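(* Let $F=\sum_{g\ge0}\lambda^{2g-2}F_g$ be the dessin free energy and $G_{g,n}(x_1,\dots,x_n)=\sum_{a_i\ge1}a_1\cdots a_n\,\partial_{p_{a_1}}\cdots\partial_{p_{a_n}}F_g|_{p=0}\prod_i x_i^{-a_i-1}$. Consider the dessin spectral curve $y^2=\frac{1}{4s^2}-\frac{u+v}{2sx}+\frac{(u-v)^2}{4x^2}$, globally parametrized by $z\in\mathbb{P}^1$ via $$x(z)=\frac{s(\alpha z^2-\beta)}{z^2-1},\qquad y(z)=-\frac{(\alpha-\beta)z}{2s(\alpha z^2-\beta)},\qquad \alpha=(\sqrt u-\sqrt v)^2,\ \beta=(\sqrt u+\sqrt v)^2,$$ so that $z=\sqrt{(1-s\beta/x)/(1-s\alpha/x)}$ (with $z\to1$ as $x\to\infty$). For $2g-2+n>0$ define the multidifferential $W_{g,n}=G_{g,n}(x(z_1),\dots,x(z_n))\,dx(z_1)\cdots dx(z_n)$. Then for every $g\ge0,n\ge1$ with $2g-2+n>0$: (1) $W_{g,n}=w_{g,n}(z_1,\dots,z_n)\,dz_1\cdots dz_n=\tilde w_{g,n}(\tilde z_1,\dots,\tilde z_n)\,d\tilde z_1\cdots d\tilde z_n$ with $\tilde z_i=1/z_i$, where $w_{g,n}$ (resp. $\tilde w_{g,n}$) is a Laurent polynomial in $z_1,\dots,z_n$ (resp. $\tilde z_1,\dots,\tilde z_n$) containing only terms of even degree in each variable; and (2) $W_{g,n}=\omega_{g,n}$, where $\omega_{g,n}$ are the Eynard–Orantin invariants of this spectral curve defined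 in the context.
   Context: Let $s,u,v$ be parameters with $s\ne0$, $uv\ne0$ (fixed square roots $\sqrt u,\sqrt v$), and $\lambda$ a genus-tracking parameter. For $n\ge0$ define $$L_n=-\frac{n+1}{s}\frac{\partial}{\partial p_{n+1}}+(u+v)n\frac{\partial}{\partial p_n}+\sum_{j\ge1}p_j(n+j)\frac{\partial}{\partial p_{n+j}}+\lambda^2\sum_{i+j=n,\ i,j\ge1}ij\frac{\partial^2}{\partial p_i\partial p_j}+\delta_{n,0}\,uv\,\lambda^{-2}.$$ The dessin free energy $F=\sum_{g\ge0}\lambda^{2g-2}F_g$ (logarithm of the Kazarian–Zograf generating series of Grothendieck's dessins d'enfants, each $F_g$ a formal power series in $p_1,p_2,\dots$ vanishing at $p=0$) is characterized by $L_ne^F=0$ for all $n\ge0$. The series $G_{g,n}$ in $x_i^{-1}$ are identified with functions of $z_i$ via $x_i=x(z_i)$ (expansion near $z_i=1$). Eynard–Orantin data: involution $\sigma(z)=-z$ (i.e. $(x,y)\mapsto(x,-y)$); branch points $z=0$ and $z=\infty$ (zeros of $dx$); $\omega_{0,1}=y\,dx$; $\omega_{0,2}(z_1,z_2)=B(z_1,z_2)=\frac{dz_1dz_2}{(z_1-z_2)^2}$; recursion kernel $$K(z_0,z)=\frac{\frac12\int_{q=-z}^{z}B(z_0,q)}{2y(z)\,dx(z)}=\frac{(\alpha z^2-\beta)(z^2-1)^2}{2(\alpha-\beta)^2z(z_0^2-z^2)}\frac{dz_0}{dz}.$$ For $2g-2+(n+1)>0$, $$\omega_{g,n+1}(z_0,z_{[n]})=\Big(\operatorname{Res}_{z\to0}+\operatorname{Res}_{z\to\infty}\Big)K(z_0,z)\Big[\omega_{g-1,n+2}(z,-z,z_{[n]})+\sum_{\substack{g_1+g_2=g\\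 I\sqcup J=[n]}}{}'\omega_{g_1,|I|+1}(z,z_I)\,\omega_{g_2,|J|+1}(-z,z_J)\Big],$$ where $[n]=\{1,\dots,n\}$, $\omega_{-1,\cdot}=0$, and $\sum'$ excludes the terms with $(g_1,I)=(0,\emptyset)$ or $(g_2,J)=(0,\emptyset)$. *)

theory Defs
  imports "HOL-Complex_Analysis.Complex_Analysis" "HOL-Library.Multiset"
begin

text \<open>su, sv are the fixed square roots of u, v.\<close>
definition dessin_alpha :: "complex \<Rightarrow> complex \<Rightarrow> complex" where
  "dessin_alpha su sv = (su - sv)^2"

definition dessin_beta :: "complex \<Rightarrow> complex \<Rightarrow> complex" where
  "dessin_beta su sv = (su + sv)^2"

definition curve_x :: "complex \<Rightarrow> complex \<Rightarrow> complex \<Rightarrow> complex \<Rightarrow> complex" where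
  "curve_x s \<alpha> \<beta> z = s * (\<alpha> * z^2 - \<beta>) / (z^2 - 1)"

definition curve_y :: "complex \<Rightarrow> complex \<Rightarrow> complex \<Rightarrow> complex \<Rightarrow> complex" where
  "curve_y s \<alpha> \<beta> z = - ((\<alpha> - \<beta>) * z) / (2 * s * (\<alpha> * z^2 - \<beta>))"

text \<open>A formal power series in p_1,p_2,... is represented by its coefficient function
  on monomials; the monomial prod_{k in m} p_k is encoded by the multiset m of positive
  indices. dP f k is the coefficient function of the partial derivative d/dp_k.\<close>

definition dP :: "(nat multiset \<Rightarrow> complex) \<Rightarrow> nat \<Rightarrow> nat multiset \<Rightarrow> complex" where
  "dP f k m = of_nat (count m k + 1) * f (m + {#k#})"

definition prodc :: "(nat multiset \<Rightarrow> complex) \<Rightarrow> (nat multiset \<Rightarrow> complex) \<Rightarrow> nat multiset \<Rightarrow> complex" where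
  "prodc f h m = (\<Sum>m1 \<in> {m1. m1 \<subseteq># m}. f m1 * h (m - m1))"

text \<open>Coefficient of lambda^(2g-2) p^m in  e^(-F) L_n e^F, where F = sum_g lambda^(2g-2) F_g
  and c g is the coefficient function of F_g.\<close>
definition L_coeff :: "complex \<Rightarrow> complex \<Rightarrow> complex \<Rightarrow> (nat \<Rightarrow> nat multiset \<Rightarrow> complex)
    \<Rightarrow> nat \<Rightarrow> nat \<Rightarrow> nat multiset \<Rightarrow> complex" where
  "L_coeff s u v c n g m =
     - (of_nat (n + 1) / s) * dP (c g) (n + 1) m
     + (u + v) * of_nat n * dP (c g) n m
     + (\<Sum>j \<in> set_mset m. of_nat (n + j) * dP (c g) (n + j) (m - {#j#}))
     + (\<Sum>i \<in> {1..<n}. of_nat (i * (n - i)) *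
          ((if 1 \<le> g then dP (dP (c (g - 1)) i) (n - i) m else 0)
           + (\<Sum>g1 \<in> {0..g}. prodc (dP (c g1) i) (dP (c (g - g1)) (n - i)) m)))
     + (if n = 0 \<and> g = 0 \<and> m = {#} then u * v else 0)"

text \<open>c is the dessin free energy: each F_g vanishes at p = 0, only involves p_1,p_2,...,
  and L_n e^F = 0 for all n (equivalently e^(-F) L_n e^F = 0, genus by genus).\<close>
definition dessin_free_energy :: "complex \<Rightarrow> complex \<Rightarrow> complex \<Rightarrow> (nat \<Rightarrow> nat multiset \<Rightarrow> complex) \<Rightarrow> bool" where
  "dessin_free_energy s u v c \<longleftrightarrow>
     (\<forall>g m. (m = {#} \<or> 0 \<in># m) \<longrightarrow> c g m = 0) \<and>
     (\<forall>n g m. 0 \<notin># m \<longrightarrow> L_coeff s u v c n g m = 0)"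

text \<open>Coefficient of prod_i x_i^(-a_i-1) in G_{g,n}:
  a_1...a_n * d_{p_{a_1}}...d_{p_{a_n}} F_g at p = 0.\<close>
definition G_coeff :: "(nat \<Rightarrow> nat multiset \<Rightarrow> complex) \<Rightarrow> nat \<Rightarrow> nat list \<Rightarrow> complex" where
  "G_coeff c g a = of_nat (prod_list a) * (\<Prod>k \<in> set a. of_nat (fact (count (mset a) k))) * c g (mset a)"

definition even_laurent_poly :: "nat \<Rightarrow> (complex list \<Rightarrow> complex) \<Rightarrow> bool" where
  "even_laurent_poly n f \<longleftrightarrow>
     (\<exists>E :: int list set. \<exists>coef :: int list \<Rightarrow> complex.
        finite E \<and> (\<forall>e\<in>E. length e = n \<and> (\<forall>k\<in>set e. even k)) \<and>
        (\<forall>zs. length zs = n \<and> (\<forall>z\<in>set zs. z \<noteq> 0) \<longrightarrow>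
              f zs = (\<Sum>e\<in>E. coef e * (\<Prod>i<n. (zs ! i) powi (e ! i)))))"

definition residue_inf :: "(complex \<Rightarrow> complex) \<Rightarrow> complex" where
  "residue_inf f = - residue (\<lambda>w. f (1 / w) / w^2) 0"

text \<open>Recursion kernel K(z0,z) = EO_kernel * dz0/dz.\<close>
definition EO_kernel :: "complex \<Rightarrow> complex \<Rightarrow> complex \<Rightarrow> complex \<Rightarrow> complex" where
  "EO_kernel \<alpha> \<beta> z0 z = (\<alpha> * z^2 - \<beta>) * (z^2 - 1)^2 / (2 * (\<alpha> - \<beta>)^2 * z * (z0^2 - z^2))"

text \<open>om g n zs is the coefficient of dz_1...dz_n in omega_{g,n}. The bracket below is the
  coefficient of dz dz in  omega_{g-1,n+2}(z,-z,zs) + sum' omega(z,zs_I) omega(-z,zs_J);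
  the overall minus sign comes from d(-z) = -dz.\<close>
definition EO_bracket :: "(nat \<Rightarrow> nat \<Rightarrow> complex list \<Rightarrow> complex) \<Rightarrow> nat \<Rightarrow> nat \<Rightarrow> complex list \<Rightarrow> complex \<Rightarrow> complex" where
  "EO_bracket om g n zs z =
     - ((if 1 \<le> g then om (g - 1) (n + 2) (z # (- z) # zs) else 0)
        + (\<Sum>g1 \<in> {0..g}. \<Sum>I \<in> Pow {0..<n}.
             if (g1 = 0 \<and> I = {}) \<or> (g1 = g \<and> I = {0..<n}) then 0
             else om g1 (card I + 1) (z # nths zs I)
                  * om (g - g1) (n - card I + 1) ((- z) # nths zs ({0..<n} - I))))"

definition EO_invariants :: "complex \<Rightarrow> complex \<Rightarrow> complex \<Rightarrow> (nat \<Rightarrow> nat \<Rightarrow> complex list \<Rightarrow> complex) \<Rightarrow> bool" where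
  "EO_invariants s \<alpha> \<beta> om \<longleftrightarrow>
     (\<forall>z. om 0 1 [z] = curve_y s \<alpha> \<beta> z * deriv (curve_x s \<alpha> \<beta>) z) \<and>
     (\<forall>z1 z2. om 0 2 [z1, z2] = 1 / (z1 - z2)^2) \<and>
     (\<forall>g n z0 zs. length zs = n \<and> 2 \<le> 2 * g + n \<longrightarrow>
        om g (Suc n) (z0 # zs) =
          (let f = (\<lambda>z. EO_kernel \<alpha> \<beta> z0 z * EO_bracket om g n zs z)
           in residue f 0 + residue_inf f))"

end

theory Submission
  imports Defs
begin

text \<open>
  Put \<open>t = 1/x\<close> and \<open>q = z\<^sup>2\<close>. The Virasoro constraints say that the coefficients of \<open>G\<^sub>g\<^sub>,\<^sub>n\<close> satisfy a loop
  equation which is linear in the first variable with invertible prefactor \<open>- 2 y\<close>, so it determines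
  \<open>G\<^sub>g\<^sub>,\<^sub>n\<^sub>+\<^sub>1\<close> from the terms of lower complexity. On the other side, if the lower invariants are even
  Laurent polynomials, then so are the residues at \<open>0\<close> and \<open>\<infinity>\<close>: writing \<open>K(z\<^sub>0,z) = \<kappa>(z) z / (z\<^sub>0\<^sup>2 - z\<^sup>2)\<close>, the
  residues of \<open>K(z\<^sub>0,z) q\<^sup>l\<close> add up to \<open>\<kappa>(z\<^sub>0) q\<^sub>0\<^sup>l\<close>, and those of \<open>K(z\<^sub>0,z) q\<^sup>l\<close> times the even part of
  \<open>B(z,w)\<close> to the \<open>w\<close>-derivative of a divided difference of \<open>\<kappa>(z) q\<^sup>l\<close> at \<open>z\<^sub>0\<close>, \<open>w\<close>. Expanding these in
  \<open>t\<close>, with \<open>2 y \<kappa> dx = dz\<close>, gives exactly the loop equation, so the two recursions agree. Only one variable has to be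
  treated as a series; all other variables enter through linear functionals on Laurent polynomials
  (a point value, or a coefficient of \<open>x\<^sup>-\<^sup>a\<^sup>-\<^sup>1\<close>).
\<close>

section \<open>The loop equation for coefficients\<close>

text \<open>For every stable (g,n) one finite list of monomials, a \<open>tensor\<close>, is built
  and evaluated twice: at points it gives omega_{g,n}, at coefficient functionals it gives G_{g,n}.
  The tensor operations are verified over an arbitrary field for the free variable, so the same
  identities serve the complex numbers and the Laurent series in t. The obstacle is the unstable
  factor of type (0,2). On the residue side it is the even part of B. On the series side it splits
  into G_{0,2}, which is not a Laurent polynomial in the z_i, and a truncated shift coming from p_j
  (n+j) d/dp_{n+j}; only the combination of the two is again a tensor. These two cases are computed
  separately and start the induction. The minus sign of the bracket, which comes from d(-z) = -dz,
  corresponds to the sign of the prefactor -2y.\<close>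

definition p_deriv_at_0 :: "(nat multiset \<Rightarrow> complex) \<Rightarrow> nat list \<Rightarrow> complex" where
  "p_deriv_at_0 f A = (\<Prod>k \<in> set A. fact (count (mset A) k)) * f (mset A)"

lemma prod_fact_count_superset:
  assumes "finite B" "set A \<subseteq> B"
  shows "(\<Prod>k \<in> set A. fact (count (mset A) k)) = (\<Prod>k \<in> B. fact (count (mset A) k) :: complex)"
  using assms by (intro prod.mono_neutral_left) (auto simp: count_mset_0_iff[THEN iffD2])

lemma prod_fact_count_Cons:
  "(\<Prod>k \<in> set (x # A). fact (count (mset (x # A)) k)) =
     (of_nat (count (mset A) x + 1) * (\<Prod>k \<in> set A. fact (count (mset A) k)) :: complex)"
proof -
  let ?B = "insert x (set A)"
  have "(\<Prod>k \<in> ?B. fact (count (mset (x # A)) k) :: complex) =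
      fact (count (mset A) x + 1) * (\<Prod>k \<in> ?B - {x}. fact (count (mset A) k))"
    by (subst prod.remove[of _ x]) (auto intro!: prod.cong simp del: fact_Suc split: if_splits)
  also have "\<dots> = of_nat (count (mset A) x + 1) * (\<Prod>k \<in> ?B. fact (count (mset A) k))"
    by (subst prod.remove[of ?B x]) (auto simp: algebra_simps)
  also have "(\<Prod>k \<in> ?B. fact (count (mset A) k) :: complex) = (\<Prod>k \<in> set A. fact (count (mset A) k))"
    by (rule prod_fact_count_superset[symmetric]) auto
  finally show ?thesis by simp
qed

lemma p_deriv_at_0_Cons: "p_deriv_at_0 f (x # A) = p_deriv_at_0 (dP f x) A"
  unfolding p_deriv_at_0_def prod_fact_count_Cons dP_def by simp

lemma p_deriv_at_0_add: "p_deriv_at_0 (\<lambda>m. f m + h m) A = p_deriv_at_0 f A + p_deriv_at_0 h A"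
  by (simp add: p_deriv_at_0_def algebra_simps)

lemma p_deriv_at_0_cmult: "p_deriv_at_0 (\<lambda>m. r * f m) A = r * p_deriv_at_0 f A"
  by (simp add: p_deriv_at_0_def algebra_simps)

lemma p_deriv_at_0_sum:
  "p_deriv_at_0 (\<lambda>m. \<Sum>i\<in>S. f i m) A = (\<Sum>i\<in>S. p_deriv_at_0 (f i) A)"
  by (simp add: p_deriv_at_0_def sum_distrib_left)

lemma finite_submultisets: "finite {m1. m1 \<subseteq># m}"
proof (induction m)
  case (add x m)
  have "{m1. m1 \<subseteq># add_mset x m} \<subseteq> {m1. m1 \<subseteq># m} \<union> add_mset x ` {m1. m1 \<subseteq># m}"
  proof
    fix m1 assume m1: "m1 \<in> {m1. m1 \<subseteq># add_mset x m}"
    show "m1 \<in> {m1. m1 \<subseteq># m} \<union> add_mset x ` {m1. m1 \<subseteq># m}"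
    proof (cases "x \<in># m1")
      case True
      then obtain m2 where "m1 = add_mset x m2" by (metis mset_add)
      with m1 show ?thesis by auto
    next
      case False
      have "count m1 k \<le> count m k" for k
        using m1 False by (cases "k = x") (auto simp: subseteq_mset_def not_in_iff dest: spec[of _ k])
      thus ?thesis by (auto simp: subseteq_mset_def)
    qed
  qed
  thus ?case using add by (meson finite_UnI finite_imageI finite_subset)
qed auto

text \<open>The multiplicity of x in \<open>m + {#x#}\<close> is the sum of its multiplicities in
  the two halves of a splitting, and each summand yields one Leibniz term. A splitting whose
  relevant half misses x has weight 0; the others are in bijection with the splittings of m.\<close>

lemma dP_prodc: "dP (prodc f h) x = (\<lambda>m. prodc (dP f x) h m + prodc f (dP h x) m)"
proof
  fix m :: "nat multiset"
  define S where "S = {m1. m1 \<subseteq># m + {#x#}}"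
  have fin: "finite S"
    unfolding S_def by (rule finite_submultisets)
  have cnt: "count m x + 1 = count m1 x + count (m + {#x#} - m1) x" if "m1 \<in> S" for m1
  proof -
    have "count m1 x \<le> count (m + {#x#}) x"
      using that unfolding S_def subseteq_mset_def by blast
    thus ?thesis by simp
  qed
  have "dP (prodc f h) x m =
      (\<Sum>m1\<in>S. of_nat (count m1 x) * f m1 * h (m + {#x#} - m1)) +
      (\<Sum>m1\<in>S. f m1 * (of_nat (count (m + {#x#} - m1) x) * h (m + {#x#} - m1)))"
    unfolding dP_def prodc_def sum_distrib_left sum.distrib[symmetric] S_def[symmetric]
    by (intro sum.cong refl) (simp only: cnt of_nat_add, simp add: algebra_simps)
  also have "(\<Sum>m1\<in>S. of_nat (count m1 x) * f m1 * h (m + {#x#} - m1)) = prodc (dP f x) h m"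
  proof -
    have "(\<Sum>m1\<in>S. of_nat (count m1 x) * f m1 * h (m + {#x#} - m1)) =
       (\<Sum>m1\<in>(\<lambda>m1. m1 + {#x#}) ` {m1. m1 \<subseteq># m}. of_nat (count m1 x) * f m1 * h (m + {#x#} - m1))"
    proof (rule sum.mono_neutral_right[OF fin])
      show "(\<lambda>m1. m1 + {#x#}) ` {m1. m1 \<subseteq># m} \<subseteq> S" by (auto simp: S_def)
      show "\<forall>i\<in>S - (\<lambda>m1. m1 + {#x#}) ` {m1. m1 \<subseteq># m}.
         of_nat (count i x) * f i * h (m + {#x#} - i) = 0"
      proof
        fix i assume i: "i \<in> S - (\<lambda>m1. m1 + {#x#}) ` {m1. m1 \<subseteq># m}"
        have "x \<notin># i"
        proof
          assume "x \<in># i"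
          then obtain j where "i = j + {#x#}" by (metis add_mset_add_single mset_add)
          with i show False by (auto simp: S_def)
        qed
        thus "of_nat (count i x) * f i * h (m + {#x#} - i) = 0"
          by (simp add: not_in_iff)
      qed
    qed
    also have "\<dots> = prodc (dP f x) h m"
      unfolding prodc_def dP_def by (subst sum.reindex) (auto simp: inj_on_def intro!: sum.cong)
    finally show ?thesis .
  qed
  also have "(\<Sum>m1\<in>S. f m1 * (of_nat (count (m + {#x#} - m1) x) * h (m + {#x#} - m1))) = prodc f (dP h x) m"
  proof -
    have "prodc f (dP h x) m =
       (\<Sum>m1\<in>{m1. m1 \<subseteq># m}. f m1 * (of_nat (count (m + {#x#} - m1) x) * h (m + {#x#} - m1)))"
      unfolding prodc_def dP_def
    proof (intro sum.cong refl)
      fix m1 assume "m1 \<in> {m1. m1 \<subseteq># m}"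
      hence "count m1 k \<le> count m k" for k by (auto simp: subseteq_mset_def)
      hence "m + {#x#} - m1 = (m - m1) + {#x#}"
        by (intro multiset_eqI) (auto simp: Suc_diff_le)
      thus "f m1 * (of_nat (count (m - m1) x + 1) * h (m - m1 + {#x#})) =
         f m1 * (of_nat (count (m + {#x#} - m1) x) * h (m + {#x#} - m1))"
        by simp
    qed
    also have "\<dots> = (\<Sum>m1\<in>S. f m1 * (of_nat (count (m + {#x#} - m1) x) * h (m + {#x#} - m1)))"
    proof (rule sum.mono_neutral_left[OF fin])
      show "{m1. m1 \<subseteq># m} \<subseteq> S" by (auto simp: S_def) (metis add_mset_add_single mset_subset_eq_add_left subset_mset.trans)
      show "\<forall>i\<in>S - {m1. m1 \<subseteq># m}. f i * (of_nat (count (m + {#x#} - i) x) * h (m + {#x#} - i)) = 0"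
      proof
        fix i assume i: "i \<in> S - {m1. m1 \<subseteq># m}"
        have "count (m + {#x#} - i) x = 0"
        proof (rule ccontr)
          assume "count (m + {#x#} - i) x \<noteq> 0"
          hence "count i x \<le> count m x" by simp
          with i show False by (auto simp: S_def subseteq_mset_def split: if_splits)
        qed
        thus "f i * (of_nat (count (m + {#x#} - i) x) * h (m + {#x#} - i)) = 0" by simp
      qed
    qed
    finally show ?thesis ..
  qed
  finally show "dP (prodc f h) x m = prodc (dP f x) h m + prodc f (dP h x) m" .
qed

section \<open>Derivatives of products as sums over sets of positions\<close>

lemma sum_Pow_Suc:
  "(\<Sum>I\<in>Pow {0..<Suc n}. F I) =
   (\<Sum>I\<in>Pow {0..<n}. F (insert 0 (Suc ` I)) + (F (Suc ` I) :: 'a :: comm_monoid_add))"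
proof -
  have eq: "{0..<Suc n} = insert 0 (Suc ` {0..<n})" by (simp add: atLeast0_lessThan_Suc_eq_insert_0)
  have inj: "inj_on (insert 0) (Pow (Suc ` {0..<n}))"
    proof (rule inj_onI)
    fix x y :: "nat set"
    assume "x \<in> Pow (Suc ` {0..<n})" "y \<in> Pow (Suc ` {0..<n})" "insert 0 x = insert 0 y"
    moreover from this have "0 \<notin> x" "0 \<notin> y" by auto
    ultimately show "x = y" by (metis insert_ident)
  qed
  have inj2: "inj_on ((`) Suc) (Pow {0..<n})"
    by (auto simp: inj_on_def)
  have "(\<Sum>I\<in>Pow {0..<Suc n}. F I) =
      (\<Sum>I\<in>Pow (Suc ` {0..<n}). F I) + (\<Sum>I\<in>insert 0 ` Pow (Suc ` {0..<n}). F I)"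
    unfolding eq Pow_insert by (rule sum.union_disjoint) auto
  also have "\<dots> = (\<Sum>I\<in>Pow {0..<n}. F (Suc ` I)) + (\<Sum>I\<in>Pow {0..<n}. F (insert 0 (Suc ` I)))"
    unfolding image_Pow_surj[OF refl, symmetric]
    using inj by (simp add: image_Pow_surj[OF refl, symmetric] sum.reindex[OF inj2] o_def sum.reindex
      del: image_Suc_atLeastLessThan)
  finally show ?thesis by (simp add: sum.distrib add.commute)
qed

lemma nths_Cons_image_Suc [simp]:
  "nths (x # A) (insert 0 (Suc ` I)) = x # nths A I"
  "nths (x # A) (Suc ` I) = nths A I"
  "nths (x # A) ({0..<Suc n} - insert 0 (Suc ` I)) = nths A ({0..<n} - I)"
  "nths (x # A) ({0..<Suc n} - Suc ` I) = x # nths A ({0..<n} - I)"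
  by (auto simp: nths_Cons intro!: arg_cong[of _ _ "nths A"])

text \<open>The factorials in \<open>p_deriv_at_0\<close> turn a sum over submultisets into one over
  sets of positions, which is the index set of \<open>EO_bracket\<close>. In the induction the
  derivative along the head falls on one of the two factors, that is, position 0 joins I or its
  complement.\<close>

lemma p_deriv_at_0_prodc:
  "p_deriv_at_0 (prodc f h) A =
     (\<Sum>I\<in>Pow {0..<length A}. p_deriv_at_0 f (nths A I) * p_deriv_at_0 h (nths A ({0..<length A} - I)))"
proof (induction A arbitrary: f h)
  case Nil
  have "{m1. m1 = {#}} = {{#}::nat multiset}" by auto
  thus ?case by (simp add: p_deriv_at_0_def prodc_def)
next
  case (Cons x A)
  show ?case
    unfolding p_deriv_at_0_Cons dP_prodc p_deriv_at_0_add Cons length_Cons sum_Pow_Suc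
    by (simp add: p_deriv_at_0_Cons sum.distrib)
qed

lemma mset_nths_split:
  "mset A = mset (nths A I) + mset (nths A ({0..<length A} - I))"
proof (induction A arbitrary: I)
  case (Cons x A)
  have "nths (x # A) ({0..<length (x # A)} - I) =
      (if 0 \<in> I then [] else [x]) @ nths A ({0..<length A} - {j. Suc j \<in> I})"
    by (auto simp: nths_Cons intro!: arg_cong[of _ _ "nths A"])
  thus ?case using Cons[of "{j. Suc j \<in> I}"] by (auto simp: nths_Cons)
qed auto

lemma nths_singleton_index: "k < length A \<Longrightarrow> nths A {k} = [A ! k]"
proof (induction A arbitrary: k)
  case (Cons x A)
  have "{j. Suc j = k} = (if k = 0 then {} else {k - 1})" by auto
  thus ?case using Cons by (auto simp: nths_Cons)
qed auto

lemma sum_list_map_eq_sum_count_mset: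
  fixes g :: "'a \<Rightarrow> 'b :: semiring_1"
  assumes "finite B" "set A \<subseteq> B"
  shows "sum_list (map g A) = (\<Sum>j\<in>B. of_nat (count (mset A) j) * g j)"
  using assms(2)
proof (induction A)
  case (Cons a A)
  have "(\<Sum>j\<in>B. of_nat (count (mset (a # A)) j) * g j) =
     (\<Sum>j\<in>B. of_nat (count (mset A) j) * g j + (if a = j then g j else 0))"
    by (intro sum.cong) (auto simp: algebra_simps)
  also have "\<dots> = (\<Sum>j\<in>B. of_nat (count (mset A) j) * g j) + g a"
    using Cons assms(1) by (simp add: sum.distrib)
  finally show ?case using Cons by (simp add: add.commute)
qed auto

text \<open>Differentiating a factor p_j away leaves the multiplicity of j in the list as a weight,
  and counting j with this multiplicity amounts to summing over positions.\<close>

lemma p_deriv_at_0_mult_p: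
  "p_deriv_at_0 (\<lambda>m. \<Sum>j \<in> set_mset m. F j (m - {#j#})) A =
     (\<Sum>k<length A. p_deriv_at_0 (F (A ! k)) (nths A ({0..<length A} - {k})))"
proof -
  define g where "g j = (\<Prod>k \<in> set A. fact (count (mset A - {#j#}) k)) * F j (mset A - {#j#})" for j
  have "p_deriv_at_0 (F (A ! k)) (nths A ({0..<length A} - {k})) = g (A ! k)" if "k < length A" for k
  proof -
    have m: "mset (nths A ({0..<length A} - {k})) = mset A - {#A ! k#}"
      using mset_nths_split[of A "{k}"] nths_singleton_index[OF that] by simp
    have "set (nths A ({0..<length A} - {k})) \<subseteq> set A" by (rule set_nths_subset)
    from prod_fact_count_superset[OF _ this] show ?thesis
      by (simp add: p_deriv_at_0_def g_def m)
  qed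
  hence "(\<Sum>k<length A. p_deriv_at_0 (F (A ! k)) (nths A ({0..<length A} - {k}))) = (\<Sum>k<length A. g (A ! k))"
    by simp
  also have "\<dots> = sum_list (map g A)"
    by (simp add: sum_list_sum_nth atLeast0LessThan)
  also have "\<dots> = (\<Sum>j\<in>set A. of_nat (count (mset A) j) * g j)"
    by (rule sum_list_map_eq_sum_count_mset) auto
  also have "\<dots> = (\<Sum>j\<in>set A. (\<Prod>k \<in> set A. fact (count (mset A) k)) * F j (mset A - {#j#}))"
  proof (intro sum.cong refl)
    fix j assume j: "j \<in> set A"
    hence "count (mset A) j \<noteq> 0" by (metis count_eq_zero_iff set_mset_mset)
    then obtain c where c: "count (mset A) j = Suc c" by (meson not0_implies_Suc)
    have "(\<Prod>k \<in> set A. fact (count (mset A) k) :: complex) =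
       of_nat (count (mset A) j) * (\<Prod>k \<in> set A. fact (count (mset A - {#j#}) k))"
      using j c by (simp add: prod.remove[of _ j])
    thus "of_nat (count (mset A) j) * g j =
        (\<Prod>k \<in> set A. fact (count (mset A) k)) * F j (mset A - {#j#})"
      by (simp add: g_def)
  qed
  finally show ?thesis by (simp add: p_deriv_at_0_def sum_distrib_left)
qed

lemma G_coeff_eq: "G_coeff c g A = of_nat (prod_list A) * p_deriv_at_0 (c g) A"
  by (simp add: G_coeff_def p_deriv_at_0_def)

lemma prod_list_nths_split:
  "prod_list (A :: nat list) = prod_list (nths A I) * prod_list (nths A ({0..<length A} - I))"
  using mset_nths_split[of A I] by (metis mset_append prod_list.append prod_mset_prod_list)

text \<open>The derivatives along A at p = 0 are applied to the vanishing \<open>L_coeff\<close>.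
  The product of indices in \<open>G_coeff\<close> absorbs the weights m+1, m, m+j and i(m-i), so
  that only \<open>A ! k\<close> remains as a coefficient.\<close>

lemma G_coeff_recursion:
  assumes "dessin_free_energy s u v c" and pos: "\<forall>a\<in>set A. 0 < a"
  shows "G_coeff c g (Suc m # A) / s =
      (u + v) * G_coeff c g (m # A)
      + (\<Sum>k<length A. of_nat (A ! k) * G_coeff c g ((m + A ! k) # nths A ({0..<length A} - {k})))
      + (\<Sum>i = 0..m. (if 1 \<le> g then G_coeff c (g - 1) (i # (m - i) # A) else 0) +
          (\<Sum>g1 \<in> {0..g}. \<Sum>I\<in>Pow {0..<length A}. G_coeff c g1 (i # nths A I) *
              G_coeff c (g - g1) ((m - i) # nths A ({0..<length A} - I))))
      + (if m = 0 \<and> g = 0 \<and> A = [] then u * v else 0)"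
proof -
  define P where "P = (of_nat (prod_list A) :: complex)"
  let ?ev = "\<lambda>f. P * p_deriv_at_0 f A"
  define F where "F = (\<lambda>j m'. of_nat (m + j) * dP (c g) (m + j) m')"
  have P_k: "P = of_nat (A ! k) * of_nat (prod_list (nths A ({0..<length A} - {k})))" if "k < length A" for k
    using prod_list_nths_split[of A "{k}"] nths_singleton_index[OF that] by (simp add: P_def)
  have P_I: "P * (x * y) = (of_nat (prod_list (nths A I)) * x) * (of_nat (prod_list (nths A ({0..<length A} - I))) * y)" for I x y
    using prod_list_nths_split[of A I] by (simp add: P_def mult_ac flip: of_nat_mult)
  have "L_coeff s u v c m g (mset A) = 0"
    using assms by (auto simp: dessin_free_energy_def)
  hence "0 = ?ev (\<lambda>m'. L_coeff s u v c m g m')"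
    by (simp add: p_deriv_at_0_def)
  also have "(\<lambda>m'. L_coeff s u v c m g m') =
     (\<lambda>m'. - (of_nat (m + 1) / s) * dP (c g) (m + 1) m'
     + ((u + v) * of_nat m) * dP (c g) m m'
     + (\<Sum>j \<in> set_mset m'. F j (m' - {#j#}))
     + (\<Sum>i \<in> {1..<m}. of_nat (i * (m - i)) *
          ((if 1 \<le> g then 1 else 0) * dP (dP (c (g - 1)) i) (m - i) m'
           + (\<Sum>g1 \<in> {0..g}. prodc (dP (c g1) i) (dP (c (g - g1)) (m - i)) m')))
     + (if m = 0 \<and> g = 0 then u * v else 0) * (if m' = {#} then 1 else 0))"
    by (auto simp: L_coeff_def F_def fun_eq_iff)
  also have "?ev \<dots> = - (of_nat (m + 1) / s) * ?ev (dP (c g) (m + 1))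
     + ((u + v) * of_nat m) * ?ev (dP (c g) m)
     + (\<Sum>k<length A. P * p_deriv_at_0 (F (A ! k)) (nths A ({0..<length A} - {k})))
     + (\<Sum>i \<in> {1..<m}. of_nat (i * (m - i)) *
          ((if 1 \<le> g then 1 else 0) * ?ev (dP (dP (c (g - 1)) i) (m - i))
           + (\<Sum>g1 \<in> {0..g}. \<Sum>I\<in>Pow {0..<length A}.
                P * (p_deriv_at_0 (dP (c g1) i) (nths A I) *
                p_deriv_at_0 (dP (c (g - g1)) (m - i)) (nths A ({0..<length A} - I))))))
     + (if m = 0 \<and> g = 0 then u * v else 0) * ?ev (\<lambda>m'. if m' = {#} then 1 else 0)"
    unfolding p_deriv_at_0_add p_deriv_at_0_cmult p_deriv_at_0_sum p_deriv_at_0_mult_p p_deriv_at_0_prodc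
    by (simp add: algebra_simps sum_distrib_left)
  also have "(\<Sum>k<length A. P * p_deriv_at_0 (F (A ! k)) (nths A ({0..<length A} - {k}))) =
     (\<Sum>k<length A. of_nat (A ! k) * G_coeff c g ((m + A ! k) # nths A ({0..<length A} - {k})))"
    by (intro sum.cong refl)
       (simp add: P_k F_def p_deriv_at_0_cmult G_coeff_eq p_deriv_at_0_Cons)
  also have "(\<Sum>i \<in> {1..<m}. of_nat (i * (m - i)) *
          ((if 1 \<le> g then 1 else 0) * ?ev (dP (dP (c (g - 1)) i) (m - i))
           + (\<Sum>g1 \<in> {0..g}. \<Sum>I\<in>Pow {0..<length A}.
                P * (p_deriv_at_0 (dP (c g1) i) (nths A I) *
                p_deriv_at_0 (dP (c (g - g1)) (m - i)) (nths A ({0..<length A} - I)))))) =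
    (\<Sum>i \<in> {1..<m}. (if 1 \<le> g then G_coeff c (g - 1) (i # (m - i) # A) else 0) +
          (\<Sum>g1 \<in> {0..g}. \<Sum>I\<in>Pow {0..<length A}. G_coeff c g1 (i # nths A I) *
              G_coeff c (g - g1) ((m - i) # nths A ({0..<length A} - I))))"
    unfolding distrib_left sum_distrib_left
    by (intro sum.cong arg_cong2[of _ _ _ _ "(+)"] refl)
       (simp_all only: P_I G_coeff_eq p_deriv_at_0_Cons prod_list.Cons P_def[symmetric] of_nat_mult, simp_all add: mult_ac P_def, (metis of_nat_mult prod_list_nths_split)?)
  \<comment> \<open>The ends i = 0 and i = m may be added, because \<open>G_coeff\<close> contains
    the product of all indices and vanishes at index 0.\<close>
  also have "\<dots> = (\<Sum>i = 0..m. (if 1 \<le> g then G_coeff c (g - 1) (i # (m - i) # A) else 0) +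
          (\<Sum>g1 \<in> {0..g}. \<Sum>I\<in>Pow {0..<length A}. G_coeff c g1 (i # nths A I) *
              G_coeff c (g - g1) ((m - i) # nths A ({0..<length A} - I))))"
  proof (intro sum.mono_neutral_left ballI)
    fix i assume "i \<in> {0..m} - {1..<m}"
    hence "i = 0 \<or> i = m" by auto
    thus "(if 1 \<le> g then G_coeff c (g - 1) (i # (m - i) # A) else 0) +
          (\<Sum>g1 \<in> {0..g}. \<Sum>I\<in>Pow {0..<length A}. G_coeff c g1 (i # nths A I) *
              G_coeff c (g - g1) ((m - i) # nths A ({0..<length A} - I))) = 0"
      by (auto simp: G_coeff_eq)
  qed auto
  also have "?ev (\<lambda>m'. if m' = {#} then 1 else 0) = (if A = [] then 1 else 0)"
    by (simp add: p_deriv_at_0_def P_def)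
  finally show ?thesis
    by (simp add: G_coeff_eq p_deriv_at_0_Cons P_def[symmetric] algebra_simps)
qed

section \<open>Residues at the branch points\<close>

text \<open>For \<open>L j = r\<^sup>j\<close> this is \<open>(q\<^sup>k - r\<^sup>k) / (q - r)\<close>; in general \<open>L j\<close> is the value at \<open>r\<^sup>j\<close> of a
  linear functional on Laurent polynomials in \<open>r\<close>.\<close>
definition divided_difference :: "'a::field \<Rightarrow> int \<Rightarrow> (int \<Rightarrow> 'a) \<Rightarrow> 'a" where
  "divided_difference q k L =
     (\<Sum>j\<in>{0..<k}. q powi (k - 1 - j) * L j) - (\<Sum>j\<in>{k..<0}. q powi (k - 1 - j) * L j)"

lemma divided_difference_0 [simp]: "divided_difference q 0 L = 0"
  by (simp add: divided_difference_def)

lemma divided_difference_Suc: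
  assumes "q \<noteq> 0"
  shows "divided_difference q (k + 1) L = q * divided_difference q k L + L k"
proof -
  have q: "q * (q powi (k - 1 - j) * L j) = q powi (k - j) * L j" for j
    using power_int_add[of q 1 "k - 1 - j"] assms by (simp add: mult.assoc)
  show ?thesis
  proof (cases "k \<ge> 0")
    case True
    have "(\<Sum>j\<in>{0..<k + 1}. q powi (k - j) * L j) = L k + (\<Sum>j\<in>{0..<k}. q powi (k - j) * L j)"
    proof -
      have eq: "{0..<k + 1} = insert k {0..<k}" using True by auto
      show ?thesis unfolding eq by (subst sum.insert) auto
    qed
    moreover have "{k..<0} = {}" "{k + 1..<0} = {}" using True by auto
    ultimately show ?thesis by (simp add: divided_difference_def sum_distrib_left q)
  next
    case False
    have "(\<Sum>j\<in>{k..<0}. q powi (k - j) * L j) = L k + (\<Sum>j\<in>{k + 1..<0}. q powi (k - j) * L j)"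
    proof -
      have eq: "{k..<0} = insert k {k + 1..<0}" using False by auto
      show ?thesis unfolding eq by (subst sum.insert) auto
    qed
    moreover have "{0..<k} = {}" "{0..<k + 1} = {}" using False by auto
    ultimately show ?thesis by (simp add: divided_difference_def sum_distrib_left right_diff_distrib q)
  qed
qed

text \<open>Since q is invertible the recursion also runs downwards, so one base value at k = 0
  settles all integers. This is how the residue formulas below reach negative powers of z^2.\<close>

lemma two_sided_recursion_unique:
  fixes f h u :: "int \<Rightarrow> 'a::field"
  assumes "q \<noteq> 0" "f 0 = h 0" "\<And>k. f (k + 1) = q * f k + u k" "\<And>k. h (k + 1) = q * h k + u k"
  shows "f k = h k"
proof (induction k rule: int_induct[where k = 0])
  case (step2 i)
  have "q * f (i - 1) + u (i - 1) = q * h (i - 1) + u (i - 1)"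
    using assms(3,4)[of "i - 1"] step2 by simp
  thus ?case using assms(1) by simp
qed (use assms in auto)

text \<open>For L j = r^j this is (q - r) times the divided difference; the index shift from L j to
  L (j+1) stands for multiplication by r.\<close>

lemma divided_difference_telescope:
  assumes "q \<noteq> 0"
  shows "divided_difference q k (\<lambda>j. q * L j - L (j + 1)) = q powi k * L 0 - L k"
  by (rule two_sided_recursion_unique[of q _ _ "\<lambda>j. q * L j - L (j + 1)"])
     (use assms in \<open>auto simp: divided_difference_Suc power_int_add algebra_simps\<close>)

lemma divided_difference_add:
  "divided_difference q k (\<lambda>j. L j + M j) = divided_difference q k L + divided_difference q k M"
  by (simp add: divided_difference_def sum.distrib algebra_simps)

lemma divided_difference_cmult:
  "divided_difference q k (\<lambda>j. r * L j) = r * divided_difference q k L"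
  by (simp add: divided_difference_def sum_distrib_left algebra_simps)

lemma divided_difference_conv_sum_list:
  "divided_difference q k L =
     (\<Sum>j\<leftarrow>(if 0 \<le> k then [0..k - 1] else [k..-1]). (if 0 \<le> k then 1 else -1) * (q powi (k - 1 - j) * L j))"
proof -
  have "sum_list (map f [0..k - 1]) = sum f {0..<k}" "sum_list (map f [k..-1]) = sum f {k..<0}" for f :: "int \<Rightarrow> 'a"
    by (subst sum_list_distinct_conv_sum_set; auto intro!: sum.cong)+
  thus ?thesis
    by (cases "0 \<le> k") (simp_all add: divided_difference_def sum_negf)
qed

section \<open>Sums of residues at 0 and infinity\<close>

definition eo_res :: "(complex \<Rightarrow> complex) \<Rightarrow> complex" where
  "eo_res f = residue f 0 + residue_inf f"

text \<open>Holomorphy on punctured neighbourhoods of both branch points \<open>0\<close> and \<open>\<infinity>\<close>.\<close>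
definition holo_near_branch :: "(complex \<Rightarrow> complex) \<Rightarrow> bool" where
  "holo_near_branch f \<longleftrightarrow>
     (\<exists>r>0. f holomorphic_on {z. z \<noteq> 0 \<and> (cmod z < r \<or> 1 < cmod z * r)})"

lemma holo_near_branchI:
  "r > 0 \<Longrightarrow> f holomorphic_on {z. z \<noteq> 0 \<and> (cmod z < r \<or> 1 < cmod z * r)} \<Longrightarrow> holo_near_branch f"
  by (auto simp: holo_near_branch_def)

lemma holo_near_branch_common:
  assumes "holo_near_branch f" "holo_near_branch g"
  obtains r where "r > 0" "f holomorphic_on {z. z \<noteq> 0 \<and> (cmod z < r \<or> 1 < cmod z * r)}"
    "g holomorphic_on {z. z \<noteq> 0 \<and> (cmod z < r \<or> 1 < cmod z * r)}"
proof -
  from assms obtain r1 r2 where r: "r1 > 0" "r2 > 0"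
    "f holomorphic_on {z. z \<noteq> 0 \<and> (cmod z < r1 \<or> 1 < cmod z * r1)}"
    "g holomorphic_on {z. z \<noteq> 0 \<and> (cmod z < r2 \<or> 1 < cmod z * r2)}"
    by (auto simp: holo_near_branch_def)
  define r where "r = min r1 r2"
  have "cmod z * r \<le> cmod z * r1" "cmod z * r \<le> cmod z * r2" for z
    by (auto simp: r_def intro!: mult_left_mono)
  hence le: "1 < cmod z * r \<Longrightarrow> 1 < cmod z * r1" "1 < cmod z * r \<Longrightarrow> 1 < cmod z * r2" for z
    by (auto intro: less_le_trans)
  show ?thesis
  proof (rule that[of r])
    show "r > 0" using r by (simp add: r_def)
    show "f holomorphic_on {z. z \<noteq> 0 \<and> (cmod z < r \<or> 1 < cmod z * r)}"
      by (rule holomorphic_on_subset[OF r(3)]) (use le in \<open>auto simp: r_def\<close>)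
    show "g holomorphic_on {z. z \<noteq> 0 \<and> (cmod z < r \<or> 1 < cmod z * r)}"
      by (rule holomorphic_on_subset[OF r(4)]) (use le in \<open>auto simp: r_def\<close>)
  qed
qed

lemma holo_near_branch_add: "holo_near_branch f \<Longrightarrow> holo_near_branch g \<Longrightarrow> holo_near_branch (\<lambda>z. f z + g z)"
  by (erule (1) holo_near_branch_common, rule holo_near_branchI) (auto intro!: holomorphic_intros)

lemma holo_near_branch_mult: "holo_near_branch f \<Longrightarrow> holo_near_branch g \<Longrightarrow> holo_near_branch (\<lambda>z. f z * g z)"
  by (erule (1) holo_near_branch_common, rule holo_near_branchI) (auto intro!: holomorphic_intros)

lemma holo_near_branch_const: "holo_near_branch (\<lambda>z. c)"
  by (rule holo_near_branchI[of 1]) auto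

lemma holo_near_branch_power_int: "holo_near_branch (\<lambda>z. z powi k)"
  by (rule holo_near_branchI[of 1]) (auto intro!: holomorphic_intros)

lemma holo_near_branch_pole:
  assumes "w \<noteq> 0"
  shows "holo_near_branch (\<lambda>z. 1 / (z - w))"
proof (rule holo_near_branchI)
  let ?r = "min (cmod w) (1 / cmod w)"
  show "?r > 0" using assms by simp
  have "cmod w * ?r \<le> cmod w * (1 / cmod w)" by (intro mult_left_mono) auto
  hence "\<not> 1 < cmod w * ?r" using assms by simp
  thus "(\<lambda>z. 1 / (z - w)) holomorphic_on {z. z \<noteq> 0 \<and> (cmod z < ?r \<or> 1 < cmod z * ?r)}"
    by (intro holomorphic_intros) auto
qed

lemma holo_near_branch_bidifferential:
  assumes "w \<noteq> 0"
  shows "holo_near_branch (\<lambda>z. 1 / (z - w)^2 + 1 / (z + w)^2)"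
proof -
  have "holo_near_branch (\<lambda>z. 1 / (z - w) * (1 / (z - w)) + 1 / (z - (-w)) * (1 / (z - (-w))))"
    using assms by (intro holo_near_branch_add holo_near_branch_mult holo_near_branch_pole) auto
  thus ?thesis by (simp add: power2_eq_square)
qed

lemma holo_near_branch_kernel:
  assumes "z0 \<noteq> 0"
  shows "holo_near_branch (\<lambda>z. z / (z0^2 - z^2))"
proof -
  have "holo_near_branch (\<lambda>z. (-1) * (z powi 1) * (1 / (z - z0) * (1 / (z - (-z0)))))"
    using assms by (intro holo_near_branch_mult holo_near_branch_const holo_near_branch_power_int
      holo_near_branch_pole) auto
  moreover have "(-1) * (z powi 1) * (1 / (z - z0) * (1 / (z - (-z0)))) = z / (z0^2 - z^2)" for z
  proof -
    have "z0^2 - z^2 = - ((z - z0) * (z - (-z0)))" by (simp add: algebra_simps power2_eq_square)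
    thus ?thesis by (simp del: diff_minus_eq_add)
  qed
  ultimately show ?thesis by simp
qed

lemma inverse_near_infinity:
  fixes w :: complex
  assumes "w \<in> ball 0 r - {0}"
  shows "1 / w \<noteq> 0" "1 < cmod (1 / w) * r"
proof -
  have "cmod w < r" "cmod w > 0" using assms by auto
  hence "1 < r / cmod w" by (subst less_divide_eq_1_pos) auto
  thus "1 < cmod (1 / w) * r" by (simp add: norm_divide)
qed (use assms in auto)

lemma holo_near_branch_at_0:
  assumes "f holomorphic_on {z. z \<noteq> 0 \<and> (cmod z < r \<or> 1 < cmod z * r)}"
  shows "f holomorphic_on ball 0 r - {0}" "(\<lambda>w. f (1 / w) / w^2) holomorphic_on ball 0 r - {0}"
proof -
  show "f holomorphic_on ball 0 r - {0}"
    by (rule holomorphic_on_subset[OF assms]) auto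
  have "(\<lambda>w. f (1 / w)) holomorphic_on ball 0 r - {0}"
  proof (rule holomorphic_on_compose_gen[OF _ assms, unfolded o_def])
    show "(\<lambda>w. 1 / w) holomorphic_on ball 0 r - {0}" by (intro holomorphic_intros) auto
    show "(\<lambda>w. 1 / w) ` (ball 0 r - {0}) \<subseteq> {z. z \<noteq> 0 \<and> (cmod z < r \<or> 1 < cmod z * r)}"
    proof (rule image_subsetI)
      fix w assume "w \<in> ball 0 r - {0::complex}"
      from inverse_near_infinity[OF this]
      show "1 / w \<in> {z. z \<noteq> 0 \<and> (cmod z < r \<or> 1 < cmod z * r)}" by blast
    qed
  qed
  thus "(\<lambda>w. f (1 / w) / w^2) holomorphic_on ball 0 r - {0}"
    by (intro holomorphic_intros) auto
qed

lemma eo_res_add: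
  assumes "holo_near_branch f" "holo_near_branch g"
  shows "eo_res (\<lambda>z. f z + g z) = eo_res f + eo_res g"
proof -
  obtain r where r: "r > 0"
    "f holomorphic_on {z. z \<noteq> 0 \<and> (cmod z < r \<or> 1 < cmod z * r)}"
    "g holomorphic_on {z. z \<noteq> 0 \<and> (cmod z < r \<or> 1 < cmod z * r)}"
    by (rule holo_near_branch_common[OF assms])
  note h = holo_near_branch_at_0[OF r(2)] holo_near_branch_at_0[OF r(3)]
  have "residue (\<lambda>z. f z + g z) 0 = residue f 0 + residue g 0"
    by (rule residue_add[OF open_ball _ h(1,3)]) (use r in auto)
  moreover have "residue (\<lambda>w. f (1 / w) / w^2 + g (1 / w) / w^2) 0 =
      residue (\<lambda>w. f (1 / w) / w^2) 0 + residue (\<lambda>w. g (1 / w) / w^2) 0"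
    by (rule residue_add[OF open_ball _ h(2,4)]) (use r in auto)
  ultimately show ?thesis by (simp add: eo_res_def residue_inf_def add_divide_distrib)
qed

lemma eo_res_cmult:
  assumes "holo_near_branch f"
  shows "eo_res (\<lambda>z. c * f z) = c * eo_res f"
proof -
  from assms obtain r where r: "r > 0"
    "f holomorphic_on {z. z \<noteq> 0 \<and> (cmod z < r \<or> 1 < cmod z * r)}"
    by (auto simp: holo_near_branch_def)
  note h = holo_near_branch_at_0[OF r(2)]
  have "residue (\<lambda>z. c * f z) 0 = c * residue f 0"
    by (rule residue_lmul[OF open_ball _ h(1)]) (use r in auto)
  moreover have "residue (\<lambda>w. c * (f (1 / w) / w^2)) 0 = c * residue (\<lambda>w. f (1 / w) / w^2) 0"
    by (rule residue_lmul[OF open_ball _ h(2)]) (use r in auto)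
  ultimately show ?thesis by (simp add: eo_res_def residue_inf_def algebra_simps)
qed

lemma eo_res_cong_near:
  assumes "r > 0" "\<And>z. z \<noteq> 0 \<Longrightarrow> cmod z < r \<or> 1 < cmod z * r \<Longrightarrow> f z = g z"
  shows "eo_res f = eo_res g"
proof -
  have ev: "\<forall>\<^sub>F w in at 0. w \<in> ball 0 r - {0::complex}"
    using eventually_at_in_open[of "ball 0 r" "0::complex"] assms(1) by simp
  have "residue f 0 = residue g 0"
    by (rule residue_cong, rule eventually_mono[OF ev]) (use assms in auto)
  moreover have "residue (\<lambda>w. f (1 / w) / w^2) 0 = residue (\<lambda>w. g (1 / w) / w^2) 0"
  proof (rule residue_cong, rule eventually_mono[OF ev])
    fix w assume "w \<in> ball 0 r - {0::complex}"
    from inverse_near_infinity[OF this]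
    show "f (1 / w) / w^2 = g (1 / w) / w^2" using assms(2) by simp
  qed auto
  ultimately show ?thesis by (simp add: eo_res_def residue_inf_def)
qed

lemma eo_res_cong: "(\<And>z. z \<noteq> 0 \<Longrightarrow> f z = g z) \<Longrightarrow> eo_res f = eo_res g"
  by (rule eo_res_cong_near[of 1]) auto

lemma eo_res_sum:
  assumes "\<And>i. i \<in> S \<Longrightarrow> holo_near_branch (f i)"
  shows "holo_near_branch (\<lambda>z. \<Sum>i\<in>S. f i z)" "eo_res (\<lambda>z. \<Sum>i\<in>S. f i z) = (\<Sum>i\<in>S. eo_res (f i))"
proof -
  have "holo_near_branch (\<lambda>z. \<Sum>i\<in>S. f i z) \<and> eo_res (\<lambda>z. \<Sum>i\<in>S. f i z) = (\<Sum>i\<in>S. eo_res (f i))"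
    using assms
  proof (induction S rule: infinite_finite_induct)
    case (insert x S)
    thus ?case by (simp add: holo_near_branch_add eo_res_add)
  qed (use eo_res_cmult[OF holo_near_branch_const[of 0], of 0] in \<open>auto simp: holo_near_branch_const\<close>)
  thus "holo_near_branch (\<lambda>z. \<Sum>i\<in>S. f i z)" "eo_res (\<lambda>z. \<Sum>i\<in>S. f i z) = (\<Sum>i\<in>S. eo_res (f i))" by auto
qed

lemma residue_power_int: "residue (\<lambda>z. z powi k) 0 = (if k = -1 then 1 else 0)"
proof (cases "k \<ge> 0")
  case True
  hence "(\<lambda>z::complex. z powi k) holomorphic_on UNIV" by (auto intro!: holomorphic_intros)
  with True show ?thesis by (subst residue_holo[of UNIV]) auto
next
  case False
  define n where "n = nat (- k - 1)"
  have k: "k = - int (Suc n)" using False by (simp add: n_def)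
  have "residue (\<lambda>z. 1 / z ^ Suc n) 0 = (deriv ^^ n) (\<lambda>_::complex. 1) 0 / fact n"
    by (rule residue_holomorphic_over_power'[of UNIV]) auto
  also have "(\<lambda>z::complex. 1 / z ^ Suc n) = (\<lambda>z. z powi k)"
    by (simp only: k power_int_minus power_int_of_nat inverse_eq_divide)
  also have "(deriv ^^ n) (\<lambda>_::complex. 1) 0 / fact n = (if n = 0 then 1 else 0)"
    by simp
  finally show ?thesis using k by auto
qed

text \<open>The residues of z^k dz at 0 and at infinity are opposite, also for k = -1.\<close>

lemma eo_res_power_int: "eo_res (\<lambda>z. z powi k) = 0"
proof -
  have "residue (\<lambda>w. (1 / w) powi k / w^2) 0 = residue (\<lambda>w::complex. w powi (- k - 2)) 0"
  proof (rule residue_cong)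
    have "(1 / w) powi k / w^2 = w powi (- k - 2)" if "w \<noteq> 0" for w :: complex
      using that by (simp add: power_int_diff power_int_minus power_int_divide_distrib inverse_eq_divide)
    thus "\<forall>\<^sub>F w::complex in at 0. (1 / w) powi k / w^2 = w powi (- k - 2)"
      unfolding eventually_at_filter by (intro always_eventually) blast
  qed auto
  thus ?thesis by (simp add: eo_res_def residue_inf_def residue_power_int)
qed

text \<open>There is no pole at 0, so only infinity contributes. In w = 1/z there is a simple pole
  with numerator h, and the minus sign is that of \<open>residue_inf\<close>.\<close>

lemma eo_res_eq_at_infinity:
  assumes "r > 0" "f holomorphic_on ball 0 r" "h holomorphic_on ball 0 r"
    and "\<And>w. w \<in> ball 0 r - {0} \<Longrightarrow> f (1 / w) / w^2 = h w / w"
  shows "eo_res f = - h 0"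
proof -
  have "residue f 0 = 0" by (rule residue_holo[OF open_ball _ assms(2)]) (use assms in auto)
  moreover have "residue (\<lambda>w. f (1 / w) / w^2) 0 = residue (\<lambda>w. h w / (w - 0)) 0"
  proof (rule residue_cong)
    have "\<forall>\<^sub>F w in at 0. w \<in> ball 0 r - {0::complex}"
      using eventually_at_in_open[of "ball 0 r" "0::complex"] assms(1) by simp
    thus "\<forall>\<^sub>F w in at 0. f (1 / w) / w^2 = h w / (w - 0)"
      by eventually_elim (use assms(4) in auto)
  qed auto
  moreover have "residue (\<lambda>w. h w / (w - 0)) 0 = h 0"
    by (rule residue_simple[OF open_ball _ assms(3)]) (use assms in auto)
  ultimately show ?thesis by (simp add: eo_res_def residue_inf_def)
qed

text \<open>The radius min(|a|, 1/|a|) keeps both z and 1/z away from a and -a, as required in the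
  charts at 0 and at infinity.\<close>

lemma ball_small_nonzero:
  fixes a z :: complex
  assumes "z \<in> ball 0 (min (cmod a) (inverse (cmod a)))" "a \<noteq> 0"
  shows "z \<noteq> a" "z \<noteq> -a" "z * a \<noteq> 1" "z * a \<noteq> -1" "z^2 \<noteq> a^2" "z^2 * a^2 \<noteq> 1"
proof -
  have 1: "cmod z < cmod a" and 2: "cmod z < inverse (cmod a)" using assms by auto
  from 1 show "z \<noteq> a" "z \<noteq> -a" by auto
  from 2 assms(2) have "cmod (z * a) < 1" by (simp add: norm_mult field_simps)
  thus 3: "z * a \<noteq> 1" "z * a \<noteq> -1" by auto
  show "z^2 \<noteq> a^2" using \<open>z \<noteq> a\<close> \<open>z \<noteq> -a\<close> by (auto simp: power2_eq_iff)
  show "z^2 * a^2 \<noteq> 1" using 3 by (metis power2_eq_1_iff power_mult_distrib)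
qed

text \<open>Base value for \<open>eo_res_kernel_power\<close>: near infinity the integrand is -1/z
  to leading order.\<close>

lemma eo_res_kernel:
  assumes "z0 \<noteq> 0"
  shows "eo_res (\<lambda>z. z / (z0^2 - z^2)) = 1"
proof -
  let ?r = "min (cmod z0) (inverse (cmod z0))"
  have nz: "z0^2 - z^2 \<noteq> 0" "z^2 * z0^2 - 1 \<noteq> 0" if "z \<in> ball 0 ?r" for z
    using ball_small_nonzero(5,6)[OF that assms] by auto
  have "eo_res (\<lambda>z. z / (z0^2 - z^2)) = - (1 / (0^2 * z0^2 - 1))"
  proof (rule eo_res_eq_at_infinity[where r = ?r])
    show "(\<lambda>z. z / (z0^2 - z^2)) holomorphic_on ball 0 ?r"
      by (intro holomorphic_intros; erule nz)
    show "(\<lambda>w. 1 / (w^2 * z0^2 - 1)) holomorphic_on ball 0 ?r"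
      by (intro holomorphic_intros; erule nz)
  next
    fix w :: complex assume w: "w \<in> ball 0 ?r - {0}"
    hence "w \<noteq> 0" "w^2 * z0^2 - 1 \<noteq> 0" using nz(2)[of w] by auto
    moreover have "z0^2 - (1 / w)^2 = (w^2 * z0^2 - 1) / w^2"
      using w by (simp add: field_simps)
    moreover have "1 / w / (p / w^2) / w^2 = 1 / p / w" if "w \<noteq> 0" for p
      using that by (simp add: field_simps power2_eq_square)
    ultimately show "1 / w / (z0^2 - (1 / w)^2) / w^2 = 1 / (w^2 * z0^2 - 1) / w"
      by simp
  qed (use assms in auto)
  thus ?thesis by simp
qed

lemma bidifferential_at_inverse:
  fixes w a :: complex
  assumes "w \<noteq> 0"
  shows "1 / (1 / w - a)^2 + 1 / (1 / w + a)^2 = w^2 * (1 / (1 - w * a)^2 + 1 / (1 + w * a)^2)"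
proof -
  have "1 / w - a = (1 - w * a) / w" "1 / w + a = (1 + w * a) / w"
    using assms by (auto simp: field_simps)
  thus ?thesis by (simp add: power_divide algebra_simps)
qed

text \<open>At infinity the integrand behaves like 2/z.\<close>

lemma eo_res_bidifferential:
  assumes "a \<noteq> 0"
  shows "eo_res (\<lambda>z. z * (1 / (z - a)^2 + 1 / (z + a)^2)) = -2"
proof -
  let ?r = "min (cmod a) (inverse (cmod a))"
  note nz = ball_small_nonzero[OF _ assms]
  have "eo_res (\<lambda>z. z * (1 / (z - a)^2 + 1 / (z + a)^2)) = - (1 / (1 - 0 * a)^2 + 1 / (1 + 0 * a)^2)"
  proof (rule eo_res_eq_at_infinity[where r = ?r])
    show "(\<lambda>z. z * (1 / (z - a)^2 + 1 / (z + a)^2)) holomorphic_on ball 0 ?r"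
      using nz(1,2) by (intro holomorphic_intros) (auto simp: add_eq_0_iff)
    show "(\<lambda>w. 1 / (1 - w * a)^2 + 1 / (1 + w * a)^2) holomorphic_on ball 0 ?r"
      using nz(3,4) by (intro holomorphic_intros) (auto simp: add_eq_0_iff)
  next
    fix w :: complex assume w: "w \<in> ball 0 ?r - {0}"
    thus "1 / w * (1 / (1 / w - a)^2 + 1 / (1 / w + a)^2) / w^2 =
        (1 / (1 - w * a)^2 + 1 / (1 + w * a)^2) / w"
      by (subst bidifferential_at_inverse) auto
  qed (use assms in auto)
  thus ?thesis by simp
qed

text \<open>The integrand is regular at 0 and decays like z^-3 at infinity. This is the value at
  exponent 0, where the divided difference vanishes.\<close>

lemma eo_res_kernel_bidifferential:
  assumes "a \<noteq> 0" "z0 \<noteq> 0"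
  shows "eo_res (\<lambda>z. z / (z0^2 - z^2) * (1 / (z - a)^2 + 1 / (z + a)^2)) = 0"
proof -
  let ?r = "min (min (cmod a) (inverse (cmod a))) (min (cmod z0) (inverse (cmod z0)))"
  have nz: "(z - a)^2 \<noteq> 0" "(z + a)^2 \<noteq> 0" "(1 - z * a)^2 \<noteq> 0" "(1 + z * a)^2 \<noteq> 0"
    if "z \<in> ball 0 ?r" for z
  proof -
    have "z \<noteq> a" "z \<noteq> -a" "z * a \<noteq> 1" "z * a \<noteq> -1"
      using that ball_small_nonzero[of z a] assms by auto
    thus "(z - a)^2 \<noteq> 0" "(z + a)^2 \<noteq> 0" "(1 - z * a)^2 \<noteq> 0" "(1 + z * a)^2 \<noteq> 0"
      by (auto simp: add_eq_0_iff)
  qed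
  have nz': "z0^2 - z^2 \<noteq> 0" "z^2 * z0^2 - 1 \<noteq> 0" if "z \<in> ball 0 ?r" for z
  proof -
    have "z^2 \<noteq> z0^2" "z^2 * z0^2 \<noteq> 1"
      using that ball_small_nonzero[of z z0] assms by auto
    thus "z0^2 - z^2 \<noteq> 0" "z^2 * z0^2 - 1 \<noteq> 0" by auto
  qed
  have "eo_res (\<lambda>z. z / (z0^2 - z^2) * (1 / (z - a)^2 + 1 / (z + a)^2)) =
      - (0^2 / (0^2 * z0^2 - 1) * (1 / (1 - 0 * a)^2 + 1 / (1 + 0 * a)^2))"
  proof (rule eo_res_eq_at_infinity[where r = ?r])
    show "(\<lambda>z. z / (z0^2 - z^2) * (1 / (z - a)^2 + 1 / (z + a)^2)) holomorphic_on ball 0 ?r"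
      by (intro holomorphic_intros; (erule nz | erule nz'))
    show "(\<lambda>w. w^2 / (w^2 * z0^2 - 1) * (1 / (1 - w * a)^2 + 1 / (1 + w * a)^2)) holomorphic_on ball 0 ?r"
      by (intro holomorphic_intros; (erule nz | erule nz'))
  next
    fix w :: complex assume w: "w \<in> ball 0 ?r - {0}"
    hence w0: "w \<noteq> 0" "w^2 * z0^2 - 1 \<noteq> 0" using nz'(2)[of w] by auto
    have "z0^2 - (1 / w)^2 = (w^2 * z0^2 - 1) / w^2"
      using w by (simp add: field_simps)
    moreover have "1 / w / (p / w^2) * (w^2 * q) / w^2 = w^2 / p * q / w" for p q
      using w0 by (simp add: field_simps power2_eq_square)
    ultimately show "1 / w / (z0^2 - (1 / w)^2) * (1 / (1 / w - a)^2 + 1 / (1 / w + a)^2) / w^2 =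
        w^2 / (w^2 * z0^2 - 1) * (1 / (1 - w * a)^2 + 1 / (1 + w * a)^2) / w"
      by (simp only: bidifferential_at_inverse[OF w0(1)])
  qed (use assms in auto)
  thus ?thesis by simp
qed

lemma power2_power_int: "(z^2) powi k = z powi (2 * k)" for z :: "'a :: field"
  by (metis power_int_mult power_int_numeral)

lemma holo_near_branch_power2_int: "holo_near_branch (\<lambda>z. (z^2) powi k)"
  unfolding power2_power_int by (rule holo_near_branch_power_int)

lemma eo_res_odd_power: "eo_res (\<lambda>z. z * (z^2) powi k) = 0"
proof -
  have "eo_res (\<lambda>z. z * (z^2) powi k) = eo_res (\<lambda>z. z powi (1 + 2 * k))"
    by (rule eo_res_cong) (simp add: power2_power_int power_int_add)
  thus ?thesis by (simp add: eo_res_power_int)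
qed

lemma holo_near_branch_id: "holo_near_branch (\<lambda>z. z)"
  using holo_near_branch_power_int[of 1] by simp

lemmas holo_near_branch_intros =
  holo_near_branch_mult holo_near_branch_add holo_near_branch_const holo_near_branch_id
  holo_near_branch_power_int holo_near_branch_power2_int holo_near_branch_kernel
  holo_near_branch_bidifferential

text \<open>From z^2/(z0^2 - z^2) = z0^2/(z0^2 - z^2) - 1: raising the exponent multiplies by z0^2,
  up to a residue without the kernel.\<close>

lemma eo_res_kernel_shift:
  assumes "z0 \<noteq> 0" "holo_near_branch f"
  shows "eo_res (\<lambda>z. z / (z0^2 - z^2) * (z^2 * f z)) =
    z0^2 * eo_res (\<lambda>z. z / (z0^2 - z^2) * f z) - eo_res (\<lambda>z. z * f z)"
proof -
  have "eo_res (\<lambda>z. z / (z0^2 - z^2) * (z^2 * f z)) =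
    eo_res (\<lambda>z. z0^2 * (z / (z0^2 - z^2) * f z) + (-1) * (z * f z))"
  proof (rule eo_res_cong_near)
    let ?r = "min (cmod z0) (inverse (cmod z0))"
    show "?r > 0" using assms by simp
    fix z assume z: "z \<noteq> 0" "cmod z < ?r \<or> 1 < cmod z * ?r"
    have "cmod z \<noteq> cmod z0"
    proof
      assume eq: "cmod z = cmod z0"
      have "cmod z0 * ?r \<le> cmod z0 * inverse (cmod z0)" by (intro mult_left_mono) auto
      with z eq assms show False by auto
    qed
    hence "z0^2 - z^2 \<noteq> 0" by (auto simp: power2_eq_iff)
    thus "z / (z0^2 - z^2) * (z^2 * f z) = z0^2 * (z / (z0^2 - z^2) * f z) + (-1) * (z * f z)"
      by (simp add: divide_simps) (simp add: algebra_simps)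
  qed
  also have "\<dots> = z0^2 * eo_res (\<lambda>z. z / (z0^2 - z^2) * f z) + (-1) * eo_res (\<lambda>z. z * f z)"
    apply (subst eo_res_add)
    apply (intro holo_near_branch_intros assms)
    apply (intro holo_near_branch_intros assms)
    apply (subst eo_res_cmult)
    apply (intro holo_near_branch_intros assms)
    apply (subst eo_res_cmult)
    apply (intro holo_near_branch_intros assms)
    apply (rule refl)
    done
  finally show ?thesis by simp
qed

text \<open>The kernel reproduces even Laurent monomials. By the residue theorem the value is minus
  the sum of the residues at z0 and -z0, each of which is -(z0^2)^k / 2; the proof obtains it from
  the shift recursion instead.\<close>

lemma eo_res_kernel_power:
  assumes "z0 \<noteq> 0"
  shows "eo_res (\<lambda>z. z / (z0^2 - z^2) * (z^2) powi k) = (z0^2) powi k"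
proof (rule two_sided_recursion_unique[where q = "z0^2" and u = "\<lambda>_. 0"])
  fix k :: int
  have "eo_res (\<lambda>z. z / (z0^2 - z^2) * (z^2) powi (k + 1)) =
      eo_res (\<lambda>z. z / (z0^2 - z^2) * (z^2 * (z^2) powi k))"
    by (rule eo_res_cong) (simp add: power_int_add)
  also have "\<dots> = z0^2 * eo_res (\<lambda>z. z / (z0^2 - z^2) * (z^2) powi k) + 0"
    using eo_res_kernel_shift[OF assms holo_near_branch_power2_int[of k]] by (simp add: eo_res_odd_power)
  finally show "eo_res (\<lambda>z. z / (z0^2 - z^2) * (z^2) powi (k + 1)) = \<dots>" .
qed (use assms eo_res_kernel in \<open>auto simp: power_int_add\<close>)

text \<open>The factor 2k+1 comes from differentiating z^(2k+1) at the double poles a and -a. The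
  residues there are equal, and 0 and infinity carry the negative of their sum.\<close>

lemma eo_res_bidifferential_power:
  assumes "a \<noteq> 0"
  shows "eo_res (\<lambda>z. z * (z^2) powi k * (1 / (z - a)^2 + 1 / (z + a)^2)) = - 2 * (2 * of_int k + 1) * (a^2) powi k"
proof (rule two_sided_recursion_unique[where q = "a^2" and u = "\<lambda>k. - 4 * a^2 * (a^2) powi k"])
  fix k :: int
  have 1: "holo_near_branch (\<lambda>z. z * (z^2) powi k * (1 / (z - a)^2 + 1 / (z + a)^2))"
    using assms by (intro holo_near_branch_intros)
  have "eo_res (\<lambda>z. z * (z^2) powi (k + 1) * (1 / (z - a)^2 + 1 / (z + a)^2)) =
     eo_res (\<lambda>z. a^2 * (z * (z^2) powi k * (1 / (z - a)^2 + 1 / (z + a)^2))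
       + (2 * (z * (z^2) powi k) + (- 4 * a^2) * (z / (a^2 - z^2) * (z^2) powi k)))"
  proof (rule eo_res_cong_near)
    let ?r = "min (cmod a) (inverse (cmod a))"
    show "?r > 0" using assms by simp
    fix z assume z: "z \<noteq> 0" "cmod z < ?r \<or> 1 < cmod z * ?r"
    have "cmod z \<noteq> cmod a"
    proof
      assume eq: "cmod z = cmod a"
      have "cmod a * ?r \<le> cmod a * inverse (cmod a)" by (intro mult_left_mono) auto
      with z eq assms show False by auto
    qed
    hence nz: "z - a \<noteq> 0" "z + a \<noteq> 0" by (auto simp: add_eq_0_iff)
    hence nz': "a^2 - z^2 \<noteq> 0" by (auto simp: power2_eq_iff add_eq_0_iff)
    \<comment> \<open>This identity lowers the double poles at a and -a to the simple poles of the
      kernel, whose residues are already known.\<close>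
    have "(z^2 - a^2) * (1 / (z - a)^2 + 1 / (z + a)^2) = 2 - 4 * a^2 / (a^2 - z^2)"
    proof -
      have "1 / (z - a)^2 + 1 / (z + a)^2 = ((z + a)^2 + (z - a)^2) / ((z - a)^2 * (z + a)^2)"
        using nz by (subst add_frac_eq) auto
      also have "(z + a)^2 + (z - a)^2 = 2 * (z^2 + a^2)" by (simp add: power2_eq_square algebra_simps)
      also have "(z - a)^2 * (z + a)^2 = (a^2 - z^2)^2"
        unfolding power_mult_distrib[symmetric] by (simp add: power2_eq_square algebra_simps)
      finally have eq: "1 / (z - a)^2 + 1 / (z + a)^2 = 2 * (z^2 + a^2) / (a^2 - z^2)^2" .
      define d where "d = a^2 - z^2"
      have d: "z^2 = a^2 - d" "d \<noteq> 0" using nz' by (auto simp: d_def)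
      have "(a^2 - d - a^2) * (2 * (a^2 - d + a^2) / d^2) = 2 - 4 * a^2 / d"
        using d(2) by (simp add: field_simps power2_eq_square)
      thus ?thesis unfolding eq d_def[symmetric] by (simp only: d(1))
    qed
    hence "z^2 * (1 / (z - a)^2 + 1 / (z + a)^2) =
       a^2 * (1 / (z - a)^2 + 1 / (z + a)^2) + (2 - 4 * a^2 / (a^2 - z^2))"
      by (simp only: ring_distribs) (simp add: algebra_simps)
    from arg_cong[OF this, of "\<lambda>x. z * (z^2) powi k * x"]
    show "z * (z^2) powi (k + 1) * (1 / (z - a)^2 + 1 / (z + a)^2) =
       a^2 * (z * (z^2) powi k * (1 / (z - a)^2 + 1 / (z + a)^2))
       + (2 * (z * (z^2) powi k) + (- 4 * a^2) * (z / (a^2 - z^2) * (z^2) powi k))"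
      using power_int_add_1[of "z^2" k] z(1) by (simp add: algebra_simps)
  qed
  also have "\<dots> = a^2 * eo_res (\<lambda>z. z * (z^2) powi k * (1 / (z - a)^2 + 1 / (z + a)^2)) +
      (2 * eo_res (\<lambda>z. z * (z^2) powi k) + (- 4 * a^2) * eo_res (\<lambda>z. z / (a^2 - z^2) * (z^2) powi k))"
    using assms
    apply (subst eo_res_add)
    apply (intro holo_near_branch_intros; simp)
    apply (intro holo_near_branch_intros; simp)
    apply (subst eo_res_add)
    apply (intro holo_near_branch_intros; simp)
    apply (intro holo_near_branch_intros; simp)
    apply (subst eo_res_cmult)
    apply (intro holo_near_branch_intros; simp)
    apply (subst eo_res_cmult)
    apply (intro holo_near_branch_intros; simp)
    apply (subst eo_res_cmult)
    apply (intro holo_near_branch_intros; simp)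
    apply (rule refl)
    done
  finally show "eo_res (\<lambda>z. z * (z^2) powi (k + 1) * (1 / (z - a)^2 + 1 / (z + a)^2)) =
     a^2 * eo_res (\<lambda>z. z * (z^2) powi k * (1 / (z - a)^2 + 1 / (z + a)^2)) + - 4 * a^2 * (a^2) powi k"
    using eo_res_kernel_power[OF assms, of k] by (simp add: eo_res_odd_power)
next
  show "eo_res (\<lambda>z. z * (z^2) powi 0 * (1 / (z - a)^2 + 1 / (z + a)^2)) =
      - 2 * (2 * of_int 0 + 1) * (a^2) powi 0"
    using eo_res_bidifferential[OF assms] by simp
qed (use assms in \<open>auto simp: power_int_add algebra_simps\<close>)

text \<open>The inhomogeneous term of the shift recursion is given by
  \<open>eo_res_bidifferential_power\<close>, and the resulting recursion is that of a divided
  difference. Its argument 2(2j+1)a^(2j) is the a-derivative of 2a^(2j+1).\<close>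

lemma eo_res_kernel_bidifferential_power:
  assumes "a \<noteq> 0" "z0 \<noteq> 0"
  shows "eo_res (\<lambda>z. z / (z0^2 - z^2) * ((1 / (z - a)^2 + 1 / (z + a)^2) * (z^2) powi k)) =
    divided_difference (z0^2) k (\<lambda>j. 2 * (2 * of_int j + 1) * (a^2) powi j)"
proof (rule two_sided_recursion_unique[where q = "z0^2" and u = "\<lambda>j. 2 * (2 * of_int j + 1) * (a^2) powi j"])
  fix k :: int
  let ?S = "\<lambda>z. 1 / (z - a)^2 + 1 / (z + a)^2"
  have "eo_res (\<lambda>z. z / (z0^2 - z^2) * (?S z * (z^2) powi (k + 1))) =
      eo_res (\<lambda>z. z / (z0^2 - z^2) * (z^2 * (?S z * (z^2) powi k)))"
    by (rule eo_res_cong) (simp add: power_int_add)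
  also have "\<dots> = z0^2 * eo_res (\<lambda>z. z / (z0^2 - z^2) * (?S z * (z^2) powi k))
     - eo_res (\<lambda>z. z * (?S z * (z^2) powi k))"
    using assms by (intro eo_res_kernel_shift holo_near_branch_intros)
  also have "eo_res (\<lambda>z. z * (?S z * (z^2) powi k)) = - 2 * (2 * of_int k + 1) * (a^2) powi k"
    using eo_res_bidifferential_power[OF assms(1), of k] by (simp add: mult_ac)
  finally show "eo_res (\<lambda>z. z / (z0^2 - z^2) * (?S z * (z^2) powi (k + 1))) =
     z0^2 * eo_res (\<lambda>z. z / (z0^2 - z^2) * (?S z * (z^2) powi k)) + 2 * (2 * of_int k + 1) * (a^2) powi k"
    by (simp add: algebra_simps)
qed (use assms eo_res_kernel_bidifferential in \<open>auto simp: divided_difference_Suc\<close>)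

section \<open>Even Laurent polynomials in several variables\<close>

text \<open>An entry \<open>(c, [e\<^sub>1, \<dots>])\<close> stands for \<open>c \<cdot> z\<^sub>1\<^bsup>2 e\<^sub>1\<^esup> \<cdots>\<close>. Each variable is evaluated by a linear functional
  \<open>\<phi>\<close> on Laurent polynomials in \<open>z\<^sup>2\<close>, given by its values on monomials; a slice leaves the first
  variable \<open>q = z\<^sub>1\<^sup>2\<close> free.\<close>

type_synonym tensor = "(complex \<times> int list) list"

definition monom_ev :: "(int \<Rightarrow> complex) list \<Rightarrow> int list \<Rightarrow> complex" where
  "monom_ev \<phi>s e = prod_list (map2 (\<lambda>\<phi> j. \<phi> j) \<phi>s e)"

lemma monom_ev_simps [simp]:
  "monom_ev [] e = 1" "monom_ev (\<phi> # \<phi>s) (j # e) = \<phi> j * monom_ev \<phi>s e"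
  by (simp_all add: monom_ev_def)

definition tensor_ev :: "tensor \<Rightarrow> (int \<Rightarrow> complex) list \<Rightarrow> complex" where
  "tensor_ev T \<phi>s = (\<Sum>(c, e)\<leftarrow>T. c * monom_ev \<phi>s e)"

text \<open>The field of q is left open: the complex numbers for residues, Laurent series in t for
  generating functions. The other variables are evaluated to scalars, which \<open>\<iota>\<close>
  carries into that field.\<close>

definition slice_ev :: "(complex \<Rightarrow> 'a::field) \<Rightarrow> 'a \<Rightarrow> tensor \<Rightarrow> (int \<Rightarrow> complex) list \<Rightarrow> 'a" where
  "slice_ev \<iota> q T \<phi>s = (\<Sum>(c, e)\<leftarrow>T. \<iota> (c * monom_ev \<phi>s (tl e)) * q powi hd e)"

definition is_tensor :: "nat \<Rightarrow> tensor \<Rightarrow> bool" where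
  "is_tensor n T \<longleftrightarrow> (\<forall>(c, e)\<in>set T. length e = n)"

text \<open>The two instances are the identity and \<open>fls_const\<close>. With them each tensor
  operation is verified once and read on both sides of the comparison.\<close>

definition scalar_hom :: "(complex \<Rightarrow> 'a::field) \<Rightarrow> bool" where
  "scalar_hom \<iota> \<longleftrightarrow> (\<forall>x y. \<iota> (x * y) = \<iota> x * \<iota> y) \<and> (\<forall>x. \<iota> (- x) = - \<iota> x) \<and> \<iota> 1 = 1"

lemma scalar_hom_id: "scalar_hom (\<lambda>x. x)"
  by (simp add: scalar_hom_def)

lemma scalar_hom_fls_const: "scalar_hom fls_const"
  by (simp add: scalar_hom_def)

lemma scalar_homD:
  assumes "scalar_hom \<iota>"
  shows "\<iota> (x * y) = \<iota> x * \<iota> y" "\<iota> (- x) = - \<iota> x" "\<iota> 1 = 1"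
  using assms by (auto simp: scalar_hom_def)

lemma tensor_simps [simp]:
  "tensor_ev [] \<phi>s = 0" "slice_ev \<iota> q [] \<phi>s = 0" "is_tensor n []"
  "tensor_ev ((c, e) # T) \<phi>s = c * monom_ev \<phi>s e + tensor_ev T \<phi>s"
  "slice_ev \<iota> q ((c, e) # T) \<phi>s = \<iota> (c * monom_ev \<phi>s (tl e)) * q powi hd e + slice_ev \<iota> q T \<phi>s"
  "is_tensor n ((c, e) # T) \<longleftrightarrow> length e = n \<and> is_tensor n T"
  "tensor_ev (T @ U) \<phi>s = tensor_ev T \<phi>s + tensor_ev U \<phi>s"
  "slice_ev \<iota> q (T @ U) \<phi>s = slice_ev \<iota> q T \<phi>s + slice_ev \<iota> q U \<phi>s"
  "is_tensor n (T @ U) \<longleftrightarrow> is_tensor n T \<and> is_tensor n U"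
  by (auto simp: tensor_ev_def slice_ev_def is_tensor_def)

lemma slice_ev_concat: "slice_ev \<iota> q (concat Ts) \<phi>s = (\<Sum>T\<leftarrow>Ts. slice_ev \<iota> q T \<phi>s)"
  by (induction Ts) auto

lemma is_tensor_concat: "is_tensor n (concat Ts) \<longleftrightarrow> (\<forall>T\<in>set Ts. is_tensor n T)"
  by (induction Ts) auto

lemma tensor_ev_Cons_power:
  assumes "is_tensor (Suc n) T"
  shows "tensor_ev T ((\<lambda>j. q powi j) # \<phi>s) = slice_ev (\<lambda>x. x) q T \<phi>s"
  using assms
proof (induction T)
  case (Cons ce T)
  obtain c j e where "ce = (c, j # e)" using Cons.prems by (cases ce; cases "snd ce") auto
  with Cons show ?case by simp
qed auto

text \<open>Taking a coefficient is linear, so the functional in the first slot can be pulled out of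
  the finite sum over monomials.\<close>

lemma tensor_ev_Cons_fls_nth:
  assumes "is_tensor (Suc n) T"
  shows "tensor_ev T ((\<lambda>j. fls_nth (\<psi> * Q powi j) b) # \<phi>s) = fls_nth (\<psi> * slice_ev fls_const Q T \<phi>s) b"
  using assms
proof (induction T)
  case (Cons ce T)
  obtain c j e where "ce = (c, j # e)" using Cons.prems by (cases ce; cases "snd ce") auto
  moreover have "fls_nth (\<psi> * (fls_const (c * m) * Q powi j)) b = c * m * fls_nth (\<psi> * Q powi j) b" for m
    by (metis (no_types, lifting) fls_mult_const_nth(1) mult.left_commute)
  ultimately show ?case using Cons by (simp add: distrib_left del: fls_const_mult_const)
qed auto

text \<open>The linear extension of a map from monomials to tensors; \<open>mul_tensor\<close>,
  \<open>contract_tensor\<close>, \<open>prod_tensor\<close> and \<open>dd_tensor\<close> are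
  instances of it.\<close>

definition bind_tensor :: "(int list \<Rightarrow> tensor) \<Rightarrow> tensor \<Rightarrow> tensor" where
  "bind_tensor f T = concat (map (\<lambda>(c, e). map (\<lambda>(p, e'). (c * p, e')) (f e)) T)"

lemma bind_tensor_simps [simp]:
  "bind_tensor f [] = []"
  "bind_tensor f ((c, e) # T) = map (\<lambda>(p, e'). (c * p, e')) (f e) @ bind_tensor f T"
  by (simp_all add: bind_tensor_def)

lemma slice_ev_scale:
  assumes "scalar_hom \<iota>"
  shows "slice_ev \<iota> q (map (\<lambda>(p, e'). (c * p, e')) T) \<phi>s = \<iota> c * slice_ev \<iota> q T \<phi>s"
  using assms by (induction T) (auto simp: scalar_homD algebra_simps)

lemma is_tensor_scale: "is_tensor n (map (\<lambda>(p, e'). (c * p, e')) T) \<longleftrightarrow> is_tensor n T"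
  by (induction T) auto

lemma slice_ev_bind:
  assumes "scalar_hom \<iota>"
  shows "slice_ev \<iota> q (bind_tensor f T) \<phi>s = (\<Sum>(c, e)\<leftarrow>T. \<iota> c * slice_ev \<iota> q (f e) \<phi>s)"
  by (induction T) (auto simp: slice_ev_scale[OF assms])

lemma is_tensor_bind:
  "is_tensor n T \<Longrightarrow> (\<And>e. length e = n \<Longrightarrow> is_tensor m (f e)) \<Longrightarrow> is_tensor m (bind_tensor f T)"
  by (induction T) (auto simp: is_tensor_scale)

definition mul_tensor :: "(complex \<times> int) list \<Rightarrow> tensor \<Rightarrow> tensor" where
  "mul_tensor P T = bind_tensor (\<lambda>e. map (\<lambda>(p, i). (p, (hd e + i) # tl e)) P) T"

lemma is_tensor_mul: "is_tensor (Suc n) T \<Longrightarrow> is_tensor (Suc n) (mul_tensor P T)"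
  unfolding mul_tensor_def by (rule is_tensor_bind) (auto simp: is_tensor_def)

lemma slice_ev_mul:
  assumes "scalar_hom \<iota>" "q \<noteq> 0"
  shows "slice_ev \<iota> q (mul_tensor P T) \<phi>s = (\<Sum>(p, i)\<leftarrow>P. \<iota> p * q powi i) * slice_ev \<iota> q T \<phi>s"
proof -
  have "slice_ev \<iota> q (map (\<lambda>(p, i). (p, (hd e + i) # tl e)) P) \<phi>s =
      (\<Sum>(p, i)\<leftarrow>P. \<iota> p * q powi i) * (\<iota> (monom_ev \<phi>s (tl e)) * q powi hd e)" for e
    using assms by (induction P) (auto simp: scalar_homD algebra_simps power_int_add)
  thus ?thesis
    unfolding mul_tensor_def slice_ev_bind[OF assms(1)]
    by (induction T) (auto simp: scalar_homD[OF assms(1)] algebra_simps)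
qed

text \<open>Identification of the first two variables. It serves for omega(z,-z,...), since only
  even powers occur, and for the diagonal x_1 = x_2 of a generating series.\<close>

definition contract_tensor :: "tensor \<Rightarrow> tensor" where
  "contract_tensor T = bind_tensor (\<lambda>e. [(1, (hd e + hd (tl e)) # tl (tl e))]) T"

lemma is_tensor_contract: "is_tensor (Suc (Suc n)) T \<Longrightarrow> is_tensor (Suc n) (contract_tensor T)"
  unfolding contract_tensor_def by (rule is_tensor_bind) auto

lemma slice_ev_contract:
  assumes "scalar_hom \<iota>"
  shows "slice_ev \<iota> q (contract_tensor T) \<phi>s =
    (\<Sum>(c, e)\<leftarrow>T. \<iota> (c * monom_ev \<phi>s (tl (tl e))) * q powi (hd e + hd (tl e)))"
  unfolding contract_tensor_def slice_ev_bind[OF assms]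
  by (intro arg_cong[of _ _ sum_list] map_cong) (auto simp: scalar_homD[OF assms] mult_ac)

lemma tensor_ev_contract_power:
  assumes "is_tensor (Suc (Suc n)) T" "q \<noteq> 0"
  shows "tensor_ev T ((\<lambda>j. q powi j) # (\<lambda>j. q powi j) # \<phi>s) = slice_ev (\<lambda>x. x) q (contract_tensor T) \<phi>s"
  unfolding slice_ev_contract[OF scalar_hom_id] tensor_ev_def
proof (intro arg_cong[of _ _ sum_list] map_cong refl)
  fix ce assume "ce \<in> set T"
  with assms obtain c i j e where "ce = (c, i # j # e)"
    by (cases ce; cases "snd ce"; cases "tl (snd ce)") (auto simp: is_tensor_def)
  thus "(case ce of (c, e) \<Rightarrow> c * monom_ev ((powi) q # (powi) q # \<phi>s) e) =
     (case ce of (c, e) \<Rightarrow> c * monom_ev \<phi>s (tl (tl e)) * q powi (hd e + hd (tl e)))"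
    using assms(2) by (simp add: power_int_add)
qed

text \<open>Interleaves two lists so as to undo the splitting of a list by \<open>nths\<close> into
  the positions in I and those outside I.\<close>

fun merge :: "nat \<Rightarrow> nat set \<Rightarrow> 'a list \<Rightarrow> 'a list \<Rightarrow> 'a list" where
  "merge 0 I xs ys = []"
| "merge (Suc n) I xs ys =
     (if 0 \<in> I then hd xs # merge n {j. Suc j \<in> I} (tl xs) ys
      else hd ys # merge n {j. Suc j \<in> I} xs (tl ys))"

lemma length_merge [simp]: "length (merge n I xs ys) = n"
  by (induction n I xs ys rule: merge.induct) auto

lemma nths_Cons_compl:
  "nths (x # A) ({0..<Suc n} - I) = (if 0 \<in> I then [] else [x]) @ nths A ({0..<n} - {j. Suc j \<in> I})"
  by (auto simp: nths_Cons intro!: arg_cong[of _ _ "nths A"])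

lemma monom_ev_merge:
  assumes "length \<phi>s = n" "length e1 = length (nths \<phi>s I)" "length e2 = length (nths \<phi>s ({0..<n} - I))"
  shows "monom_ev \<phi>s (merge n I e1 e2) = monom_ev (nths \<phi>s I) e1 * monom_ev (nths \<phi>s ({0..<n} - I)) e2"
  using assms
proof (induction \<phi>s arbitrary: n I e1 e2)
  case (Cons \<phi> \<phi>s)
  obtain m where n: "n = Suc m" "length \<phi>s = m" using Cons.prems by auto
  show ?case
  proof (cases "0 \<in> I")
    case True
    then obtain i e1' where e1: "e1 = i # e1'" using Cons.prems by (cases e1) (auto simp: nths_Cons)
    show ?thesis using Cons.prems Cons.IH[of m e1' "{j. Suc j \<in> I}" e2] True
      unfolding n e1 nths_Cons_compl by (simp add: nths_Cons n)
  next
    case False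
    then obtain i e2' where e2: "e2 = i # e2'" using Cons.prems unfolding n nths_Cons_compl
      by (cases e2) auto
    show ?thesis using Cons.prems Cons.IH[of m e1 "{j. Suc j \<in> I}" e2'] False
      unfolding n e2 nths_Cons_compl by (simp add: nths_Cons n)
  qed
qed auto

lemma length_nths_subset:
  assumes "length xs = n" "I \<subseteq> {0..<n}"
  shows "length (nths xs I) = card I" "length (nths xs ({0..<n} - I)) = n - card I"
proof -
  have "{i. i < n \<and> i \<in> I} = I" "{i. i < n \<and> i \<in> {0..<n} - I} = {0..<n} - I" using assms by auto
  moreover have "card ({0..<n} - I) = n - card I"
    using assms by (subst card_Diff_subset) (auto intro: finite_subset)
  ultimately show "length (nths xs I) = card I" "length (nths xs ({0..<n} - I)) = n - card I"
    using assms(1) by (simp_all only: length_nths)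
qed

text \<open>The tensor of omega(z, z_I) omega(-z, z_J): the first variable is shared, so its
  exponents add, and the other variables return to their positions.\<close>

definition prod_tensor :: "nat \<Rightarrow> nat set \<Rightarrow> tensor \<Rightarrow> tensor \<Rightarrow> tensor" where
  "prod_tensor n I T U = bind_tensor (\<lambda>e. bind_tensor (\<lambda>e'. [(1, (hd e + hd e') # merge n I (tl e) (tl e'))]) U) T"

lemma is_tensor_prod:
  "is_tensor m T \<Longrightarrow> is_tensor m' U \<Longrightarrow> is_tensor (Suc n) (prod_tensor n I T U)"
  unfolding prod_tensor_def by (rule is_tensor_bind, assumption, rule is_tensor_bind, assumption) auto

lemma slice_ev_prod:
  assumes \<iota>: "scalar_hom \<iota>" and "q \<noteq> 0" "length \<phi>s = n" "I \<subseteq> {0..<n}"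
    "is_tensor (Suc (card I)) T" "is_tensor (Suc (n - card I)) U"
  shows "slice_ev \<iota> q (prod_tensor n I T U) \<phi>s =
    slice_ev \<iota> q T (nths \<phi>s I) * slice_ev \<iota> q U (nths \<phi>s ({0..<n} - I))"
proof -
  let ?J = "{0..<n} - I"
  note len = length_nths_subset[OF assms(3,4)]
  have U: "(\<Sum>(c', e')\<leftarrow>U. \<iota> c' * slice_ev \<iota> q [(1, (hd e + hd e') # merge n I (tl e) (tl e'))] \<phi>s) =
      \<iota> (monom_ev (nths \<phi>s I) (tl e)) * q powi hd e * slice_ev \<iota> q U (nths \<phi>s ?J)"
    if "length e = Suc (card I)" for e
    unfolding slice_ev_def[of _ _ U] sum_list_const_mult[symmetric]
  proof (intro arg_cong[of _ _ sum_list] map_cong refl)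
    fix ce assume "ce \<in> set U"
    then obtain c' e' where ce: "ce = (c', e')" "length e' = Suc (n - card I)"
      using assms(6) by (cases ce) (auto simp: is_tensor_def)
    have "monom_ev \<phi>s (merge n I (tl e) (tl e')) = monom_ev (nths \<phi>s I) (tl e) * monom_ev (nths \<phi>s ?J) (tl e')"
      by (rule monom_ev_merge) (use that ce len assms in auto)
    thus "(case ce of (c', e') \<Rightarrow> \<iota> c' * slice_ev \<iota> q [(1, (hd e + hd e') # merge n I (tl e) (tl e'))] \<phi>s) =
       \<iota> (monom_ev (nths \<phi>s I) (tl e)) * q powi hd e *
       (case ce of (c, e) \<Rightarrow> \<iota> (c * monom_ev (nths \<phi>s ?J) (tl e)) * q powi hd e)"
      using assms(2) by (simp add: ce scalar_homD[OF \<iota>] power_int_add mult_ac)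
  qed
  have "slice_ev \<iota> q (prod_tensor n I T U) \<phi>s = (\<Sum>(c, e)\<leftarrow>T. \<iota> c *
      (\<Sum>(c', e')\<leftarrow>U. \<iota> c' * slice_ev \<iota> q [(1, (hd e + hd e') # merge n I (tl e) (tl e'))] \<phi>s))"
    unfolding prod_tensor_def slice_ev_bind[OF \<iota>] ..
  also have "\<dots> = slice_ev \<iota> q T (nths \<phi>s I) * slice_ev \<iota> q U (nths \<phi>s ?J)"
    unfolding slice_ev_def[of _ _ T] sum_list_mult_const[symmetric]
  proof (intro arg_cong[of _ _ sum_list] map_cong refl)
    fix ce assume "ce \<in> set T"
    then obtain c e where ce: "ce = (c, e)" "length e = Suc (card I)"
      using assms(5) by (cases ce) (auto simp: is_tensor_def)
    show "(case ce of (c, e) \<Rightarrow> \<iota> c *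
      (\<Sum>(c', e')\<leftarrow>U. \<iota> c' * slice_ev \<iota> q [(1, (hd e + hd e') # merge n I (tl e) (tl e'))] \<phi>s)) =
      (case ce of (c, e) \<Rightarrow> \<iota> (c * monom_ev (nths \<phi>s I) (tl e)) * q powi hd e) * slice_ev \<iota> q U (nths \<phi>s ?J)"
      unfolding ce prod.case U[OF ce(2)] by (simp add: scalar_homD[OF \<iota>] mult_ac)
  qed
  finally show ?thesis .
qed

text \<open>Tensor form of \<open>eo_res_kernel_bidifferential_power\<close>. The first exponent of
  T is consumed by the divided difference, which leaves a power of q and a new exponent j for the
  k-th variable; hence there is one variable more than in T.\<close>

definition dd_tensor :: "nat \<Rightarrow> nat \<Rightarrow> tensor \<Rightarrow> tensor" where
  "dd_tensor n k T = bind_tensor (\<lambda>e. map (\<lambda>j. ((if 0 \<le> hd e then 1 else -1) * (2 * (2 * of_int j + 1)),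
      (hd e - 1 - j) # merge n {k} [j] (tl e))) (if 0 \<le> hd e then [0..hd e - 1] else [hd e..-1])) T"

lemma is_tensor_dd: "is_tensor n T \<Longrightarrow> is_tensor (Suc n) (dd_tensor n k T)"
  unfolding dd_tensor_def by (rule is_tensor_bind) (auto simp: is_tensor_def)

lemma slice_ev_dd:
  assumes \<iota>: "scalar_hom \<iota>" and "length \<phi>s = n" "k < n" "is_tensor n T"
  shows "slice_ev \<iota> q (dd_tensor n k T) \<phi>s =
    (\<Sum>(c, e)\<leftarrow>T. \<iota> (c * monom_ev (nths \<phi>s ({0..<n} - {k})) (tl e)) *
       divided_difference q (hd e) (\<lambda>j. \<iota> (2 * (2 * of_int j + 1) * (\<phi>s ! k) j)))"
  unfolding dd_tensor_def slice_ev_bind[OF \<iota>]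
proof (intro arg_cong[of _ _ sum_list] map_cong refl)
  fix ce assume "ce \<in> set T"
  then obtain c e where ce: "ce = (c, e)" "length e = n"
    using assms(4) by (cases ce) (auto simp: is_tensor_def)
  have "{k} \<subseteq> {0..<n}" using assms by auto
  note len = length_nths_subset[OF assms(2) this]
  have single: "nths \<phi>s {k} = [\<phi>s ! k]" using nths_singleton_index[of k \<phi>s] assms by simp
  have m: "monom_ev \<phi>s (merge n {k} [j] (tl e)) = (\<phi>s ! k) j * monom_ev (nths \<phi>s ({0..<n} - {k})) (tl e)" for j
    by (subst monom_ev_merge) (use assms len ce single in auto)
  define h :: "int \<Rightarrow> complex" where "h j = 2 * (2 * of_int j + 1)" for j
  have "slice_ev \<iota> q (map (\<lambda>j. (s * h j, (hd e - 1 - j) # merge n {k} [j] (tl e))) js) \<phi>s =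
      \<iota> (monom_ev (nths \<phi>s ({0..<n} - {k})) (tl e)) *
      (\<Sum>j\<leftarrow>js. \<iota> s * (q powi (hd e - 1 - j) * \<iota> (h j * (\<phi>s ! k) j)))" for js s
    by (induction js) (simp_all add: m scalar_homD[OF \<iota>] distrib_left mult_ac)
  thus "(case ce of (c, e) \<Rightarrow> \<iota> c * slice_ev \<iota> q (map (\<lambda>j. ((if 0 \<le> hd e then 1 else -1) * (2 * (2 * of_int j + 1)),
      (hd e - 1 - j) # merge n {k} [j] (tl e))) (if 0 \<le> hd e then [0..hd e - 1] else [hd e..-1])) \<phi>s) =
    (case ce of (c, e) \<Rightarrow> \<iota> (c * monom_ev (nths \<phi>s ({0..<n} - {k})) (tl e)) *
       divided_difference q (hd e) (\<lambda>j. \<iota> (2 * (2 * of_int j + 1) * (\<phi>s ! k) j)))"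
    unfolding ce prod.case divided_difference_conv_sum_list h_def[symmetric]
    by (simp add: scalar_homD[OF \<iota>] mult.assoc if_distrib[of \<iota>] cong: if_cong)
qed

section \<open>Residues of tensors against the kernel\<close>

lemma holo_near_branch_slice: "holo_near_branch (\<lambda>z. slice_ev (\<lambda>x. x) (z^2) T \<phi>s)"
  by (induction T) (auto intro!: holo_near_branch_intros)

lemma eo_res_kernel_slice:
  assumes "z0 \<noteq> 0"
  shows "eo_res (\<lambda>z. z / (z0^2 - z^2) * slice_ev (\<lambda>x. x) (z^2) T \<phi>s) = slice_ev (\<lambda>x. x) (z0^2) T \<phi>s"
proof (induction T)
  case Nil
  show ?case using eo_res_cmult[OF holo_near_branch_const[of 0], of 0] by simp
next
  case (Cons ce T)
  obtain c e where ce: "ce = (c, e)" by force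
  let ?m = "c * monom_ev \<phi>s (tl e)"
  have "eo_res (\<lambda>z. z / (z0^2 - z^2) * slice_ev (\<lambda>x. x) (z^2) (ce # T) \<phi>s) =
     eo_res (\<lambda>z. ?m * (z / (z0^2 - z^2) * (z^2) powi hd e) + z / (z0^2 - z^2) * slice_ev (\<lambda>x. x) (z^2) T \<phi>s)"
    by (rule eo_res_cong) (simp add: ce distrib_left mult_ac)
  also have "\<dots> = ?m * (z0^2) powi hd e + slice_ev (\<lambda>x. x) (z0^2) T \<phi>s"
    using assms by (subst eo_res_add) (auto intro!: holo_near_branch_intros holo_near_branch_slice
      simp: eo_res_cmult holo_near_branch_intros eo_res_kernel_power Cons simp del: times_divide_eq_left)
  finally show ?case by (simp add: ce)
qed

lemma eo_res_kernel_bidifferential_slice: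
  assumes "z0 \<noteq> 0" "a \<noteq> 0"
  shows "eo_res (\<lambda>z. z / (z0^2 - z^2) * ((1 / (z - a)^2 + 1 / (z + a)^2) * slice_ev (\<lambda>x. x) (z^2) T \<phi>s)) =
   (\<Sum>(c, e)\<leftarrow>T. c * monom_ev \<phi>s (tl e) * divided_difference (z0^2) (hd e) (\<lambda>j. 2 * (2 * of_int j + 1) * (a^2) powi j))"
proof (induction T)
  case Nil
  show ?case using eo_res_cmult[OF holo_near_branch_const[of 0], of 0] by simp
next
  case (Cons ce T)
  obtain c e where ce: "ce = (c, e)" by force
  let ?m = "c * monom_ev \<phi>s (tl e)" and ?S = "\<lambda>z. 1 / (z - a)^2 + 1 / (z + a)^2"
  have "eo_res (\<lambda>z. z / (z0^2 - z^2) * (?S z * slice_ev (\<lambda>x. x) (z^2) (ce # T) \<phi>s)) =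
     eo_res (\<lambda>z. ?m * (z / (z0^2 - z^2) * (?S z * (z^2) powi hd e)) +
        z / (z0^2 - z^2) * (?S z * slice_ev (\<lambda>x. x) (z^2) T \<phi>s))"
    by (rule eo_res_cong) (simp add: ce distrib_left mult_ac)
  also have "\<dots> = eo_res (\<lambda>z. ?m * (z / (z0^2 - z^2) * (?S z * (z^2) powi hd e))) +
     eo_res (\<lambda>z. z / (z0^2 - z^2) * (?S z * slice_ev (\<lambda>x. x) (z^2) T \<phi>s))"
    using assms by (intro eo_res_add holo_near_branch_intros holo_near_branch_slice)
  also have "eo_res (\<lambda>z. ?m * (z / (z0^2 - z^2) * (?S z * (z^2) powi hd e))) =
     ?m * eo_res (\<lambda>z. z / (z0^2 - z^2) * (?S z * (z^2) powi hd e))"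
    using assms by (intro eo_res_cmult holo_near_branch_intros)
  finally show ?case
    unfolding eo_res_kernel_bidifferential_power[OF assms(2,1)] Cons by (simp add: ce)
qed

unbundle fps_syntax

section \<open>Expansions in \<open>t = 1/x\<close>\<close>

lemma fls_X_power_times_nth: "(fls_X ^ k * f) $$ m = f $$ (m - int k)" for f :: "complex fls"
  by (simp add: fls_X_power_times_conv_shift)

lemma fls_X_times_nth: "(fls_X * f) $$ m = f $$ (m - 1)" for f :: "complex fls"
  by (simp add: fls_X_times_conv_shift)

lemma fls_deriv_power_int:
  fixes f :: "complex fls"
  assumes "f \<noteq> 0"
  shows "fls_deriv (f powi n) = of_int n * f powi (n - 1) * fls_deriv f"
proof (induction n rule: int_induct[where k = 0])
  case (step1 i)
  have "f powi (i + 1) = f powi i * f" "f powi i = f powi (i - 1) * f"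
    using power_int_add_1[of f i] power_int_add_1[of f "i - 1"] assms by auto
  thus ?case using step1 by (simp add: algebra_simps)
next
  case (step2 i)
  have eq: "f powi i = f powi (i - 1) * f" "f powi (i - 1) = f powi (i - 1 - 1) * f"
    using power_int_add_1[of f "i - 1"] power_int_add_1[of f "i - 2"] assms by auto
  have "fls_deriv (f powi i) = fls_deriv (f powi (i - 1)) * f + f powi (i - 1) * fls_deriv f"
    by (subst eq(1)) (simp add: algebra_simps)
  hence "fls_deriv (f powi (i - 1)) * f = (of_int i - 1) * f powi (i - 1) * fls_deriv f"
    using step2 by (simp add: algebra_simps)
  also have "\<dots> = (of_int (i - 1) * f powi (i - 1 - 1) * fls_deriv f) * f"
    by (subst eq(2)) simp
  finally show ?case using assms by simp
qed auto

definition fls_trunc :: "nat \<Rightarrow> complex fls \<Rightarrow> complex fls" where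
  "fls_trunc a f = (\<Sum>i\<in>{0..a}. fls_const (f $$ int i) * fls_X ^ i)"

lemma fls_sum_nth: "(\<Sum>i\<in>S. f i) $$ m = (\<Sum>i\<in>S. f i $$ m)"
  by (induction S rule: infinite_finite_induct) auto

lemma fls_trunc_nth: "fls_trunc a f $$ m = (if 0 \<le> m \<and> m \<le> int a then f $$ m else 0)"
proof -
  have "fls_trunc a f $$ m = (\<Sum>i\<in>{0..a}. if m = int i then f $$ m else 0)"
    unfolding fls_trunc_def fls_sum_nth by (intro sum.cong) (auto simp: fls_X_power_nth)
  also have "\<dots> = (\<Sum>i\<in>{0..a}. if i = nat m \<and> 0 \<le> m then f $$ m else 0)"
    by (intro sum.cong) auto
  also have "\<dots> = (if 0 \<le> m \<and> m \<le> int a then f $$ m else 0)"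
    by (cases "0 \<le> m") auto
  finally show ?thesis .
qed

lemma fls_trunc_Suc: "fls_trunc (Suc a) f = fls_trunc a f + fls_const (f $$ int (Suc a)) * fls_X ^ Suc a"
  by (simp add: fls_trunc_def)

lemma fls_trunc_0: "fls_trunc 0 f = fls_const (f $$ 0)"
  by (simp add: fls_trunc_def)

lemma fls_trunc_add: "fls_trunc a (f + g) = fls_trunc a f + fls_trunc a g"
  by (rule fls_eqI) (auto simp: fls_trunc_nth)

lemma fls_trunc_cmult: "fls_trunc a (fls_const c * f) = fls_const c * fls_trunc a f"
  by (rule fls_eqI) (auto simp: fls_trunc_nth)

lemma fls_minus_trunc:
  "fps_to_fls F - fls_trunc a (fps_to_fls F) = fls_X ^ Suc a * fps_to_fls (fps_shift (Suc a) F)"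
  by (rule fls_eqI) (auto simp: fls_trunc_nth fls_X_power_times_nth nat_diff_distrib nat_add_distrib 
    intro!: arg_cong[of _ _ "fps_nth F"] simp del: power_Suc)

text \<open>The part of \<open>a x\<^sup>a\<^sup>-\<^sup>1 f\<close> (without the factor \<open>a\<close>) of order at least two in \<open>t = 1/x\<close>.\<close>
definition fls_tail :: "nat \<Rightarrow> complex fls \<Rightarrow> complex fls" where
  "fls_tail a f = fls_X * (f - fls_trunc a f) / fls_X ^ a"

lemma fls_tail_fps: "fls_tail a (fps_to_fls F) = fls_X ^ 2 * fps_to_fls (fps_shift (Suc a) F)"
proof -
  have "fls_X ^ 2 * fps_to_fls (fps_shift (Suc a) F) * fls_X ^ a = fls_X * (fls_X ^ Suc a * fps_to_fls (fps_shift (Suc a) F))"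
    by (simp add: power2_eq_square mult_ac)
  thus ?thesis unfolding fls_tail_def fls_minus_trunc
    by (intro nonzero_divide_eq_eq[THEN iffD2]) auto
qed

lemma fls_tail_add: "fls_tail a (f + g) = fls_tail a f + fls_tail a g"
  by (simp add: fls_tail_def fls_trunc_add add_divide_distrib ring_distribs diff_divide_distrib)

lemma fls_tail_cmult: "fls_tail a (fls_const c * f) = fls_const c * fls_tail a f"
  by (simp only: fls_tail_def fls_trunc_cmult right_diff_distrib[symmetric] mult.left_commute[of fls_X] times_divide_eq_right)

lemma fls_tail_const: "fls_tail a (fls_const c) = 0"
proof -
  have "fls_trunc a (fls_const c) = fls_const c"
    by (rule fls_eqI) (auto simp: fls_trunc_nth)
  thus ?thesis by (simp add: fls_tail_def)
qed

lemma fls_tail_X: "a \<ge> 1 \<Longrightarrow> fls_tail a fls_X = 0"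
proof -
  assume "a \<ge> 1"
  hence "fls_trunc a fls_X = fls_X"
    by (intro fls_eqI) (auto simp: fls_trunc_nth)
  thus ?thesis by (simp add: fls_tail_def)
qed

section \<open>Degree and order bounds for Laurent series\<close>

definition fls_deg_le :: "int \<Rightarrow> complex fls \<Rightarrow> bool" where
  "fls_deg_le n f \<longleftrightarrow> (\<forall>m>n. f $$ m = 0)"

definition fls_ord_ge :: "int \<Rightarrow> complex fls \<Rightarrow> bool" where
  "fls_ord_ge n f \<longleftrightarrow> f = 0 \<or> n \<le> fls_subdegree f"

lemma fls_ord_ge_iff: "fls_ord_ge n f \<longleftrightarrow> (\<forall>m<n. f $$ m = 0)"
  unfolding fls_ord_ge_def by (auto intro: fls_subdegree_geI)

lemma fls_ord_ge_mult: "fls_ord_ge m f \<Longrightarrow> fls_ord_ge n g \<Longrightarrow> fls_ord_ge (m + n) (f * g)"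
  unfolding fls_ord_ge_def by (cases "f = 0 \<or> g = 0") auto

lemma fls_ord_ge_add: "fls_ord_ge n f \<Longrightarrow> fls_ord_ge n g \<Longrightarrow> fls_ord_ge n (f + g)"
  unfolding fls_ord_ge_iff by auto

lemma fls_ord_ge_diff: "fls_ord_ge n f \<Longrightarrow> fls_ord_ge n g \<Longrightarrow> fls_ord_ge n (f - g)"
  unfolding fls_ord_ge_iff by auto

lemma fls_ord_ge_const: "fls_ord_ge 0 (fls_const c)"
  unfolding fls_ord_ge_iff by auto

lemma fls_ord_ge_fps: "fls_ord_ge 0 (fps_to_fls F)"
  unfolding fls_ord_ge_iff by auto

lemma fls_ord_ge_X_power: "fls_ord_ge (int k) (fls_X ^ k)"
  unfolding fls_ord_ge_iff by (auto simp: fls_X_power_nth)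

lemma fls_deg_le_mult:
  assumes "fls_deg_le m f" "fls_deg_le n g"
  shows "fls_deg_le (m + n) (f * g)"
  unfolding fls_deg_le_def
proof (intro allI impI)
  fix k assume k: "k > m + n"
  have "(f * g) $$ k = (\<Sum>i=fls_subdegree f + fls_subdegree g..k. f $$ (i - fls_subdegree g) * g $$ (fls_subdegree g + k - i))"
    by (rule fls_times_nth(1))
  also have "\<dots> = 0"
  proof (rule sum.neutral, rule ballI)
    fix i
    show "f $$ (i - fls_subdegree g) * g $$ (fls_subdegree g + k - i) = 0"
    proof (cases "i - fls_subdegree g > m")
      case False
      hence "fls_subdegree g + k - i > n" using k by linarith
      thus ?thesis using assms by (simp add: fls_deg_le_def)
    qed (use assms in \<open>simp add: fls_deg_le_def\<close>)
  qed
  finally show "(f * g) $$ k = 0" .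
qed

lemma fls_deg_le_add: "fls_deg_le n f \<Longrightarrow> fls_deg_le n g \<Longrightarrow> fls_deg_le n (f + g)"
  unfolding fls_deg_le_def by auto

lemma fls_deg_le_diff: "fls_deg_le n f \<Longrightarrow> fls_deg_le n g \<Longrightarrow> fls_deg_le n (f - g)"
  unfolding fls_deg_le_def by auto

lemma fls_deg_le_mono: "fls_deg_le m f \<Longrightarrow> m \<le> n \<Longrightarrow> fls_deg_le n f"
  unfolding fls_deg_le_def by auto

lemma fls_deg_le_const: "fls_deg_le 0 (fls_const c)"
  unfolding fls_deg_le_def by auto

lemma fls_deg_le_trunc: "fls_deg_le (int a) (fls_trunc a f)"
  unfolding fls_deg_le_def by (auto simp: fls_trunc_nth)

lemma fls_deg_le_X_power: "fls_deg_le (int k) (fls_X ^ k)"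
  unfolding fls_deg_le_def by (auto simp: fls_X_power_nth)

lemma fls_divide_X_power_nth: "(f / fls_X ^ k) $$ m = f $$ (m + int k)" for f :: "complex fls"
  by simp

lemma fls_deg_le_divide_X: "fls_deg_le n f \<Longrightarrow> fls_deg_le (n - int k) (f / fls_X ^ k)"
  unfolding fls_deg_le_def by (auto simp: fls_divide_X_power_nth)

text \<open>A formal counterpart of Liouville's theorem, by which the computation of
  \<open>H_0_2\<close> is closed.\<close>

lemma fls_deg_ord_zero: "fls_deg_le m f \<Longrightarrow> fls_ord_ge n f \<Longrightarrow> m < n \<Longrightarrow> f = 0"
  unfolding fls_deg_le_def fls_ord_ge_iff by (metis fls_eqI fls_zero_nth linorder_not_less order.strict_trans2)

lemma fps_to_fls_sum: "fps_to_fls (\<Sum>i\<in>S. F i) = (\<Sum>i\<in>S. fps_to_fls (F i))"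
  by (induction S rule: infinite_finite_induct) auto

text \<open>The factor \<open>fps_X\<close> accounts for the exponent a+1 in x^(-a-1) =
  t^(a+1).\<close>

definition gen_series :: "(nat \<Rightarrow> complex) \<Rightarrow> complex fls" where
  "gen_series h = fps_to_fls (fps_X * Abs_fps h)"

lemma gen_series_nth: "gen_series h $$ m = (if m \<ge> 1 then h (nat m - 1) else 0)"
  by (auto simp: gen_series_def nat_le_iff)

text \<open>A series in two variables restricted to x_1 = x_2 and collected by total degree; the
  square accounts for the two shifts by one.\<close>

definition gen_diag :: "(nat \<Rightarrow> nat \<Rightarrow> complex) \<Rightarrow> complex fls" where
  "gen_diag h = fps_to_fls (fps_X ^ 2 * Abs_fps (\<lambda>m. \<Sum>i = 0..m. h i (m - i)))"

lemma gen_series_loop: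
  assumes dfe: "dessin_free_energy s u v c" and pos: "\<forall>a\<in>set A. 0 < a"
  defines "H \<equiv> \<lambda>g A. gen_series (\<lambda>m. G_coeff c g (m # A))"
  shows "fls_const (1 / s) * H g A = fls_const (u + v) * fls_X * H g A
    + (\<Sum>k<length A. fls_const (of_nat (A ! k)) * fls_tail (A ! k) (H g (nths A ({0..<length A} - {k}))))
    + (if 1 \<le> g then gen_diag (\<lambda>i j. G_coeff c (g - 1) (i # j # A)) else 0)
    + (\<Sum>g1\<in>{0..g}. \<Sum>I\<in>Pow {0..<length A}. H g1 (nths A I) * H (g - g1) (nths A ({0..<length A} - I)))
    + (if g = 0 \<and> A = [] then fls_const (u * v) * fls_X ^ 2 else 0)"
proof -
  define Hp where "Hp = (\<lambda>g A. Abs_fps (\<lambda>m. G_coeff c g (m # A)))"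
  have Hp_nth: "Hp g A $ m = G_coeff c g (m # A)" for g A m by (simp add: Hp_def)
  have Hp_mult: "(Hp g1 A1 * Hp g2 A2) $ m = (\<Sum>i = 0..m. G_coeff c g1 (i # A1) * G_coeff c g2 ((m - i) # A2))"
    for g1 g2 A1 A2 m by (simp add: fps_mult_nth Hp_nth)
  have H0: "G_coeff c g (0 # A) = 0" for g A by (simp add: G_coeff_eq)
  have H: "H g A = fps_to_fls (fps_X * Hp g A)" for g A
    by (simp add: H_def gen_series_def Hp_def)
  have tail: "fls_tail a (H g A') = fps_to_fls (fps_X ^ 2 * Abs_fps (\<lambda>m. G_coeff c g ((m + a) # A')))" for a A'
  proof -
    have "fps_shift (Suc a) (fps_X * Hp g A') = Abs_fps (\<lambda>m. G_coeff c g ((m + a) # A'))"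
      by (rule fps_ext) (simp add: Hp_def)
    thus ?thesis unfolding H fls_tail_fps by (simp add: fls_times_fps_to_fls fps_to_fls_power)
  qed
  have prod: "H g1 A1 * H g2 A2 = fps_to_fls (fps_X ^ 2 * (Hp g1 A1 * Hp g2 A2))" for g1 g2 A1 A2
    unfolding H by (simp flip: fls_times_fps_to_fls add: power2_eq_square mult_ac)
  have X: "fls_const (u + v) * fls_X * H g A = fps_to_fls (fps_X ^ 2 * (fps_const (u + v) * Hp g A))"
    unfolding H by (simp add: fls_times_fps_to_fls power2_eq_square mult_ac fps_to_fls_power)
  have "fps_const (1 / s) * (fps_X * Hp g A) = fps_X ^ 2 * (fps_const (u + v) * Hp g A
     + (\<Sum>k<length A. fps_const (of_nat (A ! k)) * Abs_fps (\<lambda>m. G_coeff c g ((m + A ! k) # nths A ({0..<length A} - {k}))))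
     + (if 1 \<le> g then Abs_fps (\<lambda>m. \<Sum>i = 0..m. G_coeff c (g - 1) (i # (m - i) # A)) else 0)
     + (\<Sum>g1\<in>{0..g}. \<Sum>I\<in>Pow {0..<length A}. Hp g1 (nths A I) * Hp (g - g1) (nths A ({0..<length A} - I)))
     + (if g = 0 \<and> A = [] then fps_const (u * v) else 0))"
    (is "?l = fps_X ^ 2 * ?r")
  proof (rule fps_ext)
    fix n
    \<comment> \<open>The constraint of index m sits at t^(m+2). At t^0 and t^1 both sides vanish,
      since index 0 contributes nothing.\<close>
    consider "n = 0" | "n = 1" | m where "n = Suc (Suc m)" by (metis One_nat_def old.nat.exhaust)
    thus "?l $ n = (fps_X ^ 2 * ?r) $ n"
    proof cases
      case 3
      have "?l $ n = G_coeff c g (Suc m # A) / s" by (simp add: 3 Hp_def)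
      also have "\<dots> = ?r $ m"
        unfolding G_coeff_recursion[OF dfe pos]
        by (simp add: Hp_nth Hp_mult fps_sum_nth sum.distrib sum.swap[of _ "{0..g}" "{0..m}"]
             sum.swap[of _ "Pow {0..<length A}" "{0..m}"])
      also have "\<dots> = (fps_X ^ 2 * ?r) $ n" by (simp add: 3 fps_X_power_mult_nth)
      finally show ?thesis .
    qed (auto simp: fps_X_power_mult_nth Hp_def H0)
  qed
  hence "fps_to_fls ?l = fps_to_fls (fps_X ^ 2 * ?r)" by simp
  moreover have "fps_to_fls ?l = fls_const (1 / s) * H g A"
    by (simp add: H fls_times_fps_to_fls)
  ultimately show ?thesis
    unfolding tail prod X gen_diag_def
    by (cases "1 \<le> g"; cases "g = 0 \<and> A = []")
       (simp_all add: distrib_left fls_times_fps_to_fls fps_to_fls_power fps_to_fls_sum sum_distrib_left mult_ac)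
qed

section \<open>The spectral curve as Laurent series in t\<close>

locale dessin_curve =
  fixes s su sv :: complex
  assumes s_nz: "s \<noteq> 0" and su_nz: "su \<noteq> 0" and sv_nz: "sv \<noteq> 0"
begin

definition "\<alpha> = dessin_alpha su sv"
definition "\<beta> = dessin_beta su sv"

lemma \<alpha>_minus_\<beta>: "\<alpha> - \<beta> = - 4 * su * sv"
  by (simp add: \<alpha>_def \<beta>_def dessin_alpha_def dessin_beta_def power2_eq_square algebra_simps)

lemma \<alpha>_minus_\<beta>_nz: "\<alpha> - \<beta> \<noteq> 0"
  using su_nz sv_nz by (simp add: \<alpha>_minus_\<beta>)

text \<open>The coordinate \<open>z\<close> as a function of \<open>t = 1/x\<close>.\<close>
definition z_of :: "complex \<Rightarrow> complex" where
  "z_of t = csqrt ((1 - s * \<beta> * t) / (1 - s * \<alpha> * t))"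

definition zfps :: "complex fps" where "zfps = fps_expansion z_of 0"

text \<open>Near t = 0 the radicand is close to 1 and so avoids the branch cut of
  \<open>csqrt\<close>.\<close>

lemma z_of_radius:
  "\<exists>r>0. \<forall>t\<in>ball 0 r. 1 - s * \<alpha> * t \<noteq> 0 \<and> 1 - s * \<beta> * t \<noteq> 0 \<and>
     (1 - s * \<beta> * t) / (1 - s * \<alpha> * t) \<notin> \<real>\<^sub>\<le>\<^sub>0"
proof -
  define f where "f = (\<lambda>t::complex. (1 - s * \<beta> * t) / (1 - s * \<alpha> * t))"
  have "(f \<longlongrightarrow> f 0) (nhds 0)"
    unfolding f_def by (auto intro!: tendsto_eq_intros filterlim_ident)
  hence "\<forall>\<^sub>F t in nhds 0. dist (f t) (f 0) < 1"
    by (rule tendstoD) auto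
  moreover have "((\<lambda>t. 1 - s * \<alpha> * t) \<longlongrightarrow> 1) (nhds 0)"
    by (auto intro!: tendsto_eq_intros filterlim_ident)
  hence "\<forall>\<^sub>F t::complex in nhds 0. dist (1 - s * \<alpha> * t) 1 < 1"
    by (rule tendstoD) auto
  ultimately have "\<forall>\<^sub>F t::complex in nhds 0. dist (f t) 1 < 1 \<and> dist (1 - s * \<alpha> * t) 1 < 1"
    by eventually_elim (simp add: f_def)
  then obtain r where r: "r > 0" "\<And>t::complex. dist t 0 < r \<Longrightarrow> dist (f t) 1 < 1 \<and> dist (1 - s * \<alpha> * t) 1 < 1"
    by (auto simp: eventually_nhds_metric)
  show ?thesis
  proof (intro exI[of _ r] conjI ballI r(1))
    fix t :: complex assume "t \<in> ball 0 r"
    hence t: "dist (f t) 1 < 1" "dist (1 - s * \<alpha> * t) 1 < 1" using r(2)[of t] by (auto simp: dist_commute)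
    show "1 - s * \<alpha> * t \<noteq> 0" using t(2) by auto
    show "1 - s * \<beta> * t \<noteq> 0" using t(1) by (auto simp: f_def)
    show "(1 - s * \<beta> * t) / (1 - s * \<alpha> * t) \<notin> \<real>\<^sub>\<le>\<^sub>0"
    proof
      assume "(1 - s * \<beta> * t) / (1 - s * \<alpha> * t) \<in> \<real>\<^sub>\<le>\<^sub>0"
      hence "f t \<in> \<real>\<^sub>\<le>\<^sub>0" by (simp add: f_def)
      then obtain x where x: "f t = of_real x" "x \<le> 0" by (auto elim!: nonpos_Reals_cases)
      have "dist (f t) 1 = \<bar>x - 1\<bar>"
        unfolding x dist_norm by (metis norm_of_real of_real_1 of_real_diff)
      thus False using t(1) x(2) by simp
    qed
  qed
qed

lemma z_of_holomorphic:
  assumes "\<And>t. t \<in> ball 0 r \<Longrightarrow> 1 - s * \<alpha> * t \<noteq> 0"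
    "\<And>t. t \<in> ball 0 r \<Longrightarrow> (1 - s * \<beta> * t) / (1 - s * \<alpha> * t) \<notin> \<real>\<^sub>\<le>\<^sub>0"
  shows "z_of holomorphic_on ball 0 r"
  unfolding z_of_def using assms by (intro holomorphic_intros) auto

lemma z_of_fps_expansion: "z_of has_fps_expansion zfps"
proof -
  obtain r where r: "r > 0" "\<And>t. t \<in> ball 0 r \<Longrightarrow> 1 - s * \<alpha> * t \<noteq> 0"
    "\<And>t. t \<in> ball 0 r \<Longrightarrow> 1 - s * \<beta> * t \<noteq> 0"
    "\<And>t. t \<in> ball 0 r \<Longrightarrow> (1 - s * \<beta> * t) / (1 - s * \<alpha> * t) \<notin> \<real>\<^sub>\<le>\<^sub>0"
    using z_of_radius by blast
  have "z_of holomorphic_on ball 0 r" by (rule z_of_holomorphic[OF r(2,4)])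
  hence "z_of analytic_on {0}"
    using r(1) by (meson analytic_at centre_in_ball open_ball)
  thus ?thesis unfolding zfps_def by (rule analytic_at_imp_has_fps_expansion_0)
qed

lemma zfps_0: "zfps $ 0 = 1"
  by (simp add: zfps_def fps_expansion_def z_of_def)

text \<open>Together with \<open>zfps_0\<close> this is the input for the formal computations with
  \<open>Z\<close>: the algebraic equation of the curve and the choice of the branch z = 1 at t =
  0.\<close>

lemma zfps_square: "zfps ^ 2 * (1 - fps_const (s * \<alpha>) * fps_X) = 1 - fps_const (s * \<beta>) * fps_X"
proof -
  obtain r where r: "r > 0" "\<And>t. t \<in> ball 0 r \<Longrightarrow> 1 - s * \<alpha> * t \<noteq> 0"
    "\<And>t. t \<in> ball 0 r \<Longrightarrow> 1 - s * \<beta> * t \<noteq> 0"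
    "\<And>t. t \<in> ball 0 r \<Longrightarrow> (1 - s * \<beta> * t) / (1 - s * \<alpha> * t) \<notin> \<real>\<^sub>\<le>\<^sub>0"
    using z_of_radius by blast
  have "(\<lambda>t. z_of t ^ 2 * (1 - s * \<alpha> * t)) has_fps_expansion zfps ^ 2 * (1 - fps_const (s * \<alpha>) * fps_X)"
    by (intro fps_expansion_intros z_of_fps_expansion)
  moreover have "(\<lambda>t. 1 - s * \<beta> * t) has_fps_expansion 1 - fps_const (s * \<beta>) * fps_X"
    by (intro fps_expansion_intros)
  moreover have "\<forall>\<^sub>F t in nhds 0. z_of t ^ 2 * (1 - s * \<alpha> * t) = 1 - s * \<beta> * t"
  proof (rule eventually_mono[OF eventually_nhds_in_open[of "ball 0 r" 0]])
    fix t :: complex assume "t \<in> ball 0 r"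
    from r(2)[OF this] show "z_of t ^ 2 * (1 - s * \<alpha> * t) = 1 - s * \<beta> * t"
      by (simp add: z_of_def)
  qed (use r in auto)
  from has_fps_expansion_cong[OF this refl]
  have "((\<lambda>t. z_of t ^ 2 * (1 - s * \<alpha> * t)) has_fps_expansion F) \<longleftrightarrow>
     ((\<lambda>t. 1 - s * \<beta> * t) has_fps_expansion F)" for F .
  ultimately show ?thesis
    by (blast intro: fps_expansion_unique_complex)
qed

abbreviation "S \<equiv> fls_const s"
abbreviation "Al \<equiv> fls_const \<alpha>"
abbreviation "Be \<equiv> fls_const \<beta>"
abbreviation "X \<equiv> fls_X :: complex fls"

lemmas [simp del] = fls_const_mult_const

text \<open>\<open>Z\<close>, \<open>Q\<close>, \<open>Y\<close>, \<open>psi\<close> are the expansions of \<open>z\<close>, \<open>z\<^sup>2\<close>, \<open>y\<close> and \<open>dz/dx\<close>.\<close>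
definition "Z = fps_to_fls zfps"
definition "Q = Z ^ 2"
text \<open>\<open>XA\<close> and \<open>XB\<close> vanish at the branch points z = infinity and z =
  0. Since \<alpha> q - \<beta> = (\<alpha> - \<beta>) / \<open>XA\<close>, the function
  \<open>curve_y\<close> takes the form of \<open>Y\<close>, and dz/dx = - t^2 dz/dt gives
  \<open>psi\<close>.\<close>

definition "XA = 1 - S * (Al * X)"
definition "XB = 1 - S * (Be * X)"
definition "Y = - (Z * XA / (2 * S))"
definition "psi = - (X ^ 2 * fls_deriv Z)"

lemma S_nz: "S \<noteq> 0" using s_nz by simp

lemma Al_minus_Be_nz: "Al - Be \<noteq> 0"
  using \<alpha>_minus_\<beta>_nz unfolding fls_minus_const fls_const_eq_0_iff .

lemma Z_0: "Z $$ 0 = 1" by (simp add: Z_def zfps_0)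

lemma XA_0: "XA $$ 0 = 1" and XB_0: "XB $$ 0 = 1"
  by (simp_all add: XA_def XB_def)

lemma nz: "Z \<noteq> 0" "Q \<noteq> 0" "XA \<noteq> 0" "XB \<noteq> 0" "Y \<noteq> 0" "X \<noteq> 0"
proof -
  show Z: "Z \<noteq> 0" and A: "XA \<noteq> 0" and "XB \<noteq> 0" using Z_0 XA_0 XB_0 by auto
  thus "Q \<noteq> 0" by (simp add: Q_def)
  show "Y \<noteq> 0" using Z A s_nz by (auto simp: Y_def)
qed auto

lemma Q_XA: "Q * XA = XB"
  using arg_cong[OF zfps_square, of fps_to_fls]
  by (simp add: Q_def Z_def XA_def XB_def fls_times_fps_to_fls fps_to_fls_power mult.assoc
    flip: fls_const_mult_const)

lemma XB_minus_XA: "XB - XA = S * (Al - Be) * X"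
  by (simp only: XA_def XB_def) (simp only: ring_distribs, simp)

lemma cross: "Al * XB - Be * XA = Al - Be"
  by (simp only: XA_def XB_def ring_distribs mult_1_right) (simp add: mult_ac)

lemma Z_deriv: "2 * Z * fls_deriv Z * XA ^ 2 = S * (Al - Be)"
proof -
  have "fls_deriv (Z ^ 2 * XA) = fls_deriv XB" using Q_XA by (simp add: Q_def)
  moreover have "fls_deriv XA = - (S * Al)" "fls_deriv XB = - (S * Be)"
    by (simp_all add: XA_def XB_def)
  ultimately have "2 * Z * fls_deriv Z * XA - Z ^ 2 * (S * Al) = - (S * Be)"
    by (simp add: power2_eq_square algebra_simps)
  hence "(2 * Z * fls_deriv Z * XA - Z ^ 2 * (S * Al)) * XA = - (S * Be) * XA" by simp
  hence "2 * Z * fls_deriv Z * XA ^ 2 = S * (Al * (Q * XA) - Be * XA)"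
    by (simp add: Q_def power2_eq_square algebra_simps)
  thus ?thesis unfolding Q_XA cross .
qed

lemma Y_square: "4 * S ^ 2 * Y ^ 2 = XA * XB"
proof -
  have "4 * S ^ 2 * Y ^ 2 = (2 * S * Y) ^ 2" by (simp add: power2_eq_square mult_ac)
  also have "2 * S * Y = - (Z * XA)" using S_nz by (simp add: Y_def del: fls_const_mult_const)
  also have "(- (Z * XA)) ^ 2 = (Q * XA) * XA" by (simp add: Q_def power2_eq_square mult_ac)
  finally show ?thesis by (simp add: Q_XA mult_ac)
qed

lemma SY: "- 2 * S * Y = Z * XA"
  using S_nz by (simp add: Y_def)

text \<open>\<open>Y\<close> is proportional to \<open>Z\<close> and \<open>psi\<close> to
  1/\<open>Z\<close> over the rational functions of t, so the square root drops out of the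
  product.\<close>

lemma Y_psi: "4 * Y * psi * XA = (Al - Be) * X ^ 2"
proof -
  have "S * (4 * Y * psi * XA) = (- 2 * S * Y) * (2 * X ^ 2 * fls_deriv Z * XA)"
    by (simp add: psi_def mult_ac)
  also have "\<dots> = X ^ 2 * (2 * Z * fls_deriv Z * XA ^ 2)"
    unfolding SY by (simp add: power2_eq_square mult_ac)
  also have "\<dots> = S * ((Al - Be) * X ^ 2)" unfolding Z_deriv by (simp add: mult_ac)
  finally show ?thesis by (rule mult_left_cancel[OF S_nz, THEN iffD1])
qed

text \<open>The coefficient of \<open>x\<^sup>-\<^sup>a\<^sup>-\<^sup>1\<close> in \<open>z\<^sup>2\<^sup>j dz/dx\<close>.\<close>
definition phi :: "nat \<Rightarrow> int \<Rightarrow> complex" where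
  "phi a = (\<lambda>j. (psi * Q powi j) $$ (int a + 1))"

text \<open>From (2j+1) z^(2j) dz = d(z^(2j+1)): taking a coefficient of the derivative brings down
  the factor a. The left side carries the factor 2(2j+1) of the residue formula.\<close>

lemma phi_eq: "2 * (2 * of_int j + 1) * phi a j = - 2 * of_nat a * (Z * Q powi j) $$ int a"
proof -
  have e: "Z * Q powi j = Z powi (2 * j + 1)"
    unfolding Q_def power2_power_int using nz by (simp add: power_int_add)
  have "fls_deriv (Z * Q powi j) = of_int (2 * j + 1) * (Q powi j * fls_deriv Z)"
    unfolding e fls_deriv_power_int[OF nz(1)] unfolding Q_def power2_power_int by (simp add: mult.assoc)
  moreover have "fls_deriv (Z * Q powi j) $$ (int a - 1) = of_nat a * (Z * Q powi j) $$ int a"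
    by (simp only: fls_deriv_nth) simp
  ultimately have 1: "of_int (2 * j + 1) * (Q powi j * fls_deriv Z) $$ (int a - 1) = of_nat a * (Z * Q powi j) $$ int a"
    by (simp only: fls_of_int fls_mult_const_nth)
  have "psi * Q powi j = - (X ^ 2 * (Q powi j * fls_deriv Z))" by (simp add: psi_def mult_ac)
  hence 2: "phi a j = - (Q powi j * fls_deriv Z) $$ (int a - 1)"
    unfolding phi_def by (simp add: fls_X_power_times_nth)
  have "2 * (2 * of_int j + 1) * phi a j = - 2 * (of_int (2 * j + 1) * (Q powi j * fls_deriv Z) $$ (int a - 1))"
    unfolding 2 by simp
  thus ?thesis unfolding 1 by simp
qed

lemma subdegree_Z: "fls_subdegree Z = 0"
  by (rule fls_subdegree_eqI) (auto simp: Z_0 Z_def zfps_0)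

lemma ord_Z: "fls_ord_ge 0 Z"
  by (simp add: fls_ord_ge_def subdegree_Z)

lemma ord_Q: "fls_ord_ge 0 (Q powi j)"
  by (simp add: fls_ord_ge_def Q_def fls_subdegree_pow subdegree_Z)

text \<open>With a second variable t', q(t) - q(t') = s (\<alpha> - \<beta>) (t - t') / ((1 - s
  \<alpha> t)(1 - s \<alpha> t')). Dividing by t - t' and taking the coefficient of t'^a produces
  partial sums, hence the truncations at degree a. The factor 1 - s \<alpha> t' joins z(t') to form
  -2 s y(t').\<close>

lemma divided_difference_Z:
  "fls_X ^ Suc a * divided_difference Q k (\<lambda>j. fls_const ((Z * Q powi j) $$ int a)) =
     - (2 / (Al - Be)) * XA * (Q powi k * fls_trunc a Y - fls_trunc a (Y * Q powi k))"
proof -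
  define g where "g = (\<lambda>m j. fls_const ((Z * Q powi j) $$ m))"
  define n where "n m = divided_difference Q k (g m)" for m
  define c where "c = - (2 / (Al - Be)) * XA"
  have aux: "e = - (2 / d) * w" if "d \<noteq> 0" "d * e = - 2 * w" for d e w :: "complex fls"
    using that by (simp add: field_simps)
  \<comment> \<open>Multiplication by t - t', read at the coefficient of t'^m: the divided
    difference telescopes, and single coefficients remain.\<close>
  have "X * n m - n (m - 1) = c * (Q powi k * fls_const (Y $$ m) - fls_const ((Y * Q powi k) $$ m))" for m
  proof -
    define L where "L j = fls_const (((Z * XA) * Q powi j) $$ m)" for j
    have L: "L j = g m j - S * Al * g (m - 1) j" for j
    proof -
      have "(Z * XA) * Q powi j = Z * Q powi j - S * (Al * (X * (Z * Q powi j)))"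
        by (simp add: XA_def algebra_simps)
      thus ?thesis by (simp add: L_def g_def fls_X_times_nth fls_const_mult_const fls_minus_const mult.assoc)
    qed
    have L': "L (j + 1) = g m j - S * Be * g (m - 1) j" for j
    proof -
      have "(Z * XA) * Q powi (j + 1) = (Q * XA) * (Z * Q powi j)"
        using nz by (simp add: power_int_add)
      also have "\<dots> = Z * Q powi j - S * (Be * (X * (Z * Q powi j)))"
        unfolding Q_XA by (simp add: XB_def algebra_simps)
      finally show ?thesis by (simp add: L_def g_def fls_X_times_nth fls_const_mult_const fls_minus_const mult.assoc)
    qed
    have L'': "L j = - 2 * S * fls_const ((Y * Q powi j) $$ m)" for j
    proof -
      have "(Z * XA) * Q powi j = - 2 * (S * (Y * Q powi j))"
        unfolding SY[symmetric] by simp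
      also have "\<dots> = fls_const (- 2) * (S * (Y * Q powi j))"
        by simp
      finally show ?thesis unfolding L_def
        by (simp only: fls_mult_const_nth) (simp add: fls_const_mult_const[symmetric] mult.assoc)
    qed
    have "XA * (Q * L j - L (j + 1)) = S * (Al - Be) * (X * g m j - g (m - 1) j)" for j
    proof -
      have "XA * (Q * L j - L (j + 1)) =
          (Q * XA - XA) * g m j - S * (Al * (Q * XA) - Be * XA) * g (m - 1) j"
        unfolding L' unfolding L by (simp add: algebra_simps)
      thus ?thesis unfolding Q_XA cross XB_minus_XA by (simp add: algebra_simps)
    qed
    hence "divided_difference Q k (\<lambda>j. XA * (Q * L j - L (j + 1))) =
      divided_difference Q k (\<lambda>j. S * (Al - Be) * (X * g m j + (-1) * g (m - 1) j))" by simp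
    hence "S * (Al - Be) * (X * n m - n (m - 1)) = XA * (Q powi k * L 0 - L k)"
      unfolding divided_difference_cmult divided_difference_add divided_difference_telescope[OF nz(2)] n_def
      by simp
    also have "\<dots> = XA * (Q powi k * (- 2 * S * fls_const (Y $$ m)) - (- 2 * S * fls_const ((Y * Q powi k) $$ m)))"
      unfolding L'' by simp
    also have "XA * (q * (- 2 * S * y0) - (- 2 * S * y1)) = S * (- 2 * XA * (q * y0 - y1))" for q y0 y1
      by (simp add: algebra_simps)
    finally have "S * ((Al - Be) * (X * n m - n (m - 1))) =
      S * (- 2 * XA * (Q powi k * fls_const (Y $$ m) - fls_const ((Y * Q powi k) $$ m)))"
      unfolding mult.assoc .
    hence "(Al - Be) * (X * n m - n (m - 1)) =
      - 2 * (XA * (Q powi k * fls_const (Y $$ m) - fls_const ((Y * Q powi k) $$ m)))"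
      unfolding mult.assoc by (rule mult_left_cancel[OF S_nz, THEN iffD1])
    from aux[OF Al_minus_Be_nz this] show ?thesis by (simp only: c_def mult.assoc)
  qed
  note rec = this
  have "X ^ Suc a * n (int a) = c * (Q powi k * fls_trunc a Y - fls_trunc a (Y * Q powi k))"
  proof (induction a)
    case 0
    \<comment> \<open>The summation over m can start at 0 because z q^j has no negative powers of
      t.\<close>
    have "(Z * Q powi j) $$ -1 = 0" for j
      using fls_ord_ge_mult[OF ord_Z ord_Q[of j]] by (simp add: fls_ord_ge_iff)
    hence "n (-1) = 0" by (simp add: n_def g_def divided_difference_def)
    thus ?case using rec[of 0] by (simp add: fls_trunc_0)
  next
    case (Suc a)
    define y w where "y = fls_const (Y $$ int (Suc a))" and "w = fls_const ((Y * Q powi k) $$ int (Suc a))"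
    have "X * n (int (Suc a)) = n (int a) + c * (Q powi k * y - w)"
      using rec[of "int (Suc a)"] unfolding y_def w_def by (simp add: diff_eq_eq)
    hence "X ^ Suc (Suc a) * n (int (Suc a)) = X ^ Suc a * n (int a) + X ^ Suc a * (c * (Q powi k * y - w))"
      by (simp only: power_Suc2[of X "Suc a"] mult.assoc distrib_left)
    also have "\<dots> = c * (Q powi k * (fls_trunc a Y + y * X ^ Suc a) - (fls_trunc a (Y * Q powi k) + w * X ^ Suc a))"
      unfolding Suc by (simp add: ring_distribs mult_ac del: power_Suc)
    finally show ?case unfolding fls_trunc_Suc y_def w_def .
  qed
  thus ?thesis by (simp add: n_def g_def c_def)
qed


text \<open>The factor \<kappa> of the kernel as a Laurent polynomial in q = z^2. The exponent -1
  appears because z / (z_0^2 - z^2) is split off from a kernel with z in the denominator.\<close>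

definition kernel_poly :: "(complex \<times> int) list" where
  "kernel_poly = (let d = 2 * (\<alpha> - \<beta>)^2 in
     [(- \<beta> / d, -1), ((\<alpha> + 2 * \<beta>) / d, 0), (- (2 * \<alpha> + \<beta>) / d, 1), (\<alpha> / d, 2)])"

lemma kernel_poly_power:
  "q \<noteq> 0 \<Longrightarrow> (\<Sum>(p, i)\<leftarrow>kernel_poly. p * q powi i) = (\<alpha> * q - \<beta>) * (q - 1)^2 / (2 * (\<alpha> - \<beta>)^2 * q)"
proof -
  assume q: "q \<noteq> 0"
  have aux: "- \<beta> / d * q powi -1 + ((\<alpha> + 2 * \<beta>) / d + (- (2 * \<alpha> + \<beta>) / d * q + \<alpha> / d * q^2)) =
    (\<alpha> * q - \<beta>) * (q - 1)^2 / (d * q)" if "d \<noteq> 0" for d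
    using q that by (simp add: power_int_minus field_simps power2_eq_square)
  show ?thesis using aux[of "2 * (\<alpha> - \<beta>)^2"] \<alpha>_minus_\<beta>_nz
    by (simp add: kernel_poly_def Let_def)
qed

lemma EO_kernel_eq:
  assumes "z \<noteq> 0"
  shows "EO_kernel \<alpha> \<beta> z0 z = z / (z0^2 - z^2) * (\<Sum>(p, i)\<leftarrow>kernel_poly. p * (z^2) powi i)"
  using assms by (subst kernel_poly_power) (auto simp: EO_kernel_def power2_eq_square)

definition "kap = (\<Sum>(p, i)\<leftarrow>kernel_poly. fls_const p * Q powi i)"

text \<open>This is 2 y \<kappa> dx = dz. After multiplication by \<open>XA ^ 3\<close>, the lemmas
  \<open>XB_minus_XA\<close> and \<open>cross\<close> turn q - 1 into a multiple of t and \<alpha> q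
  - \<beta> into a constant.\<close>

lemma kap_psi: "2 * Y * kap = psi"
proof -
  let ?d = "Al - Be"
  have d: "fls_const (r / (2 * (\<alpha> - \<beta>)^2)) * (2 * ?d^2) = fls_const r" for r
  proof -
    have "2 * ?d^2 = fls_const (2 * (\<alpha> - \<beta>)^2)"
      by (simp add: fls_minus_const fls_const_power flip: fls_const_mult_const)
    thus ?thesis using \<alpha>_minus_\<beta>_nz by (simp add: fls_const_mult_const)
  qed
  have fls_const_3: "fls_const (- (2 * \<alpha> + \<beta>)) = - (2 * Al + Be)"
    by (simp only: fls_const_uminus) (simp flip: fls_plus_const fls_const_mult_const)
  have "kap * Q * (2 * ?d^2) = - Be + (Al + 2 * Be) * Q - (2 * Al + Be) * Q^2 + Al * Q^3"
  proof -
    have kap: "kap = fls_const (- \<beta> / (2 * (\<alpha> - \<beta>)^2)) * Q powi -1 + (fls_const ((\<alpha> + 2 * \<beta>) / (2 * (\<alpha> - \<beta>)^2))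
        + (fls_const (- (2 * \<alpha> + \<beta>) / (2 * (\<alpha> - \<beta>)^2)) * Q + fls_const (\<alpha> / (2 * (\<alpha> - \<beta>)^2)) * Q^2))"
      by (simp add: kap_def kernel_poly_def Let_def)
    have "kap * Q * (2 * ?d^2) = 
       (fls_const (- \<beta> / (2 * (\<alpha> - \<beta>)^2)) * (2 * ?d^2)) * (Q powi -1 * Q) + 
       (fls_const ((\<alpha> + 2 * \<beta>) / (2 * (\<alpha> - \<beta>)^2)) * (2 * ?d^2)) * Q
        + (fls_const (- (2 * \<alpha> + \<beta>) / (2 * (\<alpha> - \<beta>)^2)) * (2 * ?d^2)) * Q^2
        + (fls_const (\<alpha> / (2 * (\<alpha> - \<beta>)^2)) * (2 * ?d^2)) * Q^3"
    proof -
      have "(c0 * i + (c1 + (c2 * Q + c3 * Q^2))) * Q * e =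
          (c0 * e) * (i * Q) + (c1 * e) * Q + (c2 * e) * Q^2 + (c3 * e) * Q^3" for c0 c1 c2 c3 i e
        by (simp add: distrib_left distrib_right mult_ac power2_eq_square power3_eq_cube)
      thus ?thesis unfolding kap .
    qed
    also have "\<dots> = - Be + (Al + 2 * Be) * Q - (2 * Al + Be) * Q^2 + Al * Q^3"
      unfolding d fls_const_3 using nz(2)
      by (simp add: power_int_minus fls_const_mult_const flip: fls_plus_const)
         (simp add: algebra_simps flip: fls_const_mult_const)
    finally show ?thesis .
  qed
  also have "\<dots> = (Al * Q - Be) * (Q - 1)^2"
    by (simp add: power2_eq_square power3_eq_cube algebra_simps)
  finally have "kap * Q * (2 * ?d^2) * XA ^ 3 = (Al * Q - Be) * (Q - 1)^2 * XA ^ 3" by (simp only:)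
  also have "\<dots> = (Al * (Q * XA) - Be * XA) * (Q * XA - XA)^2"
    by (simp add: power2_eq_square power3_eq_cube algebra_simps)
  also have "\<dots> = ?d * (S * ?d * X)^2"
    unfolding Q_XA cross XB_minus_XA ..
  finally have "?d^2 * (kap * Q * XA^2 * (2 * XA)) = ?d^2 * (S^2 * (?d * X^2))"
    by (simp add: power2_eq_square power3_eq_cube mult_ac)
  hence "kap * Q * XA^2 * (2 * XA) = S^2 * (?d * X^2)"
    using Al_minus_Be_nz by simp
  also have "\<dots> = 2 * S^2 * Y * psi * (2 * XA)" unfolding Y_psi[symmetric] by (simp add: mult_ac)
  finally have "kap * Q * XA^2 = 2 * S^2 * Y * psi"
    using nz(3) by (simp only: mult_cancel_right) simp
  moreover have "Q * XA^2 = 4 * S^2 * Y^2" unfolding Y_square Q_XA[symmetric] by (simp add: power2_eq_square)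
  moreover have "2 * S^2 * Y * (2 * Y * kap) = kap * (4 * S^2 * Y^2)"
    by (simp add: power2_eq_square mult_ac)
  ultimately have "2 * S^2 * Y * (2 * Y * kap) = 2 * S^2 * Y * psi"
    by (metis mult.assoc)
  thus ?thesis using nz(5) S_nz by (simp add: mult.assoc)
qed

lemma slice_ev_mul_kernel: "slice_ev fls_const Q (mul_tensor kernel_poly T) \<phi>s = kap * slice_ev fls_const Q T \<phi>s"
  unfolding kap_def by (rule slice_ev_mul[OF scalar_hom_fls_const nz(2)])

text \<open>The coefficients agree by the choice of \<open>phi\<close>. The order bound on
  \<open>psi\<close> covers the low degrees, where \<open>gen_series\<close> has no
  coefficients.\<close>

lemma gen_series_slice:
  assumes "is_tensor (Suc n) T"
  shows "gen_series (\<lambda>a. tensor_ev T (phi a # \<phi>s)) = psi * slice_ev fls_const Q T \<phi>s"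
proof (rule fls_eqI)
  fix m
  have "fls_ord_ge 0 (slice_ev fls_const Q T \<phi>s)"
  proof (induction T)
    case (Cons ce T)
    obtain d e where ce: "ce = (d, e)" by force
    have "fls_ord_ge (0 + 0) (fls_const (d * monom_ev \<phi>s (tl e)) * Q powi hd e)"
      by (intro fls_ord_ge_mult fls_ord_ge_const ord_Q)
    with Cons show ?case by (simp add: ce fls_ord_ge_add)
  qed (simp add: fls_ord_ge_def)
  moreover have "psi = - (X ^ 2 * fps_to_fls (fps_deriv zfps))"
    by (simp add: psi_def Z_def fls_deriv_fps_to_fls)
  hence "fls_ord_ge (int 2 + 0) psi"
    using fls_ord_ge_mult[OF fls_ord_ge_X_power[of 2] fls_ord_ge_fps[of "fps_deriv zfps"]]
    by (auto simp: fls_ord_ge_iff)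
  ultimately have "fls_ord_ge (2 + 0) (psi * slice_ev fls_const Q T \<phi>s)"
    by (intro fls_ord_ge_mult) simp_all
  thus "gen_series (\<lambda>a. tensor_ev T (phi a # \<phi>s)) $$ m = (psi * slice_ev fls_const Q T \<phi>s) $$ m"
    by (auto simp: gen_series_nth phi_def tensor_ev_Cons_fls_nth[OF assms] fls_ord_ge_iff of_nat_diff)
qed

end

section \<open>The unstable loop equations (0,1) and (0,2)\<close>

locale dessin_solution = dessin_curve +
  fixes c :: "nat \<Rightarrow> nat multiset \<Rightarrow> complex"
  assumes dfe: "dessin_free_energy s (su^2) (sv^2) c"
begin

definition H :: "nat \<Rightarrow> nat list \<Rightarrow> complex fls" where
  "H g A = gen_series (\<lambda>m. G_coeff c g (m # A))"

lemma loop_equation: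
  assumes "\<forall>a\<in>set A. 0 < a"
  shows "fls_const (1 / s) * H g A = fls_const (su^2 + sv^2) * X * H g A
    + (\<Sum>k<length A. fls_const (of_nat (A ! k)) * fls_tail (A ! k) (H g (nths A ({0..<length A} - {k}))))
    + (if 1 \<le> g then gen_diag (\<lambda>i j. G_coeff c (g - 1) (i # j # A)) else 0)
    + (\<Sum>g1\<in>{0..g}. \<Sum>I\<in>Pow {0..<length A}. H g1 (nths A I) * H (g - g1) (nths A ({0..<length A} - I)))
    + (if g = 0 \<and> A = [] then fls_const (su^2 * sv^2) * X ^ 2 else 0)"
  unfolding H_def by (rule gen_series_loop[OF dfe assms])

text \<open>The loop equation for (0,1) is quadratic in \<open>H 0 []\<close>. Completing the square
  leaves \<open>XA * XB\<close>, that is 4 s^2 y^2, on the other side.\<close>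

lemma prefactor: "fls_const (1 / s) - fls_const (su^2 + sv^2) * X - 2 * H 0 [] = - 2 * Y"
proof -
  define p where "p = fls_const (1 / s) - fls_const (su^2 + sv^2) * X"
  define a b where "a = fls_const su" and "b = fls_const sv"
  have AB: "Al = (a - b)^2" "Be = (a + b)^2"
    by (simp_all add: a_def b_def \<alpha>_def \<beta>_def dessin_alpha_def dessin_beta_def fls_minus_const
      fls_plus_const flip: fls_const_power)
  have Sp: "S * p = 1 - S * (a^2 + b^2) * X"
    using s_nz by (simp add: p_def a_def b_def right_diff_distrib fls_const_mult_const flip: fls_const_power fls_plus_const)
  have "p * H 0 [] = (H 0 [])^2 + a^2 * b^2 * X^2"
    using loop_equation[of "[]" 0]
    by (simp add: p_def a_def b_def algebra_simps power2_eq_square flip: fls_const_mult_const)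
  hence ph: "p * H 0 [] - (H 0 [])^2 = a^2 * b^2 * X^2" by simp
  have "(S * (p - 2 * H 0 []))^2 = (S * p)^2 - 4 * S^2 * (p * H 0 [] - (H 0 [])^2)"
    by (simp add: power2_eq_square algebra_simps)
  hence "(S * (p - 2 * H 0 []))^2 = (S * p)^2 - 4 * S^2 * (a^2 * b^2 * X^2)"
    unfolding ph .
  also have "\<dots> = XA * XB"
    unfolding Sp XA_def XB_def AB by (simp add: power2_eq_square algebra_simps)
  also have "\<dots> = (S * (2 * Y))^2" unfolding Y_square[symmetric] by (simp add: power2_eq_square mult_ac)
  finally have "S * (p - 2 * H 0 []) = S * (2 * Y) \<or> S * (p - 2 * H 0 []) = S * (- (2 * Y))"
    by (simp only: power2_eq_iff mult_minus_right)
  hence "p - 2 * H 0 [] = 2 * Y \<or> p - 2 * H 0 [] = - 2 * Y"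
    unfolding mult_left_cancel[OF S_nz] by simp
  \<comment> \<open>The sign of the root is decided at t = 0, where p and -2y both equal 1/s and
    \<open>H 0 []\<close> vanishes.\<close>
  moreover have "p - 2 * H 0 [] \<noteq> 2 * Y"
  proof
    assume "p - 2 * H 0 [] = 2 * Y"
    hence "- (S * (p - 2 * H 0 [])) = Z * XA" unfolding SY[symmetric] by simp
    hence "(- (S * (p - 2 * H 0 []))) $$ 0 = (Z * XA) $$ 0" by simp
    moreover have "(Z * XA) $$ 0 = 1"
    proof -
      have "Z * XA = Z - X * (S * (Al * Z))" by (simp add: XA_def algebra_simps)
      thus ?thesis by (simp add: fls_X_times_nth Z_0) (simp add: Z_def)
    qed
    moreover have "(2 * H 0 []) $$ 0 = 0"
      by (simp add: H_def gen_series_nth flip: fls_const_numeral)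
    moreover have "p $$ 0 = 1 / s" by (simp add: p_def)
    ultimately show False using s_nz by simp
  qed
  ultimately show ?thesis by (simp add: p_def)
qed

text \<open>The two equal products in the loop equation are absorbed into the prefactor.
  \<open>H 0 []\<close> may be replaced by y under \<open>fls_tail\<close>, since they differ by
  terms of degree at most 1 in t, which \<open>fls_tail\<close> annihilates.\<close>

lemma H_0_1:
  assumes "0 < a"
  shows "- 2 * Y * H 0 [a] = fls_const (of_nat a) * fls_tail a Y"
proof -
  have P: "Pow {0..<length [a]} = {{}, {0}}" by auto
  have d: "{0..<length [a]} - {0} = {}" "{0..<length [a]} - {} = {0}" by auto
  have n: "nths [a] {0} = [a]" by simp
  have "fls_const (1 / s) * H 0 [a] = fls_const (su^2 + sv^2) * X * H 0 [a] +
     fls_const (of_nat a) * fls_tail a (H 0 []) + (H 0 [] * H 0 [a] + H 0 [a] * H 0 [])"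
    using loop_equation[of "[a]" 0] assms unfolding P by (simp add: d)
  hence "(fls_const (1 / s) - fls_const (su^2 + sv^2) * X - 2 * H 0 []) * H 0 [a] =
    fls_const (of_nat a) * fls_tail a (H 0 [])" by (simp add: algebra_simps)
  moreover have "fls_tail a (H 0 []) = fls_tail a Y"
  proof -
    have e: "fls_const 2 * H 0 [] = fls_const (1 / s) + (fls_const (- 1) * (fls_const (su^2 + sv^2) * X) + fls_const 2 * Y)"
      using prefactor by (simp add: algebra_simps)
    have "fls_const 2 * fls_tail a (H 0 []) = fls_const 2 * fls_tail a Y"
      unfolding fls_tail_cmult[symmetric] unfolding e
      using assms by (simp add: fls_tail_add fls_tail_const fls_tail_X fls_tail_cmult del: fls_const_numeral fls_const_uminus)
    thus ?thesis by simp
  qed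
  ultimately show ?thesis unfolding prefactor by simp
qed

lemma H_0_1_trunc:
  assumes "0 < a"
  shows "- 2 * Y * H 0 [a] * X ^ a = fls_const (of_nat a) * (X * (Y - fls_trunc a Y))"
  unfolding H_0_1[OF assms] fls_tail_def using nz(6) by (simp del: fls_divide_X_power)

text \<open>The two terms of the loop equation containing \<open>G\<^sub>0\<^sub>,\<^sub>2\<close> together with the truncated shift term
  correspond to the single residue computed by the divided difference.\<close>
lemma dd_tensor_series:
  fixes W :: tensor and \<phi>s :: "(int \<Rightarrow> complex) list"
  assumes a: "0 < a"
  defines "F \<equiv> psi * slice_ev fls_const Q W \<phi>s"
    and "N \<equiv> (\<Sum>(c, e)\<leftarrow>mul_tensor kernel_poly W. fls_const (c * monom_ev \<phi>s (tl e)) *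
         divided_difference Q (hd e) (\<lambda>j. fls_const (2 * (2 * of_int j + 1) * phi a j)))"
  shows "2 * Y * psi * N = 2 * H 0 [a] * F + fls_const (of_nat a) * fls_tail a F"
proof -
  define V where "V = slice_ev fls_const Q (mul_tensor kernel_poly W) \<phi>s"
  define A :: "complex fls" where "A = fls_const (of_nat a)"
  define t where "t = fls_trunc a Y"
  define w where "w = fls_trunc a (Y * V)"
  \<comment> \<open>\<open>psi\<close> is 2 y \<kappa>, and multiplication by \<kappa> is already
    part of V.\<close>
  have F: "F = 2 * Y * V"
    unfolding F_def V_def slice_ev_mul_kernel kap_psi[symmetric] by simp
  define \<Delta> where "\<Delta> k = divided_difference Q k (\<lambda>j. fls_const (2 * (2 * of_int j + 1) * phi a j))" for k
  define B where "B = (4 / (Al - Be)) * A * XA"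
  have dd: "\<Delta> k = - 2 * A * divided_difference Q k (\<lambda>j. fls_const ((Z * Q powi j) $$ int a))" for k
    unfolding \<Delta>_def phi_eq A_def divided_difference_cmult[symmetric]
    by (simp add: mult.assoc flip: fls_const_mult_const)
  have dd': "X ^ Suc a * \<Delta> k = B * (Q powi k * t - fls_trunc a (Y * Q powi k))" for k
  proof -
    have "X ^ Suc a * (- 2 * A * d) = - 2 * A * (X ^ Suc a * d)" for d by (simp only: mult_ac)
    thus ?thesis unfolding dd t_def B_def
      by (simp only: divided_difference_Z) (simp add: mult_ac)
  qed
  have "X ^ Suc a * (\<Sum>(c, e)\<leftarrow>T. fls_const (c * monom_ev \<phi>s (tl e)) * \<Delta> (hd e)) =
     B * (slice_ev fls_const Q T \<phi>s * t - fls_trunc a (Y * slice_ev fls_const Q T \<phi>s))" for T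
  proof (induction T)
    case Nil
    have "fls_trunc a 0 = 0" by (rule fls_eqI) (simp add: fls_trunc_nth)
    thus ?case by simp
  next
    case (Cons ce T)
    obtain c e where ce: "ce = (c, e)" by force
    define m where "m = fls_const (c * monom_ev \<phi>s (tl e))"
    define U where "U = slice_ev fls_const Q T \<phi>s"
    have tr: "fls_trunc a (Y * (m * Q powi hd e + U)) = m * fls_trunc a (Y * Q powi hd e) + fls_trunc a (Y * U)"
      unfolding m_def fls_trunc_cmult[symmetric] fls_trunc_add[symmetric] by (simp add: algebra_simps)
    have split: "X ^ Suc a * (m * d + r) = m * (X ^ Suc a * d) + X ^ Suc a * r" for d r
      by (simp only: ring_distribs mult_ac)
    have "X ^ Suc a * (m * \<Delta> (hd e) + (\<Sum>(c, e)\<leftarrow>T. fls_const (c * monom_ev \<phi>s (tl e)) * \<Delta> (hd e))) =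
       m * (B * (Q powi hd e * t - fls_trunc a (Y * Q powi hd e))) + B * (U * t - fls_trunc a (Y * U))"
      unfolding split Cons[folded U_def] dd' ..
    also have "\<dots> = B * ((m * Q powi hd e + U) * t - fls_trunc a (Y * (m * Q powi hd e + U)))"
      unfolding tr by (simp add: algebra_simps)
    finally show ?case
      by (simp add: ce m_def U_def del: power_Suc)
  qed
  hence N: "X ^ Suc a * N = (4 / (Al - Be)) * A * XA * (V * t - w)"
    unfolding N_def V_def w_def B_def \<Delta>_def .
  have "X ^ Suc a * (2 * Y * psi * N) = 2 * Y * psi * (X ^ Suc a * N)" by (simp only: mult_ac)
  also have "\<dots> = (4 * Y * psi * XA) * (2 / (Al - Be)) * A * (V * t - w)"
    unfolding N by (simp add: mult_ac)
  also have "\<dots> = X ^ 2 * (2 * A * (V * t - w))"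
    unfolding Y_psi using Al_minus_Be_nz by simp
  also have "\<dots> = X * (X * (2 * A * (V * t - w)))" by (simp add: power2_eq_square)
  finally have L: "X * (X ^ a * (2 * Y * psi * N)) = X * (X * (2 * A * (V * t - w)))" by (simp add: mult.assoc)
  have trF: "fls_trunc a F = 2 * w"
    using fls_trunc_cmult[of a 2 "Y * V"] unfolding F w_def by (simp add: mult.assoc)
  have "X ^ a * fls_tail a F = X * (F - fls_trunc a F)"
    unfolding fls_tail_def using nz(6) by (simp del: fls_divide_X_power)
  \<comment> \<open>After inserting \<open>H_0_1_trunc\<close> the products Y V cancel and only
    truncated terms survive.\<close>
  moreover have "X ^ a * (2 * H 0 [a] * F + A * r) =
     - 2 * V * (- 2 * Y * H 0 [a] * X ^ a) + A * (X ^ a * r)" for r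
    unfolding F by (simp add: algebra_simps)
  ultimately have "X ^ a * (2 * H 0 [a] * F + A * fls_tail a F) =
     - 2 * V * (- 2 * Y * H 0 [a] * X ^ a) + A * (X * (F - fls_trunc a F))"
    by (simp only:)
  also have "\<dots> = X * (2 * A * (V * t - w))"
    unfolding H_0_1_trunc[OF a] trF A_def[symmetric] t_def[symmetric] unfolding F by (simp add: algebra_simps)
  finally have "X * (X ^ a * (2 * Y * psi * N)) = X * (X ^ a * (2 * H 0 [a] * F + A * fls_tail a F))"
    unfolding L by (rule arg_cong[symmetric])
  hence eq: "X ^ a * (2 * Y * psi * N) = X ^ a * (2 * H 0 [a] * F + A * fls_tail a F)"
    by (rule mult_left_cancel[OF nz(6), THEN iffD1])
  have "X ^ a \<noteq> 0" by simp
  from mult_left_cancel[OF this, THEN iffD1, OF eq] show ?thesis unfolding A_def .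
qed


section \<open>The diagonal of G_{0,2}\<close>

lemma fls_deriv_square: "fls_deriv (f ^ 2) = 2 * f * fls_deriv f" for f :: "complex fls"
  by (simp add: power2_eq_square algebra_simps)

text \<open>If y^2 = R with R quadratic in t, then 4 y^3 y'' = 2 R R'' - R'^2, which is minus the
  discriminant of R and hence constant.\<close>

lemma Y_second_deriv: "64 * S ^ 2 * Y ^ 3 * fls_deriv (fls_deriv Y) = - ((Al - Be) ^ 2)"
proof -
  let ?d = "Al - Be" and ?Y' = "fls_deriv Y" and ?Y'' = "fls_deriv (fls_deriv Y)"
  have dA: "fls_deriv XA = - (S * Al)" "fls_deriv XB = - (S * Be)"
    by (simp_all add: XA_def XB_def)
  have S2: "fls_deriv (S * f) = S * fls_deriv f" for f by simp
  have 1: "8 * S^2 * (Y * ?Y') = - (S * (Al * XB + Be * XA))"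
  proof -
    have "fls_deriv (S * (S * (4 * Y ^ 2))) = fls_deriv (XA * XB)"
      using Y_square by (simp add: power2_eq_square mult_ac)
    thus ?thesis
      by (simp add: dA fls_deriv_square power2_eq_square algebra_simps)
  qed
  have 2: "8 * S^2 * (?Y' ^ 2 + Y * ?Y'') = 2 * S^2 * Al * Be"
  proof -
    have "fls_deriv (S * (S * (8 * (Y * ?Y')))) = fls_deriv (- (S * (Al * XB + Be * XA)))"
      using 1 by (simp add: power2_eq_square mult_ac)
    thus ?thesis
      by (simp add: dA power2_eq_square algebra_simps)
  qed
  have "S^2 * (64 * S^2 * Y^3 * ?Y'') = 8 * S^2 * Y^2 * (8 * S^2 * (?Y' ^ 2 + Y * ?Y'')) - (8 * S^2 * (Y * ?Y'))^2"
    by (simp add: power2_eq_square power3_eq_cube algebra_simps)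
  also have "\<dots> = S^2 * ((4 * S^2 * Y^2) * (4 * Al * Be) - (Al * XB + Be * XA)^2)"
    unfolding 1 2 by (simp add: power2_eq_square algebra_simps)
  also have "\<dots> = S^2 * (- ((Al * XB - Be * XA)^2))"
    unfolding Y_square by (simp add: power2_eq_square algebra_simps)
  finally have eq: "S^2 * (64 * S^2 * Y^3 * ?Y'') = S^2 * (- (?d ^ 2))" unfolding cross .
  have "S^2 \<noteq> 0" using S_nz by simp
  from mult_left_cancel[OF this, THEN iffD1, OF eq] show ?thesis .
qed

text \<open>Exchange of summation; the weight m(m-1)/2 is what a second derivative produces.\<close>

lemma sum_triangle:
  fixes f :: "nat \<Rightarrow> complex"
  shows "(\<Sum>a = 0..n. of_nat a * (\<Sum>m\<in>{Suc a..n}. f m)) = (\<Sum>m = 0..n. of_nat (m * (m - 1)) / 2 * f m)"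
proof (induction n)
  case (Suc n)
  have "(\<Sum>a = 0..Suc n. of_nat a * (\<Sum>m\<in>{Suc a..Suc n}. f m)) =
     (\<Sum>a = 0..n. of_nat a * (\<Sum>m\<in>{Suc a..n}. f m) + of_nat a * f (Suc n))"
    by (simp add: distrib_left)
  also have "\<dots> = (\<Sum>m = 0..n. of_nat (m * (m - 1)) / 2 * f m) + (\<Sum>a = 0..n. of_nat a) * f (Suc n)"
    by (simp add: sum.distrib Suc sum_distrib_right)
  also have "(\<Sum>a = 0..n. of_nat a :: complex) = of_nat (Suc n * n) / 2"
    by (induction n) (auto simp: field_simps)
  finally show ?case by (simp add: algebra_simps)
qed auto

definition Yfps :: "complex fps" where
  "Yfps = - (fps_const (1 / (2 * s)) * (zfps * (1 - fps_const (s * \<alpha>) * fps_X)))"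

lemma Y_fps: "Y = fps_to_fls Yfps"
proof -
  have "fps_to_fls Yfps = - (fls_const (1 / (2 * s)) * (Z * XA))"
    by (simp add: Yfps_def Z_def XA_def fls_times_fps_to_fls mult.assoc flip: fls_const_mult_const)
  moreover have "fls_const (1 / (2 * s)) * f = f / (2 * S)" for f
  proof -
    have "fls_const (1 / (2 * s)) * (2 * S) = 1"
      using s_nz by (simp add: fls_const_mult_const flip: fls_const_numeral)
    thus ?thesis using S_nz by (simp add: field_simps)
  qed
  ultimately show ?thesis by (simp add: Y_def)
qed

lemma Yfps_0: "Yfps $ 0 \<noteq> 0"
  using s_nz by (simp add: Yfps_def zfps_0)

lemma H_0_1_nth:
  "(H 0 [a]) $$ (int i + 1) = - (of_nat a / 2) * (\<Sum>m\<in>{Suc a..i + a}. Yfps $ m * inverse Yfps $ (i + a - m))"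
proof (cases "a = 0")
  case False
  let ?R = "inverse Yfps"
  have "Y * (- 2 * H 0 [a]) = fls_const (of_nat a) * (X ^ 2 * fps_to_fls (fps_shift (Suc a) Yfps))"
    using H_0_1[of a] False unfolding Y_fps fls_tail_fps by (simp add: mult_ac)
  hence "fps_to_fls ?R * (Y * (- 2 * H 0 [a])) =
     fps_to_fls ?R * (fls_const (of_nat a) * (X ^ 2 * fps_to_fls (fps_shift (Suc a) Yfps)))"
    by (rule arg_cong)
  hence "fps_to_fls ?R * Y * (- 2 * H 0 [a]) =
     fls_const (of_nat a) * (X ^ 2 * fps_to_fls (?R * fps_shift (Suc a) Yfps))"
    by (simp only: fls_times_fps_to_fls mult_ac)
  moreover have "fps_to_fls ?R * Y = 1"
    unfolding Y_fps using Yfps_0 by (simp add: inverse_mult_eq_1 flip: fls_times_fps_to_fls)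
  ultimately have "fls_const (- 2) * H 0 [a] =
     fls_const (of_nat a) * (X ^ 2 * fps_to_fls (?R * fps_shift (Suc a) Yfps))" by simp
  hence "(fls_const (- 2) * H 0 [a]) $$ (int i + 1) =
    (fls_const (of_nat a) * (X ^ 2 * fps_to_fls (?R * fps_shift (Suc a) Yfps))) $$ (int i + 1)" by simp
  hence eq: "- 2 * (H 0 [a]) $$ (int i + 1) =
     of_nat a * fps_to_fls (?R * fps_shift (Suc a) Yfps) $$ (int i - 1)"
    unfolding fls_mult_const_nth fls_X_power_times_nth by simp
  have R: "fps_to_fls (?R * fps_shift (Suc a) Yfps) $$ (int i - 1) =
      (\<Sum>m\<in>{Suc a..i + a}. Yfps $ m * ?R $ (i + a - m))"
  proof (cases i)
    case (Suc j)
    have "(?R * fps_shift (Suc a) Yfps) $ j = (\<Sum>k=0..j. Yfps $ (k + Suc a) * ?R $ (j - k))"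
      by (subst mult.commute) (simp add: fps_mult_nth)
    also have "\<dots> = (\<Sum>m\<in>{0 + Suc a..j + Suc a}. Yfps $ m * ?R $ (j - (m - Suc a)))"
      by (subst sum.shift_bounds_cl_nat_ivl) simp
    also have "\<dots> = (\<Sum>m\<in>{Suc a..i + a}. Yfps $ m * ?R $ (i + a - m))"
      by (intro sum.cong) (auto simp: Suc)
    finally show ?thesis by (simp add: Suc)
  qed auto
  have "(H 0 [a]) $$ (int i + 1) = - (1 / 2) * (- 2 * (H 0 [a]) $$ (int i + 1))" by simp
  also have "\<dots> = - (of_nat a / 2) * (\<Sum>m\<in>{Suc a..i + a}. Yfps $ m * ?R $ (i + a - m))"
    unfolding eq R by simp
  finally show ?thesis .
qed (simp add: H_def gen_series_nth G_coeff_eq)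

lemma H_nth: "(H g A) $$ (int a + 1) = G_coeff c g (a # A)"
  by (simp add: H_def gen_series_nth nat_add_distrib)

text \<open>At fixed total degree the coefficients of G_{0,2} weight the m-th coefficient of y by
  m(m-1)/2, so the diagonal is - t^4 y'' / (4 y). By \<open>Y_second_deriv\<close> this is (dz/dx)^2
  / (4 z^2), the counterpart of B(z,-z).\<close>

lemma gen_diag_H_0_2: "gen_diag (\<lambda>i j. G_coeff c 0 [i, j]) = psi ^ 2 * (fls_const (1 / 4) * Q powi -1)"
proof -
  let ?R = "inverse Yfps"
  have "(\<Sum>i = 0..n. G_coeff c 0 [i, n - i]) = - (1 / 4) * (fps_X ^ 2 * fps_deriv (fps_deriv Yfps) * ?R) $ n" for n
  proof -
    have "(\<Sum>i = 0..n. G_coeff c 0 [i, n - i]) = (\<Sum>a = 0..n. G_coeff c 0 [n - a, a])"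
      by (rule sum.reindex_bij_witness[of _ "\<lambda>a. n - a" "\<lambda>a. n - a"]) auto
    also have "\<dots> = (\<Sum>a = 0..n. - (1 / 2) * (of_nat a * (\<Sum>m\<in>{Suc a..n}. Yfps $ m * ?R $ (n - m))))"
      by (intro sum.cong refl, unfold H_nth[symmetric] H_0_1_nth) simp
    also have "\<dots> = - (1 / 2) * (\<Sum>m = 0..n. of_nat (m * (m - 1)) / 2 * (Yfps $ m * ?R $ (n - m)))"
      unfolding sum_distrib_left[symmetric] sum_triangle ..
    also have "\<dots> = - (1 / 4) * (\<Sum>m = 0..n. of_nat (m * (m - 1)) * Yfps $ m * ?R $ (n - m))"
      by (simp add: sum_distrib_left mult_ac)
    also have "(\<Sum>m = 0..n. of_nat (m * (m - 1)) * Yfps $ m * ?R $ (n - m)) =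
       (fps_X ^ 2 * fps_deriv (fps_deriv Yfps) * ?R) $ n"
      unfolding fps_mult_nth[of "fps_X ^ 2 * _"]
    proof (intro sum.cong refl arg_cong2[of _ _ _ _ "(*)"])
      fix m
      consider "m = 0" | "m = 1" | k where "m = Suc (Suc k)" by (metis One_nat_def old.nat.exhaust)
      thus "of_nat (m * (m - 1)) * Yfps $ m = (fps_X ^ 2 * fps_deriv (fps_deriv Yfps)) $ m"
        by cases (auto simp: fps_X_power_mult_nth numeral_2_eq_2 algebra_simps)
    qed
    finally show ?thesis .
  qed
  hence "gen_diag (\<lambda>i j. G_coeff c 0 [i, j]) =
     fps_to_fls (fps_X ^ 2 * (fps_const (- (1 / 4)) * (fps_X ^ 2 * fps_deriv (fps_deriv Yfps) * ?R)))"
    unfolding gen_diag_def by (intro arg_cong[of _ _ fps_to_fls] arg_cong2[of _ _ _ _ "(*)"] refl fps_ext) 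
      (simp del: fps_const_neg)
  also have "\<dots> = - (X ^ 4 * fls_const (1 / 4) * (fls_deriv (fls_deriv Y) * fps_to_fls ?R))"
    by (simp add: fls_times_fps_to_fls fps_to_fls_power Y_fps fls_deriv_fps_to_fls numeral_eq_Suc mult_ac)
  finally have "gen_diag (\<lambda>i j. G_coeff c 0 [i, j]) = 
     - (X ^ 4 * fls_const (1 / 4) * (fls_deriv (fls_deriv Y) * fps_to_fls ?R))" .
  moreover have "fps_to_fls ?R * Y = 1"
    unfolding Y_fps using Yfps_0 by (simp add: inverse_mult_eq_1 flip: fls_times_fps_to_fls)
  hence "fps_to_fls ?R = 1 / Y" using nz(5) by (simp add: field_simps)
  ultimately have g: "gen_diag (\<lambda>i j. G_coeff c 0 [i, j]) * (64 * S^2 * Y^4) =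
     - (X ^ 4 * fls_const (1 / 4)) * (64 * S^2 * Y^3 * fls_deriv (fls_deriv Y))"
    using nz(5) by (simp add: field_simps numeral_eq_Suc)
  have "(psi ^ 2 * (fls_const (1 / 4) * Q powi -1)) * (64 * S^2 * Y^4) * (Q * XA^2) = 
    fls_const (1 / 4) * (Q powi -1 * Q) * (4 * Y * psi * XA)^2 * (4 * S^2 * Y^2)"
    by (simp add: power2_eq_square numeral_eq_Suc algebra_simps)
  also have "\<dots> = fls_const (1 / 4) * X^4 * (Al - Be)^2 * (XA * XB)"
    unfolding Y_psi Y_square using nz(2) by (simp add: power_int_minus numeral_eq_Suc mult_ac)
  also have "XA * XB = Q * XA^2" unfolding Q_XA[symmetric] by (simp add: power2_eq_square)
  finally have "(psi ^ 2 * (fls_const (1 / 4) * Q powi -1)) * (64 * S^2 * Y^4) =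
     gen_diag (\<lambda>i j. G_coeff c 0 [i, j]) * (64 * S^2 * Y^4)"
    unfolding g Y_second_deriv using nz by (simp add: mult_ac)
  thus ?thesis using nz S_nz by simp
qed

section \<open>The loop equation for (0,3)\<close>

lemma phi_0: "phi a 0 = - of_nat a * Z $$ int a"
  using phi_eq[of 0 a] by simp

lemma phi_minus_1: "phi a (-1) = of_nat a * (1 / Z) $$ int a"
proof -
  have "Z * Q powi -1 = 1 / Z"
    using nz(1) by (simp add: Q_def power_int_minus power2_eq_square field_simps)
  thus ?thesis using phi_eq[of "-1" a] by simp
qed

text \<open>Truncation commutes with multiplication by the linear factor except in the top degree.
  The exceptional term is the remainder modulo that factor.\<close>

lemma trunc_times_linear:
  assumes "0 < a" and f: "\<And>m. m < 0 \<Longrightarrow> f $$ m = 0"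
  shows "fls_trunc a (f * (1 - fls_const r * X)) =
    fls_const (f $$ int a) * X ^ a + (1 - fls_const r * X) * fls_trunc (a - 1) f"
proof (rule fls_eqI)
  fix m
  have "f * (1 - fls_const r * X) = f - fls_const r * (X * f)"
    "(1 - fls_const r * X) * fls_trunc (a - 1) f = fls_trunc (a - 1) f - fls_const r * (X * fls_trunc (a - 1) f)"
    by (simp_all add: algebra_simps)
  thus "fls_trunc a (f * (1 - fls_const r * X)) $$ m =
    (fls_const (f $$ int a) * X ^ a + (1 - fls_const r * X) * fls_trunc (a - 1) f) $$ m"
    using assms by (auto simp: fls_trunc_nth fls_X_times_nth of_nat_diff)
qed

text \<open>Writing \<open>p\<^sub>a\<close> for \<open>- 2 s x\<^sup>a\<close> times the truncation of \<open>y\<close>, the two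
  factorisations \<open>- 2 s y = z (1 - s \<alpha> t) = z\<^sup>-\<^sup>1 (1 - s \<beta> t)\<close> give \<open>p\<^sub>a\<close> modulo each of
  the two linear factors of \<open>y\<^sup>2\<close>, hence products \<open>p\<^sub>a p\<^sub>b\<close> modulo \<open>y\<^sup>2\<close>.\<close>
lemma H_0_2:
  assumes a: "0 < a" and b: "0 < b"
  shows "2 * H 0 [a] * H 0 [b] + fls_const (of_nat a) * fls_tail a (H 0 [b]) + fls_const (of_nat b) * fls_tail b (H 0 [a])
    = - 2 * Y * (psi * (fls_const (\<beta> / (\<alpha> - \<beta>)^2 * (phi a (-1) * phi b (-1))) * Q powi -1
        - fls_const (\<alpha> / (\<alpha> - \<beta>)^2 * (phi a 0 * phi b 0))))"
proof -
  define p where "p k = - 2 * S * fls_trunc k Y / X ^ k" for k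
  define \<zeta> where "\<zeta> k = fls_const (Z $$ int k)" for k
  define \<eta> where "\<eta> k = fls_const ((1 / Z) $$ int k)" for k
  define u where "u k = fls_trunc (k - 1) Z / X ^ k" for k
  define v where "v k = fls_trunc (k - 1) (1 / Z) / X ^ k" for k
  have pu: "p k = \<zeta> k + XA * u k" if "0 < k" for k
  proof -
    have "- 2 * S * fls_trunc k Y = fls_trunc k (fls_const (- 2 * s) * Y)"
      unfolding fls_trunc_cmult by (simp flip: fls_const_mult_const)
    also have "fls_const (- 2 * s) * Y = Z * (1 - fls_const (s * \<alpha>) * X)"
      using SY by (simp add: XA_def mult.assoc flip: fls_const_mult_const)
    also have "fls_trunc k \<dots> = \<zeta> k * X ^ k + XA * fls_trunc (k - 1) Z"
      by (subst trunc_times_linear[OF that]) (auto simp: Z_def \<zeta>_def XA_def mult.assoc simp flip: fls_const_mult_const)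
    finally show ?thesis by (simp add: p_def u_def add_divide_distrib del: fls_divide_X_power)
  qed
  have pv: "p k = \<eta> k + XB * v k" if "0 < k" for k
  proof -
    have "- 2 * S * fls_trunc k Y = fls_trunc k (fls_const (- 2 * s) * Y)"
      unfolding fls_trunc_cmult by (simp flip: fls_const_mult_const)
    also have "fls_const (- 2 * s) * Y = Z * XA"
      using SY by (simp flip: fls_const_mult_const)
    also have "Z * XA = 1 / Z * (1 - fls_const (s * \<beta>) * X)"
      using Q_XA nz(1) by (simp add: XB_def Q_def mult.assoc power2_eq_square field_simps flip: fls_const_mult_const)
    also have "fls_trunc k \<dots> = \<eta> k * X ^ k + XB * fls_trunc (k - 1) (1 / Z)"
    proof (subst trunc_times_linear[OF that])
      have "1 / Z = Z powi -1" by (simp add: power_int_minus divide_inverse)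
      hence "fls_subdegree (1 / Z) = 0" using subdegree_Z by simp
      thus "(1 / Z) $$ m = 0" if "m < 0" for m using that by simp
    qed (auto simp: \<eta>_def XB_def mult.assoc simp flip: fls_const_mult_const)
    finally show ?thesis by (simp add: p_def v_def add_divide_distrib del: fls_divide_X_power)
  qed
  define d where "d = Al - Be"
  define M where "M = Be * XA * (\<eta> a * \<eta> b) - Al * XB * (\<zeta> a * \<zeta> b)"
  define W where "W = Be * (v a * p b + \<eta> a * v b) - Al * (u a * p b + \<zeta> a * u b)"
  \<comment> \<open>As in the Chinese remainder theorem, this constant combination of
    \<open>XA\<close> and \<open>XB\<close> merges the congruences modulo each factor into one
    modulo their product.\<close>
  have BA: "Be * XA - Al * XB = - d" using cross by (simp add: d_def algebra_simps)
  have pp: "- d * (p a * p b) = M + XA * XB * W"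
  proof -
    have 1: "p a * p b = \<eta> a * \<eta> b + XB * (v a * p b + \<eta> a * v b)"
    proof -
      have "p a * p b = \<eta> a * p b + XB * (v a * p b)"
        by (subst pv[OF a]) (simp add: algebra_simps)
      moreover have "\<eta> a * p b = \<eta> a * \<eta> b + XB * (\<eta> a * v b)"
        by (subst pv[OF b]) (simp add: algebra_simps)
      ultimately show ?thesis by (simp add: algebra_simps)
    qed
    have 2: "p a * p b = \<zeta> a * \<zeta> b + XA * (u a * p b + \<zeta> a * u b)"
    proof -
      have "p a * p b = \<zeta> a * p b + XA * (u a * p b)"
        by (subst pu[OF a]) (simp add: algebra_simps)
      moreover have "\<zeta> a * p b = \<zeta> a * \<zeta> b + XA * (\<zeta> a * u b)"
        by (subst pu[OF b]) (simp add: algebra_simps)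
      ultimately show ?thesis by (simp add: algebra_simps)
    qed
    have "- d * (p a * p b) = Be * XA * (p a * p b) - Al * XB * (p a * p b)"
      unfolding BA[symmetric] by (simp add: algebra_simps)
    also have "\<dots> = Be * XA * (\<eta> a * \<eta> b + XB * (v a * p b + \<eta> a * v b))
        - Al * XB * (\<zeta> a * \<zeta> b + XA * (u a * p b + \<zeta> a * u b))"
      by (intro arg_cong2[of _ _ _ _ minus] arg_cong2[of _ _ _ _ "(*)"] refl 1 2)
    also have "\<dots> = M + XA * XB * W" by (simp add: M_def W_def algebra_simps)
    finally show ?thesis .
  qed
  define A B where "A = fls_const (of_nat a :: complex)" and "B = fls_const (of_nat b :: complex)"
  define ha hb where "ha = H 0 [a]" and "hb = H 0 [b]"
  define xa xb where "xa = 1 / X ^ a" and "xb = 1 / X ^ b"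
  define la lb where "la = fls_trunc b ha" and "lb = fls_trunc a hb"
  define E where "E = 2 * ha * hb + A * fls_tail a hb + B * fls_tail b ha"
  define k1 k2 where "k1 = fls_const (\<beta> / (\<alpha> - \<beta>)^2 * (phi a (-1) * phi b (-1)))"
    and "k2 = fls_const (\<alpha> / (\<alpha> - \<beta>)^2 * (phi a 0 * phi b 0))"
  define R where "R = - 2 * Y * (psi * (k1 * Q powi -1 - k2))"
  define low where "low = A * (X * (lb * xa)) + B * (X * (la * xb))"
  define G where "G = A * B * X ^ 2 * (W + d * (xa * xb)) + 2 * d * low"
  have h: "4 * S * Y * H 0 [k] = - (fls_const (of_nat k) * X * (2 * S * Y * (1 / X ^ k) + p k))" if "0 < k" for k
  proof -
    have "(4 * S * Y * H 0 [k]) * X ^ k = - (2 * S * (- 2 * Y * H 0 [k] * X ^ k))"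
      by (simp add: mult_ac)
    also have "\<dots> = - (fls_const (of_nat k) * X * (2 * S * Y * (1 / X ^ k) + p k)) * X ^ k"
      unfolding H_0_1_trunc[OF that] p_def by (simp add: algebra_simps del: fls_divide_X_power)
    finally have eq: "(4 * S * Y * H 0 [k]) * X ^ k =
      - (fls_const (of_nat k) * X * (2 * S * Y * (1 / X ^ k) + p k)) * X ^ k" .
    have "X ^ k \<noteq> 0" by simp
    from mult_right_cancel[OF this, THEN iffD1, OF eq] show ?thesis .
  qed
  have tail: "fls_tail k f = X * (f * (1 / X ^ k)) - X * (fls_trunc k f * (1 / X ^ k))" for k f
    unfolding fls_tail_def by (simp add: algebra_simps diff_divide_distrib del: fls_divide_X_power)
  \<comment> \<open>Up to a multiple of \<open>XA * XB\<close>, that is 4 s^2 y^2, the left side of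
    the claim yields the same term A B t^2 M as the right side.\<close>
  have "- 2 * d * (XA * XB) * E = A * B * X ^ 2 * M + (XA * XB) * G"
  proof -
    define y where "y = 2 * S * Y"
    have yy: "y * y = XA * XB" unfolding Y_square[symmetric] y_def by (simp add: power2_eq_square mult_ac)
    have ya: "2 * y * ha = - (A * X * (y * xa + p a))" and yb: "2 * y * hb = - (B * X * (y * xb + p b))"
    proof -
      have y2: "2 * y = 4 * S * Y" by (simp add: y_def mult.assoc)
      show "2 * y * ha = - (A * X * (y * xa + p a))"
        unfolding y2 unfolding y_def A_def ha_def xa_def by (rule h[OF a])
      show "2 * y * hb = - (B * X * (y * xb + p b))"
        unfolding y2 unfolding y_def B_def hb_def xb_def by (rule h[OF b])
    qed
    have "2 * (y * y) * E = (2 * y * ha) * (2 * y * hb) + A * X * xa * y * (2 * y * hb)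
        + B * X * xb * y * (2 * y * ha) - 2 * (y * y) * low"
      unfolding E_def tail low_def xa_def[symmetric] xb_def[symmetric] la_def[symmetric] lb_def[symmetric]
      by (simp add: algebra_simps)
    also have "\<dots> = A * B * X ^ 2 * (p a * p b - (y * y) * (xa * xb)) - 2 * (y * y) * low"
      unfolding ya yb by (simp add: algebra_simps power2_eq_square)
    finally have e: "2 * (y * y) * E = A * B * X ^ 2 * (p a * p b - (y * y) * (xa * xb)) - 2 * (y * y) * low" .
    have "- d * (2 * (y * y) * E) =
        A * B * X ^ 2 * (- d * (p a * p b) + d * (y * y) * (xa * xb)) + 2 * d * (y * y) * low"
      unfolding e by (simp add: algebra_simps)
    thus ?thesis unfolding pp yy G_def by (simp add: algebra_simps)
  qed
  moreover have "- 2 * d * (XA * XB) * R = A * B * X ^ 2 * M"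
  proof -
    have k: "k1 * d^2 = Be * (A * \<eta> a) * (B * \<eta> b)" "k2 * d^2 = Al * (A * \<zeta> a) * (B * \<zeta> b)"
    proof -
      have r: "fls_const (r / (\<alpha> - \<beta>)^2 * q) * d^2 = fls_const (r * q)" for r q
        using \<alpha>_minus_\<beta>_nz by (simp add: d_def fls_minus_const fls_const_mult_const flip: fls_const_power)
      show "k1 * d^2 = Be * (A * \<eta> a) * (B * \<eta> b)" "k2 * d^2 = Al * (A * \<zeta> a) * (B * \<zeta> b)"
        unfolding k1_def k2_def r phi_0 phi_minus_1 A_def B_def \<eta>_def \<zeta>_def
        by (simp_all add: fls_const_mult_const mult.assoc)
    qed
    have "XB * Q powi -1 = XA"
      unfolding Q_XA[symmetric] using nz(2) by (simp add: power_int_minus)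
    moreover have "- 2 * d * (XA * XB) * R = d * XB * (4 * Y * psi * XA) * (k1 * Q powi -1 - k2)"
      by (simp add: R_def mult_ac)
    hence "- 2 * d * (XA * XB) * R = X ^ 2 * ((k1 * d^2) * (XB * Q powi -1) - XB * (k2 * d^2))"
      unfolding Y_psi d_def[symmetric] by (simp add: algebra_simps power2_eq_square)
    ultimately show ?thesis unfolding k M_def by (simp add: algebra_simps)
  qed
  ultimately have eq: "(XA * XB) * (- 2 * d * (E - R)) = (XA * XB) * G"
    by (simp only: right_diff_distrib) (simp add: mult_ac)
  have "XA * XB \<noteq> 0" using nz(3,4) by simp
  from mult_left_cancel[OF this, THEN iffD1, OF eq] have G: "- 2 * d * (E - R) = G" .
  \<comment> \<open>The terms M have cancelled and \<open>XA * XB\<close> is divided out. None of p,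
    u, v and 1/X^k contains a positive power of t, so G has no power of t above the first.\<close>
  have deg_p: "fls_deg_le 0 (p k)" for k
  proof -
    have "fls_deg_le (0 + int k) (fls_const (- 2 * s) * fls_trunc k Y)"
      by (intro fls_deg_le_mult fls_deg_le_const fls_deg_le_trunc)
    from fls_deg_le_divide_X[OF this, of k] show ?thesis
      by (simp add: p_def mult.assoc del: fls_divide_X_power flip: fls_const_mult_const)
  qed
  have deg_uv: "fls_deg_le (-1) (fls_trunc (k - 1) f / X ^ k)" if "0 < k" for k f
    using fls_deg_le_divide_X[OF fls_deg_le_trunc[of "k - 1" f], of k] that by (simp add: of_nat_diff)
  have deg_x: "fls_deg_le (- int k) (1 / X ^ k)" for k
    using fls_deg_le_divide_X[OF fls_deg_le_const[of 1], of k] by simp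
  have deg_d: "fls_deg_le 0 d" unfolding d_def by (intro fls_deg_le_diff fls_deg_le_const)
  have deg_W: "fls_deg_le (-1) W"
  proof -
    have "fls_deg_le (0 + (-1)) (Be * (v a * p b + \<eta> a * v b))" "fls_deg_le (0 + (-1)) (Al * (u a * p b + \<zeta> a * u b))"
      using fls_deg_le_mult[OF deg_uv[OF a] deg_p[of b]] fls_deg_le_mult[OF fls_deg_le_const deg_uv[OF b]]
      unfolding u_def v_def \<eta>_def \<zeta>_def
      by (intro fls_deg_le_mult fls_deg_le_const fls_deg_le_add; simp)+
    thus ?thesis unfolding W_def by (simp add: fls_deg_le_diff)
  qed
  have "fls_deg_le (0 + 0 + 2 + (-1)) (A * B * X ^ 2 * (W + d * (xa * xb)))"
  proof (intro fls_deg_le_mult fls_deg_le_add deg_W)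
    show "fls_deg_le 0 A" "fls_deg_le 0 B" unfolding A_def B_def by (rule fls_deg_le_const)+
    show "fls_deg_le 2 (X ^ 2)" using fls_deg_le_X_power[of 2] by simp
    show "fls_deg_le (-1) (d * (xa * xb))"
      unfolding xa_def xb_def
      by (rule fls_deg_le_mono[OF fls_deg_le_mult[OF deg_d fls_deg_le_mult[OF deg_x[of a] deg_x[of b]]]])
         (use a b in auto)
  qed
  moreover have "fls_deg_le (0 + 1) (2 * d * low)"
  proof (rule fls_deg_le_mult)
    show "fls_deg_le 0 (2 * d)"
      using fls_deg_le_mult[OF fls_deg_le_const[of 2] deg_d] by simp
    have *: "fls_deg_le (0 + (1 + (int k + - int k))) (fls_const r * (X * (fls_trunc k f * (1 / X ^ k))))" for r k f
      using fls_deg_le_X_power[of 1] by (intro fls_deg_le_mult fls_deg_le_const fls_deg_le_trunc deg_x) simp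
    show "fls_deg_le 1 low"
      unfolding low_def A_def B_def xa_def xb_def la_def lb_def
      using *[of "of_nat a" a hb] *[of "of_nat b" b ha] by (intro fls_deg_le_add) simp_all
  qed
  ultimately have deg: "fls_deg_le 1 G" unfolding G_def by (intro fls_deg_le_add) simp_all
  have ord_H: "fls_ord_ge 1 (H 0 L)" for L
    unfolding H_def by (auto simp: fls_ord_ge_iff gen_series_nth)
  have ord_tail: "fls_ord_ge 2 (fls_tail k (H 0 L))" for k L
    unfolding H_def gen_series_def fls_tail_fps
    using fls_ord_ge_mult[OF fls_ord_ge_X_power[of 2] fls_ord_ge_fps] by simp
  have ord_c: "fls_ord_ge n f \<Longrightarrow> fls_ord_ge n (fls_const r * f)" for n r f
    using fls_ord_ge_mult[OF fls_ord_ge_const] by simp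
  \<comment> \<open>E and R vanish to order at least 2 in t, which exceeds the degree bound for G
    and forces G = 0.\<close>
  have "fls_ord_ge 2 E"
    unfolding E_def A_def B_def ha_def hb_def
    using ord_c[OF fls_ord_ge_mult[OF ord_H ord_H], of 2] by (intro fls_ord_ge_add ord_c ord_tail) (simp add: mult.assoc)
  moreover have "fls_ord_ge 2 R"
  proof -
    have "psi = - (X ^ 2 * fps_to_fls (fps_deriv zfps))"
      by (simp add: psi_def Z_def fls_deriv_fps_to_fls)
    hence "fls_ord_ge (int 2 + 0) psi"
      using fls_ord_ge_mult[OF fls_ord_ge_X_power[of 2] fls_ord_ge_fps[of "fps_deriv zfps"]]
      by (auto simp: fls_ord_ge_iff)
    moreover have "fls_ord_ge 0 (k1 * Q powi -1 - k2)"
      unfolding k1_def k2_def by (intro fls_ord_ge_diff ord_c ord_Q fls_ord_ge_const)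
    moreover have "fls_ord_ge 0 Y" unfolding Y_fps by (rule fls_ord_ge_fps)
    ultimately have "fls_ord_ge (0 + (int 2 + 0 + 0)) (Y * (psi * (k1 * Q powi -1 - k2)))"
      by (intro fls_ord_ge_mult)
    from ord_c[OF this, of "- 2"] show ?thesis by (simp add: R_def mult.assoc)
  qed
  ultimately have "fls_ord_ge (0 + 2) ((fls_const (- 2) * d) * (E - R))"
    unfolding d_def by (intro fls_ord_ge_mult fls_ord_ge_diff fls_ord_ge_const ord_c)
  hence "fls_ord_ge 2 G" using G by simp
  with deg have "G = 0" by (rule fls_deg_ord_zero) simp
  hence "E = R" using G Al_minus_Be_nz by (simp add: d_def)
  thus ?thesis unfolding E_def R_def ha_def hb_def A_def B_def k1_def k2_def .
qed

end

section \<open>The induction\<close>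

text \<open>The two inequalities are 2g - 2 + n > 0 for each factor, the integration variable being
  counted among its arguments.\<close>

definition stable_splittings :: "nat \<Rightarrow> nat \<Rightarrow> (nat \<times> nat set) set" where
  "stable_splittings g n = {(g1, I). g1 \<le> g \<and> I \<subseteq> {0..<n} \<and> 2 \<le> 2 * g1 + card I \<and>
     2 \<le> 2 * (g - g1) + (n - card I)}"

lemma finite_stable_splittings: "finite (stable_splittings g n)"
  by (rule finite_subset[of _ "{0..g} \<times> Pow {0..<n}"]) (auto simp: stable_splittings_def)

text \<open>Separates the two terms with a factor of type (0,1), which the hypothesis makes
  distinct.\<close>

lemma sum_splittings_all:
  fixes F :: "nat \<Rightarrow> nat set \<Rightarrow> 'a :: comm_monoid_add"
  assumes "0 < 2 * g + n"
  shows "(\<Sum>g1\<in>{0..g}. \<Sum>I\<in>Pow {0..<n}. F g1 I) = F 0 {} + F g {0..<n} +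
    (\<Sum>g1\<in>{0..g}. \<Sum>I\<in>Pow {0..<n}. if (g1 = 0 \<and> I = {}) \<or> (g1 = g \<and> I = {0..<n}) then 0 else F g1 I)"
proof -
  let ?P = "{0..g} \<times> Pow {0..<n}" and ?E = "{(0::nat, {}), (g, {0..<n})}"
  have fin: "finite ?P" by auto
  have "(\<Sum>p\<in>?P. case p of (g1, I) \<Rightarrow> F g1 I) =
    (\<Sum>p\<in>?E. case p of (g1, I) \<Rightarrow> F g1 I) + (\<Sum>p\<in>?P - ?E. case p of (g1, I) \<Rightarrow> F g1 I)"
    by (subst sum.subset_diff[of ?E ?P]) (auto simp: add.commute)
  also have "(\<Sum>p\<in>?E. case p of (g1, I) \<Rightarrow> F g1 I) = F 0 {} + F g {0..<n}"
    using assms by (subst sum.insert) auto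
  also have "(\<Sum>p\<in>?P - ?E. case p of (g1, I) \<Rightarrow> F g1 I) =
     (\<Sum>p\<in>?P. case p of (g1, I) \<Rightarrow> if (g1 = 0 \<and> I = {}) \<or> (g1 = g \<and> I = {0..<n}) then 0 else F g1 I)"
    by (rule sum.mono_neutral_cong_left[OF fin]) (auto split: if_splits)
  finally show ?thesis by (simp add: sum.cartesian_product)
qed

text \<open>Besides the stable splittings only those with a factor of type (0,2) remain, and the
  hypothesis makes them pairwise distinct. For g = 0, n = 2 the splitting ({0},{1}) would have both
  factors of this type and be counted twice; this singles out the base case (0,3).\<close>

lemma sum_splittings_stable:
  fixes F :: "nat \<Rightarrow> nat set \<Rightarrow> 'a :: comm_monoid_add"
  assumes gn: "3 \<le> 2 * g + n"
  shows "(\<Sum>g1\<in>{0..g}. \<Sum>I\<in>Pow {0..<n}. if (g1 = 0 \<and> I = {}) \<or> (g1 = g \<and> I = {0..<n}) then 0 else F g1 I)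
     = (\<Sum>(g1, I)\<in>stable_splittings g n. F g1 I) + (\<Sum>k<n. F 0 {k} + F g ({0..<n} - {k}))"
proof -
  let ?P = "{0..g} \<times> Pow {0..<n}" and ?E = "{(0::nat, {}), (g, {0..<n})}"
  let ?L = "(\<lambda>k. (0::nat, {k})) ` {..<n}" and ?R = "(\<lambda>k. (g, {0..<n} - {k})) ` {..<n}"
  let ?F = "\<lambda>p. case p of (g1, I) \<Rightarrow> F g1 I"
  have fin: "finite ?P" by auto
  have card_compl: "card ({0..<n} - {k}) = n - 1" if "k < n" for k
    using that by (subst card_Diff_singleton) auto
  have "(\<Sum>g1\<in>{0..g}. \<Sum>I\<in>Pow {0..<n}. if (g1 = 0 \<and> I = {}) \<or> (g1 = g \<and> I = {0..<n}) then 0 else F g1 I)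
     = (\<Sum>p\<in>?P. case p of (g1, I) \<Rightarrow> if (g1 = 0 \<and> I = {}) \<or> (g1 = g \<and> I = {0..<n}) then 0 else F g1 I)"
    by (simp add: sum.cartesian_product)
  also have "\<dots> = (\<Sum>p\<in>?P - ?E. ?F p)"
    by (rule sum.mono_neutral_cong_right[OF fin]) (auto split: if_splits)
  also have "?P - ?E = stable_splittings g n \<union> (?L \<union> ?R)"
  proof (intro equalityI subsetI)
    fix p assume pin: "p \<in> ?P - ?E"
    obtain g1 I where p1: "p = (g1, I)" by force
    have p: "p = (g1, I)" "g1 \<le> g" "I \<subseteq> {0..<n}" "(g1, I) \<notin> ?E"
      using pin DiffD2[OF pin] unfolding p1 by simp_all
    have finI: "finite I" using p(3) finite_subset by blast
    have le: "card I \<le> n" using card_mono[OF _ p(3)] by simp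
    show "p \<in> stable_splittings g n \<union> (?L \<union> ?R)"
    proof (cases "2 * g1 + card I < 2")
      case True
      hence "g1 = 0" "card I < 2" by auto
      moreover have "card I \<noteq> 0" using p(4) finI \<open>g1 = 0\<close> by auto
      ultimately have "card I = 1" by simp
      then obtain k where "I = {k}" by (auto simp: card_1_singleton_iff)
      thus ?thesis using p \<open>g1 = 0\<close> by auto
    next
      case False
      show ?thesis
      proof (cases "2 * (g - g1) + (n - card I) < 2")
        case True
        hence g: "g1 = g" "n - card I < 2" using p(2) by auto
        have c: "card ({0..<n} - I) = n - card I" using p(3) finI by (subst card_Diff_subset) auto
        have "card ({0..<n} - I) \<noteq> 0" using p(3,4) g(1) by auto
        hence "card ({0..<n} - I) = 1" using c g(2) by simp
        then obtain k where k: "{0..<n} - I = {k}" by (auto simp: card_1_singleton_iff)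
        hence "I = {0..<n} - {k}" "k < n" using p(3) by auto
        thus ?thesis using p(1) g(1) by auto
      qed (use False p in \<open>auto simp: stable_splittings_def\<close>)
    qed
  next
    fix p assume "p \<in> stable_splittings g n \<union> (?L \<union> ?R)"
    then consider "p \<in> stable_splittings g n" | k where "k < n" "p = (0, {k})" | k where "k < n" "p = (g, {0..<n} - {k})"
      by auto
    thus "p \<in> ?P - ?E"
    proof cases
      case 1
      thus ?thesis by (cases p) (auto simp: stable_splittings_def)
    next
      case 2
      have "(0, {k}) \<noteq> (g, {0..<n})"
      proof
        assume "(0, {k}) = (g, {0..<n})"
        hence "g = 0" "card {k} = card {0..<n}" by simp_all
        thus False using gn by simp
      qed
      moreover have "(0, {k}) \<in> ?P" using 2(1) by auto
      ultimately show ?thesis unfolding 2(2) by (intro DiffI) simp_all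
    next
      case 3
      have "(g, {0..<n} - {k}) \<noteq> (0, {})"
      proof
        assume "(g, {0..<n} - {k}) = (0, {})"
        hence "g = 0" "card ({0..<n} - {k}) = 0" by simp_all
        thus False using gn card_compl[OF 3(1)] by simp
      qed
      moreover have "(g, {0..<n} - {k}) \<noteq> (g, {0..<n})"
      proof
        assume "(g, {0..<n} - {k}) = (g, {0..<n})"
        hence "{0..<n} - {k} = {0..<n}" by (rule Pair_inject)
        moreover have "k \<in> {0..<n}" using 3(1) by simp
        ultimately show False by blast
      qed
      moreover have "(g, {0..<n} - {k}) \<in> ?P" by simp
      ultimately show ?thesis unfolding 3(2) by (intro DiffI) simp_all
    qed
  qed
  also have "(\<Sum>p\<in>stable_splittings g n \<union> (?L \<union> ?R). ?F p) = (\<Sum>p\<in>stable_splittings g n. ?F p) + ((\<Sum>p\<in>?L. ?F p) + (\<Sum>p\<in>?R. ?F p))"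
  proof -
    have "(0, {k}) \<noteq> (g, {0..<n} - {k'})" if "k < n" "k' < n" for k k'
    proof
      assume "(0, {k}) = (g, {0..<n} - {k'})"
      hence "g = 0" "card {k} = card ({0..<n} - {k'})" by auto
      thus False using card_compl[OF that(2)] gn by auto
    qed
    note ne = this
    have LR: "?L \<inter> ?R = {}"
    proof (rule equals0I)
      fix p assume "p \<in> ?L \<inter> ?R"
      then obtain k k' where "k < n" "k' < n" "p = (0, {k})" "p = (g, {0..<n} - {k'})" by blast
      with ne[of k k'] show False by simp
    qed
    have S: "stable_splittings g n \<inter> (?L \<union> ?R) = {}"
    proof (rule equals0I)
      fix p assume "p \<in> stable_splittings g n \<inter> (?L \<union> ?R)"
      then consider k where "k < n" "p = (0, {k})" "p \<in> stable_splittings g n"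
        | k where "k < n" "p = (g, {0..<n} - {k})" "p \<in> stable_splittings g n" by blast
      thus False by cases (simp_all add: stable_splittings_def card_compl)
    qed
    have "(\<Sum>p\<in>stable_splittings g n \<union> (?L \<union> ?R). ?F p) =
        (\<Sum>p\<in>stable_splittings g n. ?F p) + (\<Sum>p\<in>?L \<union> ?R. ?F p)"
      by (rule sum.union_disjoint[OF finite_stable_splittings _ S]) simp
    also have "(\<Sum>p\<in>?L \<union> ?R. ?F p) = (\<Sum>p\<in>?L. ?F p) + (\<Sum>p\<in>?R. ?F p)"
      by (rule sum.union_disjoint[OF _ _ LR]) simp_all
    finally show ?thesis .
  qed
  also have "(\<Sum>p\<in>?L. ?F p) = (\<Sum>k<n. F 0 {k})"
    by (subst sum.reindex) (simp_all add: inj_on_def o_def)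
  also have "(\<Sum>p\<in>?R. ?F p) = (\<Sum>k<n. F g ({0..<n} - {k}))"
  proof (subst sum.reindex)
    show "inj_on (\<lambda>k. (g, {0..<n} - {k})) {..<n}"
    proof (rule inj_onI)
      fix k k' assume "k \<in> {..<n}" "k' \<in> {..<n}" "(g, {0..<n} - {k}) = (g, {0..<n} - {k'})"
      hence "k < n" "{0..<n} - {k} = {0..<n} - {k'}" by simp_all
      thus "k = k'" by (metis DiffE DiffI atLeastLessThan_iff le0 singletonD singletonI)
    qed
  qed (simp add: o_def)
  finally show ?thesis by (simp add: sum.distrib)
qed

lemma gen_diag_prod: "gen_diag (\<lambda>i j. h i * h' j) = gen_series h * gen_series h'"
proof -
  have "Abs_fps (\<lambda>m. \<Sum>i = 0..m. h i * h' (m - i)) = Abs_fps h * Abs_fps h'"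
    by (rule fps_ext) (simp add: fps_mult_nth)
  thus ?thesis unfolding gen_diag_def gen_series_def
    by (simp add: fls_times_fps_to_fls fps_to_fls_power power2_eq_square mult_ac)
qed

lemma gen_diag_add: "gen_diag (\<lambda>i j. f i j + h i j) = gen_diag f + gen_diag h"
proof -
  have "Abs_fps (\<lambda>m. \<Sum>i = 0..m. f i (m - i) + h i (m - i)) =
      Abs_fps (\<lambda>m. \<Sum>i = 0..m. f i (m - i)) + Abs_fps (\<lambda>m. \<Sum>i = 0..m. h i (m - i))"
    by (rule fps_ext) (simp add: sum.distrib)
  thus ?thesis by (simp add: gen_diag_def distrib_left)
qed

lemma gen_diag_cmult: "gen_diag (\<lambda>i j. r * f i j) = fls_const r * gen_diag f"
proof -
  have "Abs_fps (\<lambda>m. \<Sum>i = 0..m. r * f i (m - i)) = fps_const r * Abs_fps (\<lambda>m. \<Sum>i = 0..m. f i (m - i))"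
    by (rule fps_ext) (simp add: sum_distrib_left)
  thus ?thesis by (simp add: gen_diag_def fls_times_fps_to_fls mult_ac)
qed

lemma gen_diag_0: "gen_diag (\<lambda>i j. 0) = 0"
  using gen_diag_cmult[of 0 "\<lambda>i j. 0"] by simp

lemma eo_res_simple_poles:
  assumes "r > 0" "h0 holomorphic_on ball 0 r" "h holomorphic_on ball 0 r"
    and "\<And>z. z \<in> ball 0 r - {0} \<Longrightarrow> f z = h0 z / z"
    and "\<And>w. w \<in> ball 0 r - {0} \<Longrightarrow> f (1 / w) / w^2 = h w / w"
  shows "eo_res f = h0 0 - h 0"
proof -
  have ev: "\<forall>\<^sub>F w in at 0. w \<in> ball 0 r - {0::complex}"
    using eventually_at_in_open[of "ball 0 r" "0::complex"] assms(1) by simp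
  have "residue f 0 = residue (\<lambda>w. h0 w / (w - 0)) 0"
    by (rule residue_cong, rule eventually_mono[OF ev]) (use assms(4) in auto)
  moreover have "residue (\<lambda>w. f (1 / w) / w^2) 0 = residue (\<lambda>w. h w / (w - 0)) 0"
    by (rule residue_cong, rule eventually_mono[OF ev]) (use assms(5) in auto)
  moreover have "residue (\<lambda>w. h w / (w - 0)) 0 = h 0" "residue (\<lambda>w. h0 w / (w - 0)) 0 = h0 0"
    by (rule residue_simple[OF open_ball]; use assms in auto)+
  ultimately show ?thesis by (simp add: eo_res_def residue_inf_def)
qed

context dessin_solution begin

text \<open>\<open>gen_series\<close> includes the index 0, while G_{g,n} has positive indices. Both
  the functional and \<open>G_coeff\<close> vanish there, so identities for positive indices
  extend.\<close>

lemma phi_at_0: "phi 0 j = 0"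
proof -
  have "2 * (2 * of_int j + 1) * phi 0 j = 0" using phi_eq[of j 0] by simp
  moreover have "of_int (4 * j + 2) \<noteq> (0 :: complex)" by (subst of_int_eq_0_iff) presburger
  ultimately show ?thesis by simp
qed

lemma tensor_ev_phi_at_0: "is_tensor (Suc n) T \<Longrightarrow> tensor_ev T (phi 0 # \<phi>s) = 0"
proof (induction T)
  case (Cons ce T)
  obtain d j e where "ce = (d, j # e)" using Cons.prems by (cases ce; cases "snd ce") auto
  with Cons show ?case by (simp add: phi_at_0)
qed auto

lemma gen_diag_contract:
  assumes "is_tensor (Suc (Suc n)) T"
  shows "gen_diag (\<lambda>i j. tensor_ev T (phi i # phi j # \<phi>s)) =
    psi ^ 2 * slice_ev fls_const Q (contract_tensor T) \<phi>s"
  using assms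
proof (induction T)
  case Nil
  show ?case by (simp add: gen_diag_0 contract_tensor_def)
next
  case (Cons ce T)
  obtain d k l e where ce: "ce = (d, k # l # e)"
    using Cons.prems by (cases ce; cases "snd ce"; cases "tl (snd ce)") auto
  have single: "gen_series (\<lambda>a. phi a k) = psi * Q powi k" for k
    using gen_series_slice[of 0 "[(1, [k])]" "[]"] by simp
  have "gen_diag (\<lambda>i j. tensor_ev (ce # T) (phi i # phi j # \<phi>s)) =
    gen_diag (\<lambda>i j. (d * monom_ev \<phi>s e) * (phi i k * phi j l) + tensor_ev T (phi i # phi j # \<phi>s))"
    by (simp add: ce mult_ac)
  also have "\<dots> = fls_const (d * monom_ev \<phi>s e) * ((psi * Q powi k) * (psi * Q powi l)) +
     psi ^ 2 * slice_ev fls_const Q (contract_tensor T) \<phi>s"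
    unfolding gen_diag_add gen_diag_cmult gen_diag_prod single using Cons by (simp add: ce)
  also have "\<dots> = psi ^ 2 * slice_ev fls_const Q (contract_tensor (ce # T)) \<phi>s"
    using nz(2) by (simp add: slice_ev_contract[OF scalar_hom_fls_const] ce power_int_add power2_eq_square algebra_simps)
  finally show ?case .
qed

lemma H_eq_slice:
  assumes T: "is_tensor (Suc n) T" and "length A = n" "\<forall>a\<in>set A. 0 < a"
    and "\<And>A'. length A' = Suc n \<Longrightarrow> \<forall>a\<in>set A'. 0 < a \<Longrightarrow> G_coeff c g A' = tensor_ev T (map phi A')"
  shows "H g A = psi * slice_ev fls_const Q T (map phi A)"
proof -
  have "G_coeff c g (m # A) = tensor_ev T (phi m # map phi A)" for m
  proof (cases "m = 0")
    case True
    thus ?thesis using tensor_ev_phi_at_0[OF T] by (simp add: G_coeff_eq)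
  qed (use assms(2,3) assms(4)[of "m # A"] in auto)
  thus ?thesis unfolding H_def by (simp add: gen_series_slice[OF T])
qed

lemma G_coeff_eq_tensor_ev:
  assumes T: "is_tensor (Suc n) T"
    and "\<And>A. length A = n \<Longrightarrow> \<forall>a\<in>set A. 0 < a \<Longrightarrow> H g A = psi * slice_ev fls_const Q T (map phi A)"
    and "length A' = Suc n" "\<forall>a\<in>set A'. 0 < a"
  shows "G_coeff c g A' = tensor_ev T (map phi A')"
proof -
  obtain a A where A': "A' = a # A" using assms(3) by (cases A') auto
  have "G_coeff c g A' = (H g A) $$ (int a + 1)" by (simp add: A' H_nth)
  also have "\<dots> = (psi * slice_ev fls_const Q T (map phi A)) $$ (int a + 1)"
    using assms(2)[of A] assms(3,4) by (simp add: A')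
  also have "\<dots> = tensor_ev T (phi a # map phi A)"
    unfolding phi_def by (rule tensor_ev_Cons_fls_nth[OF T, symmetric])
  finally show ?thesis by (simp add: A')
qed

text \<open>The two products with a (0,1) factor are together \<open>2 * H 0 [] * H g A\<close>;
  with the terms linear in \<open>H g A\<close> they form the prefactor -2y.\<close>

lemma loop_equation_reduced:
  assumes A: "length A = n" "\<forall>a\<in>set A. 0 < a" and gn: "2 \<le> 2 * g + n"
  shows "- 2 * Y * H g A =
    (\<Sum>k<n. fls_const (of_nat (A ! k)) * fls_tail (A ! k) (H g (nths A ({0..<n} - {k}))))
    + (if 1 \<le> g then gen_diag (\<lambda>i j. G_coeff c (g - 1) (i # j # A)) else 0)
    + (\<Sum>g1\<in>{0..g}. \<Sum>I\<in>Pow {0..<n}. if (g1 = 0 \<and> I = {}) \<or> (g1 = g \<and> I = {0..<n}) then 0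
         else H g1 (nths A I) * H (g - g1) (nths A ({0..<n} - I)))"
proof -
  have all: "nths A {0..<n} = A" using A by (intro nths_all) auto
  have ne: "\<not> (g = 0 \<and> A = [])" using A gn by auto
  have "fls_const (1 / s) * H g A = fls_const (su^2 + sv^2) * X * H g A
    + (\<Sum>k<n. fls_const (of_nat (A ! k)) * fls_tail (A ! k) (H g (nths A ({0..<n} - {k}))))
    + (if 1 \<le> g then gen_diag (\<lambda>i j. G_coeff c (g - 1) (i # j # A)) else 0)
    + (2 * H 0 [] * H g A + (\<Sum>g1\<in>{0..g}. \<Sum>I\<in>Pow {0..<n}. if (g1 = 0 \<and> I = {}) \<or> (g1 = g \<and> I = {0..<n}) then 0
         else H g1 (nths A I) * H (g - g1) (nths A ({0..<n} - I))))"
    using loop_equation[OF A(2), of g] ne gn unfolding A(1)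
    by (subst (asm) sum_splittings_all) (auto simp: all)
  thus ?thesis unfolding prefactor[symmetric] by (simp add: algebra_simps)
qed

end

section \<open>One tensor for both recursions\<close>

locale dessin_recursion = dessin_solution +
  fixes om :: "nat \<Rightarrow> nat \<Rightarrow> complex list \<Rightarrow> complex"
  assumes eo: "EO_invariants s \<alpha> \<beta> om"
begin

lemma om_0_2: "om 0 2 [z1, z2] = 1 / (z1 - z2)^2"
  using eo by (simp add: EO_invariants_def)

lemma om_rec:
  assumes "length zs = n" "2 \<le> 2 * g + n"
  shows "om g (Suc n) (z0 # zs) = eo_res (\<lambda>z. EO_kernel \<alpha> \<beta> z0 z * EO_bracket om g n zs z)"
  using eo assms(2) unfolding EO_invariants_def Let_def eo_res_def assms(1)[symmetric] by blast

definition pw :: "complex \<Rightarrow> int \<Rightarrow> complex" where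
  "pw z = (\<lambda>j. (z^2) powi j)"

text \<open>The induction invariant. Reading both quantities off one tensor yields their equality
  and the even Laurent property at the same time.\<close>

definition represents :: "nat \<Rightarrow> nat \<Rightarrow> tensor \<Rightarrow> bool" where
  "represents g n T \<longleftrightarrow> is_tensor n T \<and>
     (\<forall>zs. length zs = n \<and> (\<forall>z\<in>set zs. z \<noteq> 0) \<longrightarrow> om g n zs = tensor_ev T (map pw zs)) \<and>
     (\<forall>A. length A = n \<and> (\<forall>a\<in>set A. 0 < a) \<longrightarrow> G_coeff c g A = tensor_ev T (map phi A))"

lemma representsD:
  assumes "represents g n T"
  shows "is_tensor n T"
    "length zs = n \<Longrightarrow> \<forall>z\<in>set zs. z \<noteq> 0 \<Longrightarrow> om g n zs = tensor_ev T (map pw zs)"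
    "length A = n \<Longrightarrow> \<forall>a\<in>set A. 0 < a \<Longrightarrow> G_coeff c g A = tensor_ev T (map phi A)"
  using assms by (auto simp: represents_def)

lemma represents_om_Cons:
  assumes "represents g (Suc n) T" "length zs = n" "\<forall>z\<in>set zs. z \<noteq> 0" "z \<noteq> 0"
  shows "om g (Suc n) (z # zs) = slice_ev (\<lambda>x. x) (z^2) T (map pw zs)"
proof -
  have "om g (Suc n) (z # zs) = tensor_ev T (map pw (z # zs))"
    by (rule representsD(2)[OF assms(1)]) (use assms in auto)
  also have "\<dots> = slice_ev (\<lambda>x. x) (z^2) T (map pw zs)"
    using tensor_ev_Cons_power[OF representsD(1)[OF assms(1)]] by (simp add: pw_def)
  finally show ?thesis .
qed

lemma represents_H:
  assumes "represents g (Suc n) T" "length A = n" "\<forall>a\<in>set A. 0 < a"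
  shows "H g A = psi * slice_ev fls_const Q T (map phi A)"
  by (rule H_eq_slice[OF representsD(1)[OF assms(1)] assms(2,3)]) (rule representsD(3)[OF assms(1)])

lemma representsI:
  assumes "is_tensor (Suc n) T"
    and "\<And>z0 zs. length zs = n \<Longrightarrow> \<forall>z\<in>set zs. z \<noteq> 0 \<Longrightarrow> z0 \<noteq> 0 \<Longrightarrow>
      om g (Suc n) (z0 # zs) = slice_ev (\<lambda>x. x) (z0^2) T (map pw zs)"
    and "\<And>A. length A = n \<Longrightarrow> \<forall>a\<in>set A. 0 < a \<Longrightarrow> H g A = psi * slice_ev fls_const Q T (map phi A)"
  shows "represents g (Suc n) T"
  unfolding represents_def
proof (intro conjI allI impI assms(1))
  fix zs :: "complex list" assume zs: "length zs = Suc n \<and> (\<forall>z\<in>set zs. z \<noteq> 0)"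
  then obtain z0 zs' where "zs = z0 # zs'" by (cases zs) auto
  with zs assms(2)[of zs' z0] show "om g (Suc n) zs = tensor_ev T (map pw zs)"
    using tensor_ev_Cons_power[OF assms(1)] by (simp add: pw_def)
next
  fix A :: "nat list" assume "length A = Suc n \<and> (\<forall>a\<in>set A. 0 < a)"
  thus "G_coeff c g A = tensor_ev T (map phi A)"
    using G_coeff_eq_tensor_ev[OF assms(1,3)] by blast
qed

definition neg_tensor :: "tensor \<Rightarrow> tensor" where
  "neg_tensor T = map (\<lambda>(p, e). (-1 * p, e)) T"

lemma neg_tensor:
  "is_tensor n (neg_tensor T) \<longleftrightarrow> is_tensor n T"
  "slice_ev (\<lambda>x. x) q (neg_tensor T) \<phi>s = - slice_ev (\<lambda>x. x) q T \<phi>s"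
  "slice_ev fls_const Q (neg_tensor T) \<phi>s = - slice_ev fls_const Q T \<phi>s"
  unfolding neg_tensor_def is_tensor_scale slice_ev_scale[OF scalar_hom_id] slice_ev_scale[OF scalar_hom_fls_const]
  by simp_all

lemma kernel_slice:
  assumes "z \<noteq> 0"
  shows "EO_kernel \<alpha> \<beta> z0 z * slice_ev (\<lambda>x. x) (z^2) T \<phi>s =
    z / (z0^2 - z^2) * slice_ev (\<lambda>x. x) (z^2) (mul_tensor kernel_poly T) \<phi>s"
  using assms by (simp add: EO_kernel_eq slice_ev_mul[OF scalar_hom_id])

text \<open>Division by the prefactor produces the sign that \<open>EO_bracket\<close> carries
  explicitly; hence both sides end in the same \<open>neg_tensor\<close>.\<close>

lemma psi_eq_if_Y:
  assumes "- 2 * Y * h = 2 * Y * psi * V"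
  shows "h = - (psi * V)"
proof -
  have eq: "(- 2 * Y) * h = (- 2 * Y) * (- (psi * V))"
    unfolding assms by (simp add: mult.assoc)
  have "- 2 * Y \<noteq> 0" using nz(5) by simp
  from mult_left_cancel[OF this, THEN iffD1, OF eq] show ?thesis .
qed

lemma represents_1_1: "\<exists>T. represents 1 1 T"
proof -
  \<comment> \<open>B(z,-z) contributes 1/(4 z^2), the same Laurent monomial as in
    \<open>gen_diag_H_0_2\<close>.\<close>
  define C :: tensor where "C = [(1 / 4, [-1])]"
  define U where "U = mul_tensor kernel_poly C"
  have C: "is_tensor (Suc 0) C" by (simp add: C_def)
  have "represents 1 (Suc 0) (neg_tensor U)"
  proof (rule representsI)
    show "is_tensor (Suc 0) (neg_tensor U)"
      unfolding neg_tensor U_def by (rule is_tensor_mul[OF C])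
  next
    fix z0 :: complex and zs :: "complex list"
    assume zs: "length zs = 0" and z0: "z0 \<noteq> 0"
    have br: "EO_bracket om 1 0 [] z = - om 0 2 [z, - z]" for z
    proof -
      have "{0..1::nat} = {0, 1}" by auto
      thus ?thesis by (simp add: EO_bracket_def numeral_2_eq_2)
    qed
    have "om 1 (Suc 0) [z0] = eo_res (\<lambda>z. EO_kernel \<alpha> \<beta> z0 z * EO_bracket om 1 0 [] z)"
      by (rule om_rec) auto
    also have "\<dots> = eo_res (\<lambda>z. (- 1) * (z / (z0^2 - z^2) * slice_ev (\<lambda>x. x) (z^2) U []))"
    proof (rule eo_res_cong)
      fix z :: complex assume z: "z \<noteq> 0"
      have "om 0 2 [z, - z] = slice_ev (\<lambda>x. x) (z^2) C []"
        using z by (simp add: om_0_2 C_def power_int_minus power2_eq_square field_simps)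
      thus "EO_kernel \<alpha> \<beta> z0 z * EO_bracket om 1 0 [] z =
          (- 1) * (z / (z0^2 - z^2) * slice_ev (\<lambda>x. x) (z^2) U [])"
        unfolding br U_def kernel_slice[OF z, symmetric] by simp
    qed
    also have "\<dots> = - slice_ev (\<lambda>x. x) (z0^2) U []"
      using z0 by (subst eo_res_cmult) (auto intro!: holo_near_branch_mult holo_near_branch_slice holo_near_branch_kernel
        simp: eo_res_kernel_slice simp del: times_divide_eq_left)
    finally show "om 1 (Suc 0) (z0 # zs) = slice_ev (\<lambda>x. x) (z0^2) (neg_tensor U) (map pw zs)"
      using zs by (simp add: neg_tensor)
  next
    fix A :: "nat list" assume A: "length A = 0"
    have "{0..1::nat} = {0, 1}" by auto
    hence "- 2 * Y * H 1 [] = gen_diag (\<lambda>i j. G_coeff c 0 [i, j])"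
      using loop_equation_reduced[of "[]" 0 1] by simp
    also have "\<dots> = 2 * Y * kap * psi * (fls_const (1 / 4) * Q powi -1)"
      unfolding gen_diag_H_0_2 kap_psi by (simp add: power2_eq_square mult.assoc)
    also have "\<dots> = 2 * Y * psi * slice_ev fls_const Q U []"
      unfolding U_def slice_ev_mul_kernel by (simp add: C_def mult_ac)
    finally have "H 1 [] = - (psi * slice_ev fls_const Q U [])" by (rule psi_eq_if_Y)
    thus "H 1 A = psi * slice_ev fls_const Q (neg_tensor U) (map phi A)"
      using A by (simp add: neg_tensor)
  qed
  thus ?thesis by auto
qed

text \<open>The bracket consists of products of two factors B. Times the kernel it has only simple
  poles at 0 and infinity, so both residues are read off directly; the series side is
  \<open>H_0_2\<close>.\<close>

lemma represents_0_3: "\<exists>T. represents 0 3 T"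
proof -
  \<comment> \<open>The first monomial is the residue at z = 0, the second the one at
    infinity.\<close>
  define T :: tensor where "T = [(\<beta> / (\<alpha> - \<beta>)^2, [-1, -1, -1]), (- \<alpha> / (\<alpha> - \<beta>)^2, [0, 0, 0])]"
  have Pow2: "Pow {0, 1::nat} = {{}, {0}, {1}, {0, 1}}"
    by (simp add: Pow_insert) blast
  have set2: "{0..<2::nat} = {0, 1}" by auto
  have ne: "{0} \<noteq> {0, 1::nat}" "{1} \<noteq> {0, 1::nat}" "{0, 1::nat} \<noteq> {1}" "{0::nat} \<noteq> {1}" by auto
  have diff: "{0, 1} - {0} = {1::nat}" "{0, 1} - {1} = {0::nat}" by auto
  have "represents 0 (Suc 2) T"
  proof (rule representsI)
    show "is_tensor (Suc 2) T" by (simp add: T_def)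
  next
    fix z0 :: complex and zs :: "complex list"
    assume "length zs = 2" and nz0: "\<forall>z\<in>set zs. z \<noteq> 0" "z0 \<noteq> 0"
    then obtain z1 z2 where zs: "zs = [z1, z2]" by (auto simp: length_Suc_conv numeral_2_eq_2)
    have z12: "z1 \<noteq> 0" "z2 \<noteq> 0" using nz0 zs by auto
    define b where "b z = 1 / (z - z1)^2 * (1 / (- z - z2)^2) + 1 / (z - z2)^2 * (1 / (- z - z1)^2)" for z
    have n: "nths [z1, z2] {0} = [z1]" "nths [z1, z2] {1} = [z2]" by (auto simp: nths_Cons)
    have br: "EO_bracket om 0 2 [z1, z2] z = - b z" for z
      unfolding EO_bracket_def set2 Pow2 using ne
      by (simp add: diff diff[unfolded One_nat_def] n n[unfolded One_nat_def] b_def om_0_2 om_0_2[unfolded numeral_2_eq_2] power2_eq_square)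
    define h0 where "h0 z = - ((\<alpha> * z^2 - \<beta>) * (z^2 - 1)^2 / (2 * (\<alpha> - \<beta>)^2 * (z0^2 - z^2)) * b z)" for z
    \<comment> \<open>The numerator in the coordinate w = 1/z: the kernel grows like w^-3, the
      bracket supplies w^4 and dz supplies w^-2, which leaves a simple pole.\<close>
    define h where "h w = - ((\<alpha> - \<beta> * w^2) * (1 - w^2)^2 / (2 * (\<alpha> - \<beta>)^2 * (w^2 * z0^2 - 1)) *
       (1 / (1 - w * z1)^2 * (1 / (1 + w * z2)^2) + 1 / (1 - w * z2)^2 * (1 / (1 + w * z1)^2)))" for w
    define r where "r = Min ((\<lambda>x. min (cmod x) (inverse (cmod x))) ` {z0, z1, z2})"
    have r: "r > 0" unfolding r_def using z12 nz0 by (subst Min_gr_iff) auto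
    have small: "z \<in> ball 0 (min (cmod x) (inverse (cmod x)))" if "z \<in> ball 0 r" "x \<in> {z0, z1, z2}" for z x
      using that unfolding r_def by auto
    have nzr: "z - x \<noteq> 0" "- z - x \<noteq> 0" "1 - z * x \<noteq> 0" "1 + z * x \<noteq> 0" "x^2 - z^2 \<noteq> 0" "z^2 * x^2 - 1 \<noteq> 0"
      if "z \<in> ball 0 r" "x \<in> {z0, z1, z2}" for z x
    proof -
      have "x \<noteq> 0" using that(2) z12 nz0 by auto
      note b = ball_small_nonzero[OF small[OF that] this]
      show "z - x \<noteq> 0" "- z - x \<noteq> 0" "1 - z * x \<noteq> 0" "x^2 - z^2 \<noteq> 0" "z^2 * x^2 - 1 \<noteq> 0"
        using b by auto
      show "1 + z * x \<noteq> 0" using b(4) by (auto simp: add_eq_0_iff)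
    qed
    have sq: "(z - z1)^2 \<noteq> 0" "(z - z2)^2 \<noteq> 0" "(- z - z1)^2 \<noteq> 0" "(- z - z2)^2 \<noteq> 0"
       "(1 - z * z1)^2 \<noteq> 0" "(1 - z * z2)^2 \<noteq> 0" "(1 + z * z1)^2 \<noteq> 0" "(1 + z * z2)^2 \<noteq> 0"
       "2 * (\<alpha> - \<beta>)^2 * (z0^2 - z^2) \<noteq> 0" "2 * (\<alpha> - \<beta>)^2 * (z^2 * z0^2 - 1) \<noteq> 0"
      if "z \<in> ball 0 r" for z
      using nzr[OF that, of z1] nzr[OF that, of z2] nzr[OF that, of z0] \<alpha>_minus_\<beta>_nz by simp_all
    have "om 0 (Suc 2) (z0 # zs) = eo_res (\<lambda>z. EO_kernel \<alpha> \<beta> z0 z * - b z)"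
      using om_rec[of zs 2 0 z0] by (simp add: zs br)
    also have "\<dots> = h0 0 - h 0"
    proof (rule eo_res_simple_poles[OF r])
      show "h0 holomorphic_on ball 0 r" unfolding h0_def b_def
        by (intro holomorphic_intros; erule sq)
      show "h holomorphic_on ball 0 r" unfolding h_def
        by (intro holomorphic_intros; erule sq)
      fix z :: complex assume z: "z \<in> ball 0 r - {0}"
      show "EO_kernel \<alpha> \<beta> z0 z * - b z = h0 z / z"
        using z by (simp add: EO_kernel_def h0_def)
      have z': "z \<noteq> 0" "z \<in> ball 0 r" using z by auto
      have fr: "1 / z - x = (1 - z * x) / z" "- (1 / z) - x = - (1 + z * x) / z" for x
        using z' by (auto simp: field_simps)
      have b: "b (1 / z) = z^4 * (1 / (1 - z * z1)^2 * (1 / (1 + z * z2)^2) + 1 / (1 - z * z2)^2 * (1 / (1 + z * z1)^2))"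
        unfolding b_def fr by (simp add: power_divide power2_eq_square numeral_eq_Suc algebra_simps)
      have k1: "\<alpha> * (1 / z)^2 - \<beta> = (\<alpha> - \<beta> * z^2) / z^2" "(1 / z)^2 - 1 = (1 - z^2) / z^2"
        "z0^2 - (1 / z)^2 = (z^2 * z0^2 - 1) / z^2"
        using z' by (auto simp: field_simps)
      have "p / z^2 * (q / z^2)^2 / (2 * (\<alpha> - \<beta>)^2 * (1 / z) * (w / z^2)) * - (z^4 * B) / z^2 =
         - (p * q^2 / (2 * (\<alpha> - \<beta>)^2 * w) * B) / z" if "w \<noteq> 0" for p q w B
        using z' that \<alpha>_minus_\<beta>_nz by (simp add: power_divide divide_simps) (simp add: numeral_eq_Suc)
      from this[OF nzr(6)[OF z'(2), of z0]]
      show "EO_kernel \<alpha> \<beta> z0 (1 / z) * - b (1 / z) / z^2 = h z / z"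
        unfolding EO_kernel_def b k1 h_def by simp
    qed
    also have "\<dots> = slice_ev (\<lambda>x. x) (z0^2) T (map pw zs)"
      using z12 nz0 \<alpha>_minus_\<beta>_nz
      by (simp add: h0_def h_def b_def T_def zs pw_def power_int_minus divide_simps)
    finally show "om 0 (Suc 2) (z0 # zs) = slice_ev (\<lambda>x. x) (z0^2) T (map pw zs)" .
  next
    fix A :: "nat list" assume "length A = 2" and pos: "\<forall>a\<in>set A. 0 < a"
    then obtain a b where A: "A = [a, b]" by (auto simp: length_Suc_conv numeral_2_eq_2)
    have n: "nths [a, b] {0} = [a]" "nths [a, b] {1} = [b]" by (auto simp: nths_Cons)
    have lt2: "{..<2::nat} = {0, 1}" by auto
    have "- 2 * Y * H 0 [a, b] = 2 * H 0 [a] * H 0 [b] + fls_const (of_nat a) * fls_tail a (H 0 [b])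
        + fls_const (of_nat b) * fls_tail b (H 0 [a])"
      using loop_equation_reduced[of "[a, b]" 2 0] pos ne unfolding set2 Pow2 lt2
      by (simp add: A diff diff[unfolded One_nat_def] n n[unfolded One_nat_def] mult_ac)
    also have "\<dots> = - 2 * Y * (psi * slice_ev fls_const Q T (map phi A))"
      unfolding H_0_2[OF pos[unfolded A, simplified, THEN conjunct1] pos[unfolded A, simplified, THEN conjunct2]]
      by (simp add: T_def A algebra_simps)
    finally have eq: "- 2 * Y * H 0 [a, b] = - 2 * Y * (psi * slice_ev fls_const Q T (map phi A))" .
    have "- 2 * Y \<noteq> 0" using nz(5) by simp
    from mult_left_cancel[OF this, THEN iffD1, OF eq]
    show "H 0 A = psi * slice_ev fls_const Q T (map phi A)" by (simp add: A)
  qed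
  thus ?thesis by (auto simp: numeral_3_eq_3 numeral_2_eq_2)
qed


lemma pw_minus: "pw (- z) = pw z"
  by (simp add: pw_def)

text \<open>Each kind of term in the bracket corresponds to one tensor operation:
  \<open>contract_tensor\<close> for the loop term, \<open>prod_tensor\<close> for stable products,
  \<open>dd_tensor\<close> for products with B. The same operations are then recognised in the loop
  equation.\<close>

lemma represents_step:
  assumes gn: "3 \<le> 2 * g + n"
    and IH: "\<And>g' n'. 1 \<le> n' \<Longrightarrow> 2 < 2 * g' + n' \<Longrightarrow> 2 * g' + n' < 2 * g + Suc n \<Longrightarrow> \<exists>T. represents g' n' T"
  shows "\<exists>T. represents g (Suc n) T"
proof -
  define \<T> where "\<T> g' n' = (SOME T. represents g' n' T)" for g' n'
  have \<T>: "represents g' n' (\<T> g' n')" if "1 \<le> n'" "2 < 2 * g' + n'" "2 * g' + n' < 2 * g + Suc n" for g' n'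
    unfolding \<T>_def by (rule someI_ex[OF IH[OF that]])
  have \<T>0: "represents (g - 1) (Suc (Suc n)) (\<T> (g - 1) (Suc (Suc n)))" if "1 \<le> g"
    using that gn by (intro \<T>) auto
  have \<T>n: "represents g n (\<T> g n)" if "1 \<le> n"
    using that gn by (intro \<T>) auto
  have \<T>s: "represents g1 (Suc (card I)) (\<T> g1 (Suc (card I)))"
      "represents (g - g1) (Suc (n - card I)) (\<T> (g - g1) (Suc (n - card I)))" "I \<subseteq> {0..<n}" "g1 \<le> g"
    if "(g1, I) \<in> stable_splittings g n" for g1 I
  proof -
    have c: "g1 \<le> g" "I \<subseteq> {0..<n}" "2 \<le> 2 * g1 + card I" "2 \<le> 2 * (g - g1) + (n - card I)"
      using that by (auto simp: stable_splittings_def)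
    have "card I \<le> n" using card_mono[OF _ c(2)] by simp
    thus "represents g1 (Suc (card I)) (\<T> g1 (Suc (card I)))"
      "represents (g - g1) (Suc (n - card I)) (\<T> (g - g1) (Suc (n - card I)))"
      using c by (intro \<T>; simp)+
    show "I \<subseteq> {0..<n}" "g1 \<le> g" using c by auto
  qed
  define U0 where "U0 = (if 1 \<le> g then contract_tensor (\<T> (g - 1) (Suc (Suc n))) else [])"
  define Us where "Us = (\<lambda>(g1, I). prod_tensor n I (\<T> g1 (Suc (card I))) (\<T> (g - g1) (Suc (n - card I))))"
  define Uk where "Uk = mul_tensor kernel_poly (\<T> g n)"
  obtain sl where sl: "set sl = stable_splittings g n" "distinct sl"
    using finite_distinct_list[OF finite_stable_splittings] by blast
  \<comment> \<open>The first two groups are simply multiplied by \<kappa>. For products with B the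
    factor \<kappa> is already in \<open>Uk\<close>, on which the divided difference then
    acts.\<close>
  define U where "U = mul_tensor kernel_poly U0 @ (concat (map (\<lambda>p. mul_tensor kernel_poly (Us p)) sl)
     @ concat (map (\<lambda>k. dd_tensor n k Uk) [0..<n]))"
  have U0: "is_tensor (Suc n) U0"
    unfolding U0_def using is_tensor_contract[OF representsD(1)[OF \<T>0]] by simp
  have Us: "is_tensor (Suc n) (Us p)" if "p \<in> stable_splittings g n" for p
    using \<T>s[of "fst p" "snd p"] that unfolding Us_def
    by (cases p) (auto intro!: is_tensor_prod dest: representsD(1))
  have Uk: "is_tensor n Uk" if "1 \<le> n"
    using is_tensor_mul[of "n - 1" "\<T> g n"] representsD(1)[OF \<T>n] that unfolding Uk_def by simp
  have U: "is_tensor (Suc n) U"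
    unfolding U_def using U0 Us Uk
    by (auto simp: is_tensor_concat sl(1) intro!: is_tensor_mul is_tensor_dd)
  have slice_U: "slice_ev \<iota> q U \<phi>s = slice_ev \<iota> q (mul_tensor kernel_poly U0) \<phi>s +
     ((\<Sum>p\<in>stable_splittings g n. slice_ev \<iota> q (mul_tensor kernel_poly (Us p)) \<phi>s) +
      (\<Sum>k<n. slice_ev \<iota> q (dd_tensor n k Uk) \<phi>s))" for \<iota> :: "complex \<Rightarrow> 'x::field" and q \<phi>s
    unfolding U_def by (simp add: slice_ev_concat o_def sum_list_distinct_conv_sum_set sl atLeast0LessThan)
  have compl: "{0..<n} - ({0..<n} - {k}) = {k}" "card ({0..<n} - {k}) = n - 1" if "k < n" for k
    using that by (auto simp: card_Diff_singleton)
  have "represents g (Suc n) (neg_tensor U)"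
  proof (rule representsI)
    show "is_tensor (Suc n) (neg_tensor U)" using U by (simp add: neg_tensor)
  next
    fix z0 :: complex and zs :: "complex list"
    assume zs: "length zs = n" "\<forall>z\<in>set zs. z \<noteq> 0" and z0: "z0 \<noteq> 0"
    let ?\<phi> = "map pw zs"
    define S where "S k z = 1 / (z - zs ! k)^2 + 1 / (z + zs ! k)^2" for k z
    define zk where "zk k = nths zs ({0..<n} - {k})" for k
    define f0 where "f0 z = z / (z0^2 - z^2) * slice_ev (\<lambda>x. x) (z^2) (mul_tensor kernel_poly U0) ?\<phi>" for z
    define fs where "fs p z = z / (z0^2 - z^2) * slice_ev (\<lambda>x. x) (z^2) (mul_tensor kernel_poly (Us p)) ?\<phi>" for p z
    define fk where "fk k z = z / (z0^2 - z^2) * (S k z * slice_ev (\<lambda>x. x) (z^2) Uk (map pw (zk k)))" for k z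
    have zk_nz: "zs ! k \<noteq> 0" if "k < n" for k using that zs by auto
    have sub_nz: "\<forall>z\<in>set (nths zs I). z \<noteq> 0" for I using zs(2) set_nths_subset[of zs I] by blast
    have kernel: "EO_kernel \<alpha> \<beta> z0 z * EO_bracket om g n zs z = (- 1) * (f0 z +
       ((\<Sum>p\<in>stable_splittings g n. fs p z) + (\<Sum>k<n. fk k z)))" if z: "z \<noteq> 0" for z
    proof -
      define F where "F g1 I = om g1 (card I + 1) (z # nths zs I) *
          om (g - g1) (n - card I + 1) ((- z) # nths zs ({0..<n} - I))" for g1 I
      have 0: "(if 1 \<le> g then om (g - 1) (n + 2) (z # (- z) # zs) else 0) = slice_ev (\<lambda>x. x) (z^2) U0 ?\<phi>"
      proof (cases "1 \<le> g")
        case True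
        have "om (g - 1) (Suc (Suc n)) (z # (- z) # zs) = tensor_ev (\<T> (g - 1) (Suc (Suc n))) (map pw (z # (- z) # zs))"
          by (rule representsD(2)[OF \<T>0[OF True]]) (use zs z in auto)
        also have "\<dots> = slice_ev (\<lambda>x. x) (z^2) U0 ?\<phi>"
          using tensor_ev_contract_power[OF representsD(1)[OF \<T>0[OF True]], of "z^2" ?\<phi>] z True
          by (simp add: U0_def pw_minus) (simp add: pw_def)
        finally show ?thesis using True by simp
      qed (simp add: U0_def)
      have s: "F g1 I = slice_ev (\<lambda>x. x) (z^2) (Us (g1, I)) ?\<phi>" if p: "(g1, I) \<in> stable_splittings g n" for g1 I
      proof -
        note len = length_nths_subset[OF zs(1) \<T>s(3)[OF p]]
        have "om g1 (Suc (card I)) (z # nths zs I) = slice_ev (\<lambda>x. x) (z^2) (\<T> g1 (Suc (card I))) (map pw (nths zs I))"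
          by (rule represents_om_Cons[OF \<T>s(1)[OF p] len(1) sub_nz z])
        moreover have "om (g - g1) (Suc (n - card I)) ((- z) # nths zs ({0..<n} - I)) =
           slice_ev (\<lambda>x. x) ((- z)^2) (\<T> (g - g1) (Suc (n - card I))) (map pw (nths zs ({0..<n} - I)))"
          by (rule represents_om_Cons[OF \<T>s(2)[OF p] len(2) sub_nz]) (use z in simp)
        moreover have "slice_ev (\<lambda>x. x) (z^2) (Us (g1, I)) ?\<phi> =
          slice_ev (\<lambda>x. x) (z^2) (\<T> g1 (Suc (card I))) (nths ?\<phi> I) *
          slice_ev (\<lambda>x. x) (z^2) (\<T> (g - g1) (Suc (n - card I))) (nths ?\<phi> ({0..<n} - I))"
          unfolding Us_def prod.case
          by (rule slice_ev_prod[OF scalar_hom_id])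
             (use z zs \<T>s(3)[OF p] representsD(1)[OF \<T>s(1)[OF p]] representsD(1)[OF \<T>s(2)[OF p]] in auto)
        ultimately show ?thesis by (simp add: F_def nths_map)
      qed
      \<comment> \<open>The stable factor is even in z, so 1/(z - w)^2 and 1/(-z - w)^2 multiply the
        same slice and add up to the even combination S.\<close>
      have k: "F 0 {k} + F g ({0..<n} - {k}) = S k z * slice_ev (\<lambda>x. x) (z^2) (\<T> g n) (map pw (zk k))" if kn: "k < n" for k
      proof -
        obtain m where m: "n = Suc m" using kn by (cases n) auto
        have single: "nths zs {k} = [zs ! k]" using nths_singleton_index[of k zs] kn zs by simp
        have len: "length (zk k) = m"
          unfolding zk_def using length_nths_subset(2)[OF zs(1), of "{k}"] kn m by simp
        have 1: "om g n (z' # zk k) = slice_ev (\<lambda>x. x) (z'^2) (\<T> g n) (map pw (zk k))" if "z' \<noteq> 0" for z'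
          using represents_om_Cons[of g m "\<T> g n" "zk k" z'] \<T>n that len sub_nz unfolding zk_def m by simp
        have 2: "om 0 2 [z', zs ! k] = 1 / (z' - zs ! k)^2" for z' by (rule om_0_2)
        have sq: "(- z - zs ! k)^2 = (z + zs ! k)^2" by (simp add: power2_eq_square algebra_simps)
        have "F 0 {k} = 1 / (z - zs ! k)^2 * slice_ev (\<lambda>x. x) (z^2) (\<T> g n) (map pw (zk k))"
          using kn 1[of "- z"] 2[of z] z by (simp add: F_def single zk_def[symmetric] numeral_2_eq_2)
        moreover have "F g ({0..<n} - {k}) = slice_ev (\<lambda>x. x) (z^2) (\<T> g n) (map pw (zk k)) * (1 / (z + zs ! k)^2)"
        proof -
          have e: "F g ({0..<n} - {k}) = om g (n - 1 + 1) (z # nths zs ({0..<n} - {k})) *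
             om (g - g) (n - (n - 1) + 1) ((- z) # nths zs {k})"
            unfolding F_def compl[OF kn] ..
          have nn: "n - 1 + 1 = n" "n - (n - 1) + 1 = 2" "g - g = 0" using kn by auto
          show ?thesis unfolding e nn single zk_def[symmetric] 1[OF z] 2 sq ..
        qed
        ultimately show ?thesis by (simp add: S_def algebra_simps)
      qed
      have br: "EO_bracket om g n zs z = - (slice_ev (\<lambda>x. x) (z^2) U0 ?\<phi> +
        ((\<Sum>p\<in>stable_splittings g n. slice_ev (\<lambda>x. x) (z^2) (Us p) ?\<phi>) +
         (\<Sum>k<n. S k z * slice_ev (\<lambda>x. x) (z^2) (\<T> g n) (map pw (zk k)))))"
      proof -
        have "EO_bracket om g n zs z = - ((if 1 \<le> g then om (g - 1) (n + 2) (z # (- z) # zs) else 0) +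
          (\<Sum>g1\<in>{0..g}. \<Sum>I\<in>Pow {0..<n}. if (g1 = 0 \<and> I = {}) \<or> (g1 = g \<and> I = {0..<n}) then 0 else F g1 I))"
          unfolding EO_bracket_def F_def ..
        also have "(\<Sum>g1\<in>{0..g}. \<Sum>I\<in>Pow {0..<n}. if (g1 = 0 \<and> I = {}) \<or> (g1 = g \<and> I = {0..<n}) then 0 else F g1 I) =
          (\<Sum>(g1, I)\<in>stable_splittings g n. F g1 I) + (\<Sum>k<n. F 0 {k} + F g ({0..<n} - {k}))"
          by (rule sum_splittings_stable[OF gn])
        also have "(\<Sum>(g1, I)\<in>stable_splittings g n. F g1 I) =
          (\<Sum>p\<in>stable_splittings g n. slice_ev (\<lambda>x. x) (z^2) (Us p) ?\<phi>)"
          by (intro sum.cong refl) (auto simp: s)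
        also have "(\<Sum>k<n. F 0 {k} + F g ({0..<n} - {k})) =
           (\<Sum>k<n. S k z * slice_ev (\<lambda>x. x) (z^2) (\<T> g n) (map pw (zk k)))"
          by (intro sum.cong refl) (auto simp: k)
        finally show ?thesis unfolding 0 .
      qed
      have fkk: "fk k z = EO_kernel \<alpha> \<beta> z0 z * (S k z * slice_ev (\<lambda>x. x) (z^2) (\<T> g n) (map pw (zk k)))" for k
      proof -
        have "EO_kernel \<alpha> \<beta> z0 z * (S k z * V) = S k z * (EO_kernel \<alpha> \<beta> z0 z * V)" for V by (simp only: mult_ac)
        thus ?thesis unfolding fk_def Uk_def by (simp only: kernel_slice[OF z] mult_ac)
      qed
      show ?thesis
        unfolding br fkk f0_def fs_def kernel_slice[OF z, symmetric] sum_distrib_left[symmetric]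
        by (simp only: distrib_left mult_minus_right mult_minus_left mult_1_left minus_add_distrib)
    qed
    have holo: "holo_near_branch f0" "\<And>p. holo_near_branch (fs p)" "\<And>k. k < n \<Longrightarrow> holo_near_branch (fk k)"
      unfolding f0_def fs_def fk_def S_def using z0 zk_nz
      by (intro holo_near_branch_mult holo_near_branch_kernel holo_near_branch_slice holo_near_branch_bidifferential; simp)+
    have "om g (Suc n) (z0 # zs) = eo_res (\<lambda>z. EO_kernel \<alpha> \<beta> z0 z * EO_bracket om g n zs z)"
      using gn by (intro om_rec[OF zs(1)]) simp
    also have "\<dots> = eo_res (\<lambda>z. (- 1) * (f0 z + ((\<Sum>p\<in>stable_splittings g n. fs p z) + (\<Sum>k<n. fk k z))))"
      by (rule eo_res_cong[OF kernel])
    also have "\<dots> = (- 1) * (eo_res f0 + ((\<Sum>p\<in>stable_splittings g n. eo_res (fs p)) + (\<Sum>k<n. eo_res (fk k))))"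
    proof -
      have hs: "holo_near_branch (\<lambda>z. \<Sum>p\<in>stable_splittings g n. fs p z)"
        "eo_res (\<lambda>z. \<Sum>p\<in>stable_splittings g n. fs p z) = (\<Sum>p\<in>stable_splittings g n. eo_res (fs p))"
        using eo_res_sum[of "stable_splittings g n" fs] holo(2) by auto
      have hk: "holo_near_branch (\<lambda>z. \<Sum>k<n. fk k z)" "eo_res (\<lambda>z. \<Sum>k<n. fk k z) = (\<Sum>k<n. eo_res (fk k))"
        using eo_res_sum[of "{..<n}" fk] holo(3) by auto
      have hsk: "holo_near_branch (\<lambda>z. (\<Sum>p\<in>stable_splittings g n. fs p z) + (\<Sum>k<n. fk k z))"
        by (rule holo_near_branch_add[OF hs(1) hk(1)])
      show ?thesis
        unfolding eo_res_cmult[OF holo_near_branch_add[OF holo(1) hsk]] eo_res_add[OF holo(1) hsk]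
          eo_res_add[OF hs(1) hk(1)] hs(2) hk(2) ..
    qed
    also have "eo_res f0 = slice_ev (\<lambda>x. x) (z0^2) (mul_tensor kernel_poly U0) ?\<phi>"
      unfolding f0_def by (rule eo_res_kernel_slice[OF z0])
    also have "(\<Sum>p\<in>stable_splittings g n. eo_res (fs p)) =
       (\<Sum>p\<in>stable_splittings g n. slice_ev (\<lambda>x. x) (z0^2) (mul_tensor kernel_poly (Us p)) ?\<phi>)"
      unfolding fs_def by (intro sum.cong refl eo_res_kernel_slice[OF z0])
    also have "(\<Sum>k<n. eo_res (fk k)) = (\<Sum>k<n. slice_ev (\<lambda>x. x) (z0^2) (dd_tensor n k Uk) ?\<phi>)"
    proof (intro sum.cong refl)
      fix k assume "k \<in> {..<n}"
      hence kn: "k < n" by simp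
      have "?\<phi> ! k = pw (zs ! k)" using kn zs by simp
      moreover have "is_tensor n Uk" using kn by (intro Uk) simp
      ultimately have "slice_ev (\<lambda>x. x) (z0^2) (dd_tensor n k Uk) ?\<phi> =
        (\<Sum>(c, e)\<leftarrow>Uk. c * monom_ev (map pw (zk k)) (tl e) *
           divided_difference (z0^2) (hd e) (\<lambda>j. 2 * (2 * of_int j + 1) * ((zs ! k)^2) powi j))"
        using slice_ev_dd[OF scalar_hom_id, of ?\<phi> n k Uk "z0^2"] kn zs
        by (simp only: length_map zk_def nths_map pw_def)
      thus "eo_res (fk k) = slice_ev (\<lambda>x. x) (z0^2) (dd_tensor n k Uk) ?\<phi>"
        unfolding fk_def S_def eo_res_kernel_bidifferential_slice[OF z0 zk_nz[OF kn]] by simp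
    qed
    finally show "om g (Suc n) (z0 # zs) = slice_ev (\<lambda>x. x) (z0^2) (neg_tensor U) ?\<phi>"
      unfolding neg_tensor(2) slice_U by simp
  next
    fix A :: "nat list" assume A: "length A = n" "\<forall>a\<in>set A. 0 < a"
    let ?\<phi> = "map phi A"
    define Ak where "Ak k = nths A ({0..<n} - {k})" for k
    have sub_pos: "\<forall>a\<in>set (nths A I). 0 < a" for I using A(2) set_nths_subset[of A I] by blast
    define F where "F g1 I = H g1 (nths A I) * H (g - g1) (nths A ({0..<n} - I))" for g1 I
    \<comment> \<open>A quadratic term carries two factors \<open>psi\<close>; one of them is traded
      for 2 y \<kappa>.\<close>
    have mul: "psi^2 * slice_ev fls_const Q V ?\<phi> = 2 * Y * psi * slice_ev fls_const Q (mul_tensor kernel_poly V) ?\<phi>" for V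
      unfolding slice_ev_mul_kernel by (subst kap_psi[symmetric]) (simp add: power2_eq_square kap_psi[symmetric] mult_ac)
    have 0: "(if 1 \<le> g then gen_diag (\<lambda>i j. G_coeff c (g - 1) (i # j # A)) else 0) = psi^2 * slice_ev fls_const Q U0 ?\<phi>"
    proof (cases "1 \<le> g")
      case True
      note T = representsD(1,3)[OF \<T>0[OF True]]
      have "G_coeff c (g - 1) (i # j # A) = tensor_ev (\<T> (g - 1) (Suc (Suc n))) (phi i # phi j # ?\<phi>)" for i j
      proof (cases "i = 0 \<or> j = 0")
        case True
        have "tensor_ev T' (phi i # phi j # ?\<phi>) = 0" if "is_tensor (Suc (Suc n)) T'" for T'
          using that
        proof (induction T')
          case (Cons ce T')
          obtain d k l e where "ce = (d, k # l # e)"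
            using Cons.prems by (cases ce; cases "snd ce"; cases "tl (snd ce)") auto
          with Cons True show ?case by (auto simp: phi_at_0)
        qed auto
        with T(1) True show ?thesis by (auto simp: G_coeff_eq)
      qed (use T(2)[of "i # j # A"] A in auto)
      thus ?thesis using True gen_diag_contract[OF T(1), of ?\<phi>] by (simp add: U0_def)
    qed (simp add: U0_def)
    have s: "F g1 I = psi^2 * slice_ev fls_const Q (Us (g1, I)) ?\<phi>" if p: "(g1, I) \<in> stable_splittings g n" for g1 I
    proof -
      note len = length_nths_subset[OF A(1) \<T>s(3)[OF p]]
      have "slice_ev fls_const Q (Us (g1, I)) ?\<phi> =
          slice_ev fls_const Q (\<T> g1 (Suc (card I))) (nths ?\<phi> I) *
          slice_ev fls_const Q (\<T> (g - g1) (Suc (n - card I))) (nths ?\<phi> ({0..<n} - I))"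
        unfolding Us_def prod.case
        by (rule slice_ev_prod[OF scalar_hom_fls_const])
           (use nz(2) A \<T>s(3)[OF p] representsD(1)[OF \<T>s(1)[OF p]] representsD(1)[OF \<T>s(2)[OF p]] in auto)
      thus ?thesis
        unfolding F_def represents_H[OF \<T>s(1)[OF p] len(1) sub_pos] represents_H[OF \<T>s(2)[OF p] len(2) sub_pos]
        by (simp add: nths_map power2_eq_square mult_ac)
    qed
    \<comment> \<open>The products with G_{0,2} and the shift term at position k have to be grouped:
      only their sum is the expansion of a \<open>dd_tensor\<close>.\<close>
    have k: "F 0 {k} + F g ({0..<n} - {k}) + fls_const (of_nat (A ! k)) * fls_tail (A ! k) (H g (Ak k)) =
       2 * Y * psi * slice_ev fls_const Q (dd_tensor n k Uk) ?\<phi>" if kn: "k < n" for k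
    proof -
      obtain m where m: "n = Suc m" using kn by (cases n) auto
      have single: "nths A {k} = [A ! k]" using nths_singleton_index[of k A] kn A by simp
      have len: "length (Ak k) = m"
        unfolding Ak_def using length_nths_subset(2)[OF A(1), of "{k}"] kn m by simp
      have HA: "H g (Ak k) = psi * slice_ev fls_const Q (\<T> g n) (map phi (Ak k))"
        using represents_H[of g m "\<T> g n" "Ak k"] \<T>n len sub_pos unfolding Ak_def m by simp
      have pos: "0 < A ! k" using kn A by simp
      have "?\<phi> ! k = phi (A ! k)" using kn A by simp
      moreover have "is_tensor n Uk" using kn by (intro Uk) simp
      ultimately have "slice_ev fls_const Q (dd_tensor n k Uk) ?\<phi> =
        (\<Sum>(c, e)\<leftarrow>mul_tensor kernel_poly (\<T> g n). fls_const (c * monom_ev (map phi (Ak k)) (tl e)) *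
           divided_difference Q (hd e) (\<lambda>j. fls_const (2 * (2 * of_int j + 1) * phi (A ! k) j)))"
        using slice_ev_dd[OF scalar_hom_fls_const, of ?\<phi> n k Uk Q] kn A
        by (simp only: length_map Ak_def nths_map Uk_def)
      moreover have "F 0 {k} + F g ({0..<n} - {k}) = 2 * H 0 [A ! k] * H g (Ak k)"
        unfolding F_def compl[OF kn] single Ak_def by simp
      ultimately show ?thesis
        using dd_tensor_series[OF pos, where W = "\<T> g n" and \<phi>s = "map phi (Ak k)"] unfolding HA by simp
    qed
    have "- 2 * Y * H g A = (\<Sum>k<n. fls_const (of_nat (A ! k)) * fls_tail (A ! k) (H g (Ak k))) +
      psi^2 * slice_ev fls_const Q U0 ?\<phi> +
      ((\<Sum>(g1, I)\<in>stable_splittings g n. F g1 I) + (\<Sum>k<n. F 0 {k} + F g ({0..<n} - {k})))"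
    proof -
      have "2 \<le> 2 * g + n" using gn by simp
      from loop_equation_reduced[OF A this] show ?thesis
        unfolding 0 F_def[symmetric] Ak_def[symmetric] sum_splittings_stable[OF gn] .
    qed
    also have "(\<Sum>(g1, I)\<in>stable_splittings g n. F g1 I) = (\<Sum>p\<in>stable_splittings g n. psi^2 * slice_ev fls_const Q (Us p) ?\<phi>)"
      by (intro sum.cong refl) (auto simp: s)
    also have "(\<Sum>k<n. fls_const (of_nat (A ! k)) * fls_tail (A ! k) (H g (Ak k))) + psi^2 * slice_ev fls_const Q U0 ?\<phi> +
       ((\<Sum>p\<in>stable_splittings g n. psi^2 * slice_ev fls_const Q (Us p) ?\<phi>) + (\<Sum>k<n. F 0 {k} + F g ({0..<n} - {k}))) =
       psi^2 * slice_ev fls_const Q U0 ?\<phi> + ((\<Sum>p\<in>stable_splittings g n. psi^2 * slice_ev fls_const Q (Us p) ?\<phi>) +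
       (\<Sum>k<n. F 0 {k} + F g ({0..<n} - {k}) + fls_const (of_nat (A ! k)) * fls_tail (A ! k) (H g (Ak k))))"
      by (simp add: sum.distrib algebra_simps)
    also have "(\<Sum>k<n. F 0 {k} + F g ({0..<n} - {k}) + fls_const (of_nat (A ! k)) * fls_tail (A ! k) (H g (Ak k))) =
       (\<Sum>k<n. 2 * Y * psi * slice_ev fls_const Q (dd_tensor n k Uk) ?\<phi>)"
      by (intro sum.cong refl) (auto simp: k)
    finally have "- 2 * Y * H g A = 2 * Y * psi * slice_ev fls_const Q U ?\<phi>"
      unfolding mul slice_U sum_distrib_left[symmetric] by (simp only: distrib_left)
    from psi_eq_if_Y[OF this] show "H g A = psi * slice_ev fls_const Q (neg_tensor U) ?\<phi>"
      by (simp add: neg_tensor)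
  qed
  thus ?thesis by blast
qed

lemma represents_exists:
  assumes "1 \<le> n" "2 < 2 * g + n"
  shows "\<exists>T. represents g n T"
  using assms
proof (induction "2 * g + n" arbitrary: g n rule: less_induct)
  case less
  obtain m where m: "n = Suc m" using less.prems by (cases n) auto
  \<comment> \<open>The equation 2g + m = 2 with m = n - 1 leaves exactly the two base
    cases.\<close>
  consider "g = 1" "n = 1" | "g = 0" "n = 3" | "3 \<le> 2 * g + m"
  proof -
    have "(g = 1 \<and> n = 1) \<or> (g = 0 \<and> n = 3) \<or> 3 \<le> 2 * g + m"
      using less.prems m by presburger
    thus ?thesis using that by blast
  qed
  thus ?case
  proof cases
    case 3
    thus ?thesis unfolding m by (rule represents_step) (use less.hyps m in auto)
  qed (use represents_1_1 represents_0_3 in auto)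
qed

end

section \<open>Convergence near \<open>z = 1\<close>\<close>

text \<open>For complex families summability is absolute summability, and the product of the
  absolute families gives summability over pairs.\<close>

lemma has_sum_mult_Times:
  fixes f :: "'a \<Rightarrow> complex" and g :: "'b \<Rightarrow> complex"
  assumes f: "(f has_sum s) A" and g: "(g has_sum t) B"
  shows "((\<lambda>(x, y). f x * g y) has_sum (s * t)) (A \<times> B)"
proof (rule has_sum_SigmaI)
  show "((\<lambda>y. case (x, y) of (x, y) \<Rightarrow> f x * g y) has_sum f x * t) B" for x
    using has_sum_cmult_right[OF g] by simp
  show "((\<lambda>x. f x * t) has_sum s * t) A" by (rule has_sum_cmult_left[OF f])
  have "(\<lambda>x. norm (f x)) summable_on A"
    using has_sum_imp_summable[OF f] unfolding summable_on_iff_abs_summable_on_complex .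
  moreover have "(\<lambda>y. norm (g y)) summable_on B"
    using has_sum_imp_summable[OF g] unfolding summable_on_iff_abs_summable_on_complex .
  ultimately obtain s' t' where st: "((\<lambda>x. norm (f x)) has_sum s') A" "((\<lambda>y. norm (g y)) has_sum t') B"
    unfolding summable_on_def by metis
  have "(\<lambda>p. norm (case p of (x, y) \<Rightarrow> f x * g y)) summable_on A \<times> B"
  proof (rule summable_on_SigmaI)
    show "((\<lambda>y. norm (case (x, y) of (x, y) \<Rightarrow> f x * g y)) has_sum norm (f x) * t') B" for x
      using has_sum_cmult_right[OF st(2), of "norm (f x)"] by (simp add: norm_mult)
    show "(\<lambda>x. norm (f x) * t') summable_on A"
      by (rule has_sum_imp_summable[OF has_sum_cmult_left[OF st(1)]])
  qed auto
  thus "(\<lambda>(x, y). f x * g y) summable_on A \<times> B"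
    by (rule abs_summable_summable)
qed

lemma has_sum_prod_lists:
  fixes f :: "nat \<Rightarrow> 'a \<Rightarrow> complex"
  assumes "\<And>i. i < n \<Longrightarrow> (f i has_sum S i) K"
  shows "((\<lambda>a. \<Prod>i<n. f i (a ! i)) has_sum (\<Prod>i<n. S i)) {a. length a = n \<and> (\<forall>k\<in>set a. k \<in> K)}"
  using assms
proof (induction n arbitrary: f S)
  case 0
  have "{a :: 'a list. length a = 0 \<and> (\<forall>k\<in>set a. k \<in> K)} = {[]}" by auto
  thus ?case by (simp only: prod.empty lessThan_0) (simp add: has_sum_finite_iff)
next
  case (Suc n)
  let ?L = "{a. length a = n \<and> (\<forall>k\<in>set a. k \<in> K)}"
  have "((\<lambda>(x, a). f 0 x * (\<Prod>i<n. f (Suc i) (a ! i))) has_sum (S 0 * (\<Prod>i<n. S (Suc i)))) (K \<times> ?L)"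
    by (intro has_sum_mult_Times Suc.IH Suc.prems) auto
  hence "((\<lambda>(x, a). \<Prod>i<Suc n. f i ((x # a) ! i)) has_sum (\<Prod>i<Suc n. S i)) (K \<times> ?L)"
    by (simp add: prod.lessThan_Suc_shift del: prod.lessThan_Suc)
  also have "?this \<longleftrightarrow> ((\<lambda>a. \<Prod>i<Suc n. f i (a ! i)) has_sum (\<Prod>i<Suc n. S i)) {a. length a = Suc n \<and> (\<forall>k\<in>set a. k \<in> K)}"
    by (rule has_sum_reindex_bij_witness[of _ "\<lambda>a. (hd a, tl a)" "\<lambda>(x, a). x # a"])
       (auto simp: length_Suc_conv)
  finally show ?case .
qed

lemma monom_ev_conv_prod:
  "length \<phi>s = n \<Longrightarrow> length e = n \<Longrightarrow> monom_ev \<phi>s e = (\<Prod>i<n. (\<phi>s ! i) (e ! i))"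
proof (induction \<phi>s arbitrary: n e)
  case (Cons \<phi> \<phi>s)
  then obtain m j e' where "n = Suc m" "e = j # e'" by (cases n; cases e) auto
  with Cons show ?case by (simp add: prod.lessThan_Suc_shift del: prod.lessThan_Suc)
qed auto

section \<open>Expansion of z^(2j) dz in powers of 1/x\<close>

context dessin_recursion begin

abbreviation "xc \<equiv> curve_x s \<alpha> \<beta>"

lemma xc_deriv:
  assumes "z^2 \<noteq> 1"
  shows "deriv xc z = - (2 * s * z * (\<alpha> - \<beta>)) / (z^2 - 1)^2"
proof -
  have "(xc has_field_derivative (- (2 * s * z * (\<alpha> - \<beta>)) / (z^2 - 1)^2)) (at z)"
    unfolding curve_x_def using assms
    by (auto intro!: derivative_eq_intros simp: power2_eq_square algebra_simps)
  thus ?thesis by (rule DERIV_imp_deriv)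
qed

definition "z_diff j t = deriv z_of t * ((z_of t)^2) powi j"

lemma z_of_square:
  "z_of t ^ 2 = (1 - s * \<beta> * t) / (1 - s * \<alpha> * t)"
  by (simp add: z_of_def)

text \<open>The Taylor coefficients of z^(2j) dz/dt are read off the formal expansion. The disc does
  not depend on j, so one radius serves all monomials of a tensor.\<close>

lemma z_diff_series:
  assumes r: "r > 0" "\<forall>t\<in>ball 0 r. 1 - s * \<alpha> * t \<noteq> 0 \<and> 1 - s * \<beta> * t \<noteq> 0 \<and>
     (1 - s * \<beta> * t) / (1 - s * \<alpha> * t) \<notin> \<real>\<^sub>\<le>\<^sub>0"
    and t: "t \<in> ball 0 r"
  shows "((\<lambda>n. - phi (Suc n) j * t ^ n) has_sum z_diff j t) UNIV"
proof -
  have holo: "z_of holomorphic_on ball 0 r" using r(2) by (intro z_of_holomorphic) auto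
  have nz': "z_of w \<noteq> 0" if "w \<in> ball 0 r" for w
    using z_of_square[of w] r(2) that by auto
  have holo': "z_diff j holomorphic_on ball 0 r"
    unfolding z_diff_def using nz' by (intro holomorphic_intros holo) auto
  have an: "z_diff j analytic_on {0}" using holo' r(1) by (meson analytic_at centre_in_ball open_ball)
  have "z_of has_laurent_expansion Z"
    unfolding Z_def using z_of_fps_expansion by (rule has_laurent_expansion_fps)
  hence "z_diff j has_laurent_expansion fls_deriv Z * Q powi j"
    unfolding z_diff_def Q_def by (intro laurent_expansion_intros)
  moreover have "z_diff j has_laurent_expansion fps_to_fls (fps_expansion (z_diff j) 0)"
    by (rule has_laurent_expansion_fps[OF analytic_at_imp_has_fps_expansion_0[OF an]])
  ultimately have eq: "fls_deriv Z * Q powi j = fps_to_fls (fps_expansion (z_diff j) 0)"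
    by (rule has_laurent_expansion_unique)
  have coeff: "- phi (Suc n) j = (deriv ^^ n) (z_diff j) 0 / fact n" for n
  proof -
    have "psi * Q powi j = - (X ^ 2 * (fls_deriv Z * Q powi j))" by (simp add: psi_def mult_ac)
    hence "- phi (Suc n) j = (fls_deriv Z * Q powi j) $$ int n"
      unfolding phi_def by (simp add: fls_X_power_times_nth)
    thus ?thesis unfolding eq by (simp add: fps_expansion_def)
  qed
  have sums: "(\<lambda>n. - phi (Suc n) j * w ^ n) sums z_diff j w" if "w \<in> ball 0 r" for w
    using holomorphic_power_series[OF holo' that] unfolding coeff by simp
  \<comment> \<open>Absolute convergence at t follows from convergence at a point of larger modulus
    in the disc.\<close>
  obtain \<rho> where \<rho>: "cmod t < \<rho>" "\<rho> < r" using t dense[of "cmod t" r] by auto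
  hence "\<rho> > 0" by (meson norm_ge_zero order.strict_trans1)
  hence "complex_of_real \<rho> \<in> ball 0 r" using \<rho> by simp
  from sums[OF this] have "summable (\<lambda>n. norm (- phi (Suc n) j * t ^ n))"
    by (intro powser_insidea[of _ "complex_of_real \<rho>"]) (use \<rho> \<open>\<rho> > 0\<close> in \<open>auto simp: sums_iff\<close>)
  thus ?thesis using sums[OF t] by (rule norm_summable_imp_has_sum)
qed

lemma z_of_deriv:
  assumes r: "r > 0" "\<forall>t\<in>ball 0 r. 1 - s * \<alpha> * t \<noteq> 0 \<and> 1 - s * \<beta> * t \<noteq> 0 \<and>
     (1 - s * \<beta> * t) / (1 - s * \<alpha> * t) \<notin> \<real>\<^sub>\<le>\<^sub>0"
    and t: "t \<in> ball 0 r"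
  shows "2 * z_of t * deriv z_of t * (1 - s * \<alpha> * t) = s * (\<alpha> * z_of t ^ 2 - \<beta>)"
proof -
  have holo: "z_of holomorphic_on ball 0 r" using r(2) by (intro z_of_holomorphic) auto
  have "(z_of has_field_derivative deriv z_of t) (at t)"
    using holomorphic_derivI[OF holo open_ball t] .
  hence "((\<lambda>t. z_of t ^ 2 * (1 - s * \<alpha> * t)) has_field_derivative
     (2 * z_of t * deriv z_of t * (1 - s * \<alpha> * t) - z_of t ^ 2 * (s * \<alpha>))) (at t)"
    by (auto intro!: derivative_eq_intros)
  moreover have "((\<lambda>t. z_of t ^ 2 * (1 - s * \<alpha> * t)) has_field_derivative (- (s * \<beta>))) (at t)"
  proof (rule has_field_derivative_transform_within_open[of "\<lambda>t. 1 - s * \<beta> * t"])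
    show "((\<lambda>t. 1 - s * \<beta> * t) has_field_derivative - (s * \<beta>)) (at t)"
      by (auto intro!: derivative_eq_intros)
    show "1 - s * \<beta> * w = z_of w ^ 2 * (1 - s * \<alpha> * w)" if "w \<in> ball 0 r" for w
      using r(2) that by (simp add: z_of_square)
  qed (use t in auto)
  ultimately have "2 * z_of t * deriv z_of t * (1 - s * \<alpha> * t) - z_of t ^ 2 * (s * \<alpha>) = - (s * \<beta>)"
    by (rule DERIV_unique)
  thus ?thesis by (simp add: algebra_simps)
qed

text \<open>For z near 1 the value t = 1/x(z) is small and z is recovered as \<open>z_of t\<close>.
  Multiplying the series for z^(2j) dz/dt by - t^2 dx/dz cancels dz/dt and raises the exponents to
  a+1.\<close>

lemma expansion_radius:
  "\<exists>r>0. \<forall>z. 0 < cmod (z - 1) \<and> cmod (z - 1) < r \<longrightarrow>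
     (\<forall>j. ((\<lambda>a. phi a j * (inverse (xc z) ^ (a + 1) * deriv xc z)) has_sum (z^2) powi j) {a. 0 < a})"
proof -
  obtain r where r: "r > 0" "\<forall>t\<in>ball 0 r. 1 - s * \<alpha> * t \<noteq> 0 \<and> 1 - s * \<beta> * t \<noteq> 0 \<and>
     (1 - s * \<beta> * t) / (1 - s * \<alpha> * t) \<notin> \<real>\<^sub>\<le>\<^sub>0"
    using z_of_radius by blast
  define tz where "tz = (\<lambda>z. (z^2 - 1) / (s * (\<alpha> * z^2 - \<beta>)))"
  have "(tz \<longlongrightarrow> tz 1) (nhds 1)"
    unfolding tz_def using s_nz \<alpha>_minus_\<beta>_nz by (auto intro!: tendsto_eq_intros filterlim_ident)
  hence "\<forall>\<^sub>F z in nhds 1. dist (tz z) (tz 1) < r" using r(1) by (rule tendstoD)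
  moreover have "((\<lambda>z. \<alpha> * z^2 - \<beta>) \<longlongrightarrow> \<alpha> - \<beta>) (nhds 1)"
    by (auto intro!: tendsto_eq_intros filterlim_ident)
  hence "\<forall>\<^sub>F z in nhds 1. \<alpha> * z^2 - \<beta> \<noteq> 0" using \<alpha>_minus_\<beta>_nz by (rule tendsto_imp_eventually_ne)
  ultimately have "\<forall>\<^sub>F z in nhds 1. tz z \<in> ball 0 r \<and> \<alpha> * z^2 - \<beta> \<noteq> 0"
    by eventually_elim (simp add: tz_def dist_commute)
  then obtain d where d: "d > 0" "\<And>z. dist z 1 < d \<Longrightarrow> tz z \<in> ball 0 r \<and> \<alpha> * z^2 - \<beta> \<noteq> 0"
    by (auto simp: eventually_nhds_metric)
  show ?thesis
  proof (intro exI[of _ "min d 1"] conjI allI impI)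
    show "min d 1 > 0" using d by simp
    fix z j assume z: "0 < cmod (z - 1) \<and> cmod (z - 1) < min d 1"
    define t where "t = tz z"
    have t: "t \<in> ball 0 r" and ab: "\<alpha> * z^2 - \<beta> \<noteq> 0" using d(2)[of z] z by (auto simp: t_def dist_norm)
    \<comment> \<open>Positive real part makes z the principal square root of z^2 and excludes z =
      -1.\<close>
    have "\<bar>Re (z - 1)\<bar> < 1" using z abs_Re_le_cmod[of "z - 1"] by linarith
    hence Re: "0 < Re z" by simp
    have z1: "z^2 - 1 \<noteq> 0"
    proof
      assume "z^2 - 1 = 0"
      hence "z = 1 \<or> z = - 1" by (simp add: power2_eq_1_iff)
      thus False using z Re by auto
    qed
    have z0: "z \<noteq> 0" using Re by auto
    have x: "inverse (xc z) = t" by (simp add: t_def tz_def curve_x_def)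
    have A: "1 - s * \<alpha> * t = (\<alpha> - \<beta>) / (\<alpha> * z^2 - \<beta>)"
      using ab s_nz by (simp add: t_def tz_def field_simps)
    have B: "1 - s * \<beta> * t = (\<alpha> - \<beta>) * z^2 / (\<alpha> * z^2 - \<beta>)"
      using ab s_nz by (simp add: t_def tz_def field_simps)
    have zt: "z_of t = z"
    proof -
      have "z_of t = csqrt (z^2)" unfolding z_of_def A B using ab \<alpha>_minus_\<beta>_nz by simp
      thus ?thesis using Re by (simp add: csqrt_square)
    qed
    have "2 * z * deriv z_of t * ((\<alpha> - \<beta>) / (\<alpha> * z^2 - \<beta>)) = s * (\<alpha> * z^2 - \<beta>)"
      using z_of_deriv[OF r t] unfolding zt A .
    hence dz: "deriv z_of t = s * (\<alpha> * z^2 - \<beta>)^2 / (2 * z * (\<alpha> - \<beta>))"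
      using ab z0 \<alpha>_minus_\<beta>_nz by (simp add: field_simps power2_eq_square)
    \<comment> \<open>The chain rule for dz/dt, dt/dx = - t^2 and dx/dz.\<close>
    have one: "- (t^2 * deriv xc z) * deriv z_of t = 1"
    proof -
      have "(w / (s * e))^2 * (2 * s * z * f / w^2) * (s * e^2 / (2 * z * f)) = 1"
        if "w \<noteq> 0" "e \<noteq> 0" "f \<noteq> 0" for w e f
        using that z0 s_nz by (simp add: field_simps power2_eq_square)
      note gen = this[OF z1 ab \<alpha>_minus_\<beta>_nz]
      have step: "- (t^2 * deriv xc z) * deriv z_of t =
          t^2 * (2 * s * z * (\<alpha> - \<beta>) / (z^2 - 1)^2) * (s * (\<alpha> * z^2 - \<beta>)^2 / (2 * z * (\<alpha> - \<beta>)))"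
        unfolding dz using z1 by (subst xc_deriv) simp_all
      have t2: "t^2 = ((z^2 - 1) / (s * (\<alpha> * z^2 - \<beta>)))^2" by (simp add: t_def tz_def)
      show ?thesis unfolding step unfolding t2 by (rule gen)
    qed
    have "((\<lambda>n. - phi (Suc n) j * t ^ n) has_sum z_diff j t) UNIV" by (rule z_diff_series[OF r t])
    from has_sum_cmult_left[OF this, of "- (t^2 * deriv xc z)"]
    have "((\<lambda>n. phi (Suc n) j * (t ^ (Suc n + 1) * deriv xc z)) has_sum (z_diff j t * - (t^2 * deriv xc z))) UNIV"
      by (simp add: power2_eq_square mult_ac)
    also have "z_diff j t * - (t^2 * deriv xc z) = (- (t^2 * deriv xc z) * deriv z_of t) * (z^2) powi j"
      unfolding z_diff_def zt by (simp only: mult_ac)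
    finally have "((\<lambda>n. phi (Suc n) j * (t ^ (Suc n + 1) * deriv xc z)) has_sum (z^2) powi j) UNIV"
      unfolding one by simp
    also have "?this \<longleftrightarrow> ((\<lambda>a. phi a j * (t ^ (a + 1) * deriv xc z)) has_sum (z^2) powi j) {a. 0 < a}"
      by (rule has_sum_reindex_bij_witness[of _ "\<lambda>a. a - 1" Suc]) auto
    finally show "((\<lambda>a. phi a j * (inverse (xc z) ^ (a + 1) * deriv xc z)) has_sum (z^2) powi j) {a. 0 < a}"
      unfolding x .
  qed
qed

lemma tensor_has_sum:
  assumes "is_tensor n T" "length zs = n"
    and "\<And>z j. z \<in> set zs \<Longrightarrow>
      ((\<lambda>a. phi a j * (inverse (xc z) ^ (a + 1) * deriv xc z)) has_sum (z^2) powi j) {a. 0 < a}"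
  shows "((\<lambda>a. tensor_ev T (map phi a) * (\<Prod>i<n. inverse (xc (zs ! i)) ^ (a ! i + 1) * deriv xc (zs ! i)))
    has_sum tensor_ev T (map pw zs)) {a. length a = n \<and> (\<forall>k\<in>set a. 0 < k)}"
  using assms(1)
proof (induction T)
  case (Cons ce T)
  obtain d e where ce: "ce = (d, e)" by force
  let ?P = "\<lambda>a. \<Prod>i<n. inverse (xc (zs ! i)) ^ (a ! i + 1) * deriv xc (zs ! i)"
  let ?A = "{a. length a = n \<and> (\<forall>k\<in>set a. 0 < k)}"
  have e: "length e = n" using Cons.prems ce by simp
  have "((\<lambda>a. \<Prod>i<n. phi (a ! i) (e ! i) * (inverse (xc (zs ! i)) ^ (a ! i + 1) * deriv xc (zs ! i)))
     has_sum (\<Prod>i<n. ((zs ! i)^2) powi (e ! i))) {a. length a = n \<and> (\<forall>k\<in>set a. k \<in> {a. 0 < a})}"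
    using assms(2,3) by (intro has_sum_prod_lists) auto
  also have "(\<Prod>i<n. ((zs ! i)^2) powi (e ! i)) = monom_ev (map pw zs) e"
    using e assms(2) by (subst monom_ev_conv_prod[of _ n]) (auto simp: pw_def)
  finally have "((\<lambda>a. \<Prod>i<n. phi (a ! i) (e ! i) * (inverse (xc (zs ! i)) ^ (a ! i + 1) * deriv xc (zs ! i)))
     has_sum monom_ev (map pw zs) e) ?A" by simp
  also have "?this \<longleftrightarrow> ((\<lambda>a. monom_ev (map phi a) e * ?P a) has_sum monom_ev (map pw zs) e) ?A"
    by (intro has_sum_cong) (auto simp: monom_ev_conv_prod[of _ n] e prod.distrib)
  finally have "((\<lambda>a. d * (monom_ev (map phi a) e * ?P a) + tensor_ev T (map phi a) * ?P a)
     has_sum (d * monom_ev (map pw zs) e + tensor_ev T (map pw zs))) ?A"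
    using Cons ce by (intro has_sum_add has_sum_cmult_right) auto
  thus ?case by (simp add: ce algebra_simps)
qed auto

section \<open>Even Laurent polynomials in the charts z and 1/z\<close>

lemma even_laurent_poly_tensor: "is_tensor n T \<Longrightarrow> even_laurent_poly n (\<lambda>zs. tensor_ev T (map pw zs))"
proof (induction T)
  case Nil
  show ?case unfolding even_laurent_poly_def by (intro exI[of _ "{}"]) auto
next
  case (Cons ce T)
  obtain d e where ce: "ce = (d, e)" by force
  have e: "length e = n" using Cons.prems ce by simp
  define e' where "e' = map (\<lambda>j. 2 * j) e"
  obtain E coef where E: "finite E" "\<forall>e\<in>E. length e = n \<and> (\<forall>k\<in>set e. even k)"
    "\<And>zs. length zs = n \<Longrightarrow> \<forall>z\<in>set zs. z \<noteq> 0 \<Longrightarrow>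
       tensor_ev T (map pw zs) = (\<Sum>e\<in>E. coef e * (\<Prod>i<n. (zs ! i) powi (e ! i)))"
    using Cons unfolding even_laurent_poly_def ce by auto
  show ?case unfolding even_laurent_poly_def
  \<comment> \<open>The sum of the two parts covers the case that the exponent vector
    \<open>e'\<close> already belongs to \<open>E\<close>.\<close>
  proof (intro exI[of _ "insert e' E"] exI[of _ "\<lambda>x. (if x = e' then d else 0) + (if x \<in> E then coef x else 0)"]
      conjI allI impI)
    show "\<forall>x\<in>insert e' E. length x = n \<and> (\<forall>k\<in>set x. even k)" using E(2) e by (auto simp: e'_def)
    fix zs :: "complex list" assume zs: "length zs = n \<and> (\<forall>z\<in>set zs. z \<noteq> 0)"
    have "(\<Sum>x\<in>insert e' E. ((if x = e' then d else 0) + (if x \<in> E then coef x else 0)) * (\<Prod>i<n. (zs ! i) powi (x ! i))) =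
      (\<Sum>x\<in>insert e' E. (if x = e' then d * (\<Prod>i<n. (zs ! i) powi (x ! i)) else 0)) +
      (\<Sum>x\<in>insert e' E. (if x \<in> E then coef x * (\<Prod>i<n. (zs ! i) powi (x ! i)) else 0))"
      unfolding sum.distrib[symmetric] by (intro sum.cong) (auto simp: algebra_simps)
    also have "(\<Sum>x\<in>insert e' E. (if x \<in> E then coef x * (\<Prod>i<n. (zs ! i) powi (x ! i)) else 0)) =
       (\<Sum>x\<in>E. coef x * (\<Prod>i<n. (zs ! i) powi (x ! i)))"
      by (rule sum.mono_neutral_cong_right) (use E(1) in auto)
    also have "(\<Sum>x\<in>insert e' E. (if x = e' then d * (\<Prod>i<n. (zs ! i) powi (x ! i)) else 0)) =
       d * (\<Prod>i<n. (zs ! i) powi (e' ! i))"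
      using E(1) by simp
    also have "(\<Prod>i<n. (zs ! i) powi (e' ! i)) = monom_ev (map pw zs) e"
      using e zs by (subst monom_ev_conv_prod[of _ n]) (auto simp: pw_def e'_def power2_power_int)
    finally show "tensor_ev (ce # T) (map pw zs) = (\<Sum>x\<in>insert e' E. ((if x = e' then d else 0) +
        (if x \<in> E then coef x else 0)) * (\<Prod>i<n. (zs ! i) powi (x ! i)))"
      using E(3) zs by (simp add: ce)
  qed (use E in auto)
qed

text \<open>Substitution z = 1/w with dz = - dw / w^2: each variable contributes a sign and turns
  the exponent j of z^2 into the exponent -j-1 of w^2, so degrees stay even.\<close>

definition flip_tensor :: "nat \<Rightarrow> tensor \<Rightarrow> tensor" where
  "flip_tensor n T = map (\<lambda>(d, e). ((-1) ^ n * d, map (\<lambda>j. - j - 1) e)) T"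

lemma is_tensor_flip: "is_tensor n T \<Longrightarrow> is_tensor n (flip_tensor n T)"
  by (auto simp: flip_tensor_def is_tensor_def)

lemma tensor_ev_flip:
  assumes "is_tensor n T" "length zs = n" "\<forall>z\<in>set zs. z \<noteq> 0"
  shows "tensor_ev (flip_tensor n T) (map pw zs) =
    tensor_ev T (map pw (map inverse zs)) * (\<Prod>i<n. - inverse ((zs ! i)^2))"
  using assms(1)
proof (induction T)
  case (Cons ce T)
  obtain d e where ce: "ce = (d, e)" by force
  have e: "length e = n" using Cons.prems ce by simp
  have "monom_ev (map pw zs) (map (\<lambda>j. - j - 1) e) = (\<Prod>i<n. ((zs ! i)^2) powi (- (e ! i) - 1))"
    using e assms(2) by (subst monom_ev_conv_prod[of _ n]) (auto simp: pw_def)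
  also have "\<dots> = (\<Prod>i<n. ((inverse (zs ! i))^2) powi (e ! i) * inverse ((zs ! i)^2))"
  proof (intro prod.cong refl)
    fix i assume "i \<in> {..<n}"
    hence "zs ! i \<noteq> 0" using assms by simp
    thus "((zs ! i)^2) powi (- (e ! i) - 1) = ((inverse (zs ! i))^2) powi (e ! i) * inverse ((zs ! i)^2)"
      by (simp add: power_int_diff power_int_minus power_int_inverse power_inverse divide_inverse)
  qed
  also have "\<dots> = monom_ev (map pw (map inverse zs)) e * (\<Prod>i<n. inverse ((zs ! i)^2))"
    using e assms(2) by (subst monom_ev_conv_prod[of _ n]) (auto simp: pw_def prod.distrib)
  finally have m: "monom_ev (map pw zs) (map (\<lambda>j. - j - 1) e) =
    monom_ev (map pw (map inverse zs)) e * (\<Prod>i<n. inverse ((zs ! i)^2))" .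
  have "(\<Prod>i<n. - inverse ((zs ! i)^2)) = (-1) ^ n * (\<Prod>i<n. inverse ((zs ! i)^2))"
    by (subst prod_uminus) simp
  with Cons m show ?case by (simp add: ce flip_tensor_def algebra_simps)
qed (simp add: flip_tensor_def)

end

theorem theorem4p1:
  fixes s su sv :: complex
    and c :: "nat \<Rightarrow> nat multiset \<Rightarrow> complex"
    and om :: "nat \<Rightarrow> nat \<Rightarrow> complex list \<Rightarrow> complex"
    and g n :: nat
  assumes "s \<noteq> 0" and "su \<noteq> 0" and "sv \<noteq> 0"
    and "dessin_free_energy s (su^2) (sv^2) c"
    and "EO_invariants s (dessin_alpha su sv) (dessin_beta su sv) om"
    and "1 \<le> n" and "2 < 2 * g + n"
  shows "\<exists>w wt. even_laurent_poly n w \<and> even_laurent_poly n wt \<and>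
     (\<exists>r>0. \<forall>zs. length zs = n \<and> (\<forall>z\<in>set zs. 0 < cmod (z - 1) \<and> cmod (z - 1) < r) \<longrightarrow>
        ((\<lambda>a. G_coeff c g a *
              (\<Prod>i<n. inverse (curve_x s (dessin_alpha su sv) (dessin_beta su sv) (zs ! i)) ^ (a ! i + 1)
                      * deriv (curve_x s (dessin_alpha su sv) (dessin_beta su sv)) (zs ! i)))
          has_sum w zs) {a. length a = n \<and> (\<forall>k\<in>set a. 0 < k)}) \<and>
     (\<forall>zs. length zs = n \<and> (\<forall>z\<in>set zs. z \<noteq> 0) \<longrightarrow>
        wt zs = w (map inverse zs) * (\<Prod>i<n. - inverse ((zs ! i)^2))) \<and>
     (\<forall>zs. length zs = n \<and> (\<forall>z\<in>set zs. z \<noteq> 0) \<longrightarrow> om g n zs = w zs)"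
proof -
  interpret dessin_curve s su sv by unfold_locales (use assms in auto)
  interpret dessin_recursion s su sv c om
    by unfold_locales (use assms in \<open>auto simp: \<alpha>_def \<beta>_def\<close>)
  obtain T where T: "represents g n T" using represents_exists[OF assms(6,7)] by blast
  note rep = representsD[OF T]
  obtain r where r: "r > 0" "\<And>z j. 0 < cmod (z - 1) \<Longrightarrow> cmod (z - 1) < r \<Longrightarrow>
     ((\<lambda>a. phi a j * (inverse (xc z) ^ (a + 1) * deriv xc z)) has_sum (z^2) powi j) {a. 0 < a}"
    using expansion_radius by blast
  define w where "w zs = tensor_ev T (map pw zs)" for zs
  define wt where "wt zs = tensor_ev (flip_tensor n T) (map pw zs)" for zs
  show ?thesis
  proof (rule exI[of _ w], rule exI[of _ wt], intro conjI)
    show "even_laurent_poly n w" "even_laurent_poly n wt"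
      unfolding w_def wt_def by (intro even_laurent_poly_tensor is_tensor_flip rep(1))+
    show "\<exists>r>0. \<forall>zs. length zs = n \<and> (\<forall>z\<in>set zs. 0 < cmod (z - 1) \<and> cmod (z - 1) < r) \<longrightarrow>
        ((\<lambda>a. G_coeff c g a *
              (\<Prod>i<n. inverse (curve_x s (dessin_alpha su sv) (dessin_beta su sv) (zs ! i)) ^ (a ! i + 1)
                      * deriv (curve_x s (dessin_alpha su sv) (dessin_beta su sv)) (zs ! i)))
          has_sum w zs) {a. length a = n \<and> (\<forall>k\<in>set a. 0 < k)}"
    proof (intro exI[of _ r] conjI allI impI r(1))
      fix zs assume zs: "length zs = n \<and> (\<forall>z\<in>set zs. 0 < cmod (z - 1) \<and> cmod (z - 1) < r)"
      have "((\<lambda>a. tensor_ev T (map phi a) * (\<Prod>i<n. inverse (xc (zs ! i)) ^ (a ! i + 1) * deriv xc (zs ! i)))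
        has_sum w zs) {a. length a = n \<and> (\<forall>k\<in>set a. 0 < k)}"
        unfolding w_def using zs by (intro tensor_has_sum[OF rep(1)] r(2)) auto
      also have "?this \<longleftrightarrow> ((\<lambda>a. G_coeff c g a * (\<Prod>i<n. inverse (xc (zs ! i)) ^ (a ! i + 1) * deriv xc (zs ! i)))
        has_sum w zs) {a. length a = n \<and> (\<forall>k\<in>set a. 0 < k)}"
        by (intro has_sum_cong) (auto simp: rep(3))
      finally show "((\<lambda>a. G_coeff c g a *
              (\<Prod>i<n. inverse (curve_x s (dessin_alpha su sv) (dessin_beta su sv) (zs ! i)) ^ (a ! i + 1)
                      * deriv (curve_x s (dessin_alpha su sv) (dessin_beta su sv)) (zs ! i)))
          has_sum w zs) {a. length a = n \<and> (\<forall>k\<in>set a. 0 < k)}"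
        unfolding \<alpha>_def \<beta>_def .
    qed
    show "\<forall>zs. length zs = n \<and> (\<forall>z\<in>set zs. z \<noteq> 0) \<longrightarrow>
        wt zs = w (map inverse zs) * (\<Prod>i<n. - inverse ((zs ! i)^2))"
      unfolding w_def wt_def using tensor_ev_flip[OF rep(1)] by blast
    show "\<forall>zs. length zs = n \<and> (\<forall>z\<in>set zs. z \<noteq> 0) \<longrightarrow> om g n zs = w zs"
      unfolding w_def using rep(2) by blast
  qed
qed

end
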